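(* Let $\mathbf{k}$ be an algebraically closed field of characteristic $p$ and let $u,v\ge1$ be integers. If $p=0$ or $p>u+v$, then $$W^{(u,v)}_{d,e}=0\quad\text{for } d\geq v,\ e\geq u,$$ where $W^{(u,v)}$ is the bi-graded Weyman module.
   Context: Koszul modules: for finite dimensional vector spaces $V_1,V_2$, $V=V_1\oplus V_2$, and a subspace $K\subseteq V_1\otimes V_2\subset\bigwedge^2V$, let $S=\operatorname{Sym}(V)$, bi-graded by $S_{1,0}=V_1$, $S_{0,1}=V_2$. The bi-graded Koszul module $W(V,K)$ has bi-degree $(d,e)$ component $W_{d,e}(V,K)$ equal to the middle homology of $$K\otimes S_{d,e}\to V_1\otimes S_{d,e+1}\oplus V_2\otimes S_{d+1,e}\to S_{d+1,e+1},$$ with maps $(v_1\otimes v_2)\otimes f\mapsto v_1\otimes v_2f-v_2\otimes v_1f$ and $v\otimes f\mapsto vf$. Weyman modules: let $U$ be a $2$-dimensional $\mathbf{k}$-vector space with basis $\{1,x\}$, identify $\operatorname{Sym}^dU$ with polynomials of degree $\le d$ in $x$ (zero if $d<0$), and identify $U\simeq U^\vee$ via $\bigwedge^2U\simeq\mathbf{k}$, $1\wedge x\mapsto1$, so that the divided power $\mathrm{D}^dU$ is $(\operatorname{Sym}^dU)^\vee$. Let $\iota_{u,v}:\operatorname{Sym}^{u-1}U\otimes\operatorname{Sym}^{v-1}U\to\operatorname{Sym}^uU\otimes\operatorname{Sym}^vU$, $f\otimes g\mapsto f\otimes xg-xf\otimes g$, and let $Q_{u,v}=\operatorname{Coker}(\iota_{u,v}\circ\iota_{u-1,v-1})$,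 with quotient map $\Psi_{u,v}:\operatorname{Sym}^uU\otimes\operatorname{Sym}^vU\to Q_{u,v}$. The bi-graded Weyman module is $W^{(u,v)}=W(V,K)$ with $V_1=\mathrm{D}^uU$, $V_2=\mathrm{D}^vU$, $V=V_1\oplus V_2$ and $K=Q_{u,v}^\vee$, viewed inside $V_1\otimes V_2$ via $\Psi_{u,v}^\vee$. *)

theory Defs
  imports
    "HOL-Algebra.Algebraic_Closure_Type"
    "HOL-Library.Poly_Mapping"
    "HOL-Library.Function_Algebras"
    "HOL-Library.Product_Plus"
    "HOL-Computational_Algebra.Polynomial"
begin

hide_const (open) Module.smult up_ring.coeff

section \<open>Quotient spaces and dual spaces\<close>

definition coset :: "'b::ab_group_add set \<Rightarrow> 'b \<Rightarrow> 'b set"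
  where "coset B z = (+) z ` B"

text \<open>The quotient \<open>Z / B\<close> of subspaces of an ambient vector space with scalar multiplication
  \<open>sc\<close>. Only the module part of the record is meaningful; see \<open>module_quotient_space\<close>.\<close>

definition quotient_space ::
    "('a \<Rightarrow> 'b \<Rightarrow> 'b) \<Rightarrow> 'b::ab_group_add set \<Rightarrow> 'b set \<Rightarrow> ('a, 'b set) module"
  where "quotient_space sc Z B =
    \<lparr>carrier = coset B ` Z,
     monoid.mult = undefined, one = undefined,
     zero = B,
     add = (\<lambda>C D. {x + y |x y. x \<in> C \<and> y \<in> D}),
     module.smult = (\<lambda>c C. {sc c x + b |x b. x \<in> C \<and> b \<in> B})\<rparr>"

lemma module_quotient_space:
  fixes sc :: "'a::field \<Rightarrow> 'b::ab_group_add \<Rightarrow> 'b"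
  assumes "vector_space sc" and Z: "module.subspace sc Z" and B: "module.subspace sc B"
    and "B \<subseteq> Z"
  shows "module (ring_of_type_algebra :: 'a ring) (quotient_space sc Z B)"
proof -
  interpret sc: vector_space sc by fact
  note sub = sc.subspace_0 sc.subspace_add sc.subspace_scale sc.subspace_neg sc.subspace_diff
  have eq: "coset B x = coset B y \<longleftrightarrow> x - y \<in> B" for x y
  proof
    assume "coset B x = coset B y"
    moreover have "x \<in> coset B x" using sub(1)[OF B] by (force simp: coset_def)
    ultimately obtain b where "b \<in> B" "x = y + b" by (auto simp: coset_def)
    thus "x - y \<in> B" by simp
  next
    assume *: "x - y \<in> B"
    show "coset B x = coset B y"
    proof (intro equalityI subsetI)
      fix t assume "t \<in> coset B x"
      then obtain b where "b \<in> B" "t = x + b" by (auto simp: coset_def)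
      hence "t = y + ((x - y) + b)" "(x - y) + b \<in> B" using * sub(2)[OF B] by auto
      thus "t \<in> coset B y" unfolding coset_def by blast
    next
      fix t assume "t \<in> coset B y"
      then obtain b where "b \<in> B" "t = y + b" by (auto simp: coset_def)
      hence "t = x + (b - (x - y))" "b - (x - y) \<in> B" using * sub(5)[OF B] by auto
      thus "t \<in> coset B x" unfolding coset_def by blast
    qed
  qed
  have B0: "B = coset B 0" by (auto simp: coset_def)
  have plus: "{x' + y' |x' y'. x' \<in> coset B x \<and> y' \<in> coset B y} = coset B (x + y)" for x y
  proof (intro equalityI subsetI)
    fix t assume "t \<in> {x' + y' |x' y'. x' \<in> coset B x \<and> y' \<in> coset B y}"
    then obtain a b where "a \<in> B" "b \<in> B" "t = (x + a) + (y + b)" by (auto simp: coset_def)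
    hence "t = (x + y) + (a + b)" "a + b \<in> B" using sub(2)[OF B] by (auto simp: algebra_simps)
    thus "t \<in> coset B (x + y)" unfolding coset_def by blast
  next
    fix t assume "t \<in> coset B (x + y)"
    then obtain b where "b \<in> B" "t = (x + y) + b" by (auto simp: coset_def)
    hence "t = (x + 0) + (y + b)" "x + 0 \<in> coset B x" "y + b \<in> coset B y"
      using sub(1)[OF B] by (auto simp: coset_def algebra_simps)
    thus "t \<in> {x' + y' |x' y'. x' \<in> coset B x \<and> y' \<in> coset B y}" by blast
  qed
  have scal: "{sc c x' + b |x' b. x' \<in> coset B x \<and> b \<in> B} = coset B (sc c x)" for c x
  proof (intro equalityI subsetI)
    fix t assume "t \<in> {sc c x' + b |x' b. x' \<in> coset B x \<and> b \<in> B}"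
    then obtain a b where "a \<in> B" "b \<in> B" "t = sc c (x + a) + b" by (auto simp: coset_def)
    hence "t = sc c x + (sc c a + b)" "sc c a + b \<in> B"
      using sub(2,3)[OF B] by (auto simp: sc.scale_right_distrib add.assoc)
    thus "t \<in> coset B (sc c x)" unfolding coset_def by blast
  next
    fix t assume "t \<in> coset B (sc c x)"
    then obtain b where "b \<in> B" "t = sc c x + b" by (auto simp: coset_def)
    moreover have "x \<in> coset B x" using sub(1)[OF B] by (force simp: coset_def)
    ultimately show "t \<in> {sc c x' + b |x' b. x' \<in> coset B x \<and> b \<in> B}" by blast
  qed
  let ?M = "quotient_space sc Z B"
  have car: "C \<in> carrier ?M \<longleftrightarrow> (\<exists>z\<in>Z. C = coset B z)" for C
    by (auto simp: quotient_space_def)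
  have add: "coset B x \<oplus>\<^bsub>?M\<^esub> coset B y = coset B (x + y)" for x y
    using plus by (simp add: quotient_space_def)
  have zero: "\<zero>\<^bsub>?M\<^esub> = coset B 0"
    using B0 by (simp add: quotient_space_def)
  have sm: "c \<odot>\<^bsub>?M\<^esub> coset B x = coset B (sc c x)" for c x
    using scal by (simp add: quotient_space_def)
  have R: "carrier (ring_of_type_algebra :: 'a ring) = UNIV"
    "x \<oplus>\<^bsub>ring_of_type_algebra\<^esub> y = x + y" "x \<otimes>\<^bsub>ring_of_type_algebra\<^esub> y = x * y"
    "\<one>\<^bsub>ring_of_type_algebra\<^esub> = (1::'a)" for x y :: 'a
    by (simp_all add: ring_of_type_algebra_def)
  show ?thesis
  proof (rule moduleI)
    show "cring (ring_of_type_algebra :: 'a ring)" by (rule cring_from_type_algebra)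
    show "abelian_group ?M"
    proof (rule abelian_groupI)
      fix C assume "C \<in> carrier ?M"
      then obtain z where z: "z \<in> Z" "C = coset B z" by (auto simp: car)
      thus "\<exists>D\<in>carrier ?M. D \<oplus>\<^bsub>?M\<^esub> C = \<zero>\<^bsub>?M\<^esub>"
        by (intro bexI[of _ "coset B (- z)"]) (auto simp: car add zero sub(4)[OF Z])
    qed (use sub(1,2)[OF Z] in \<open>auto simp: car add zero algebra_simps\<close>)
  qed (use sub(3)[OF Z] in \<open>auto simp: car add zero sm R sc.scale_left_distrib sc.scale_right_distrib\<close>)
qed

definition dual_space :: "('a::field, 'b) module \<Rightarrow> ('b \<Rightarrow> 'a) set"
  where "dual_space M = {\<phi> \<in> extensional (carrier M).
    (\<forall>x \<in> carrier M. \<forall>y \<in> carrier M. \<phi> (x \<oplus>\<^bsub>M\<^esub> y) = \<phi> x + \<phi> y) \<and>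
    (\<forall>c. \<forall>x \<in> carrier M. \<phi> (c \<odot>\<^bsub>M\<^esub> x) = c * \<phi> x)}"

section \<open>Bi-graded Koszul modules\<close>

text \<open>The spaces \<open>V\<^sub>1\<close>, \<open>V\<^sub>2\<close> are given with bases indexed by finite sets \<open>I\<close>, \<open>J\<close>:
  for a space \<open>M\<close> we encode \<open>k\<^sup>I \<otimes> M\<close> as the functions \<open>I \<rightarrow> M\<close>, extended by \<open>0\<close>.
  Thus \<open>V\<^sub>1\<close>, \<open>V\<^sub>2\<close>, \<open>V\<^sub>1 \<otimes> V\<^sub>2\<close> are \<open>coord_space L UNIV\<close> with \<open>L\<close> being \<open>I\<close>, \<open>J\<close>, \<open>I \<times> J\<close>.\<close>

definition coord_space :: "'i set \<Rightarrow> 'm::zero set \<Rightarrow> ('i \<Rightarrow> 'm) set"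
  where "coord_space L M = {f. (\<forall>i \<in> L. f i \<in> M) \<and> (\<forall>i. i \<notin> L \<longrightarrow> f i = 0)}"

text \<open>\<open>Sym (V\<^sub>1 \<oplus> V\<^sub>2)\<close> is the polynomial ring in the variables \<open>Inl i\<close> (\<open>i \<in> I\<close>) and
  \<open>Inr j\<close> (\<open>j \<in> J\<close>), which are the basis vectors of \<open>V\<^sub>1\<close> and \<open>V\<^sub>2\<close>.\<close>

type_synonym ('i, 'j, 'a) sym_alg = "(('i + 'j) \<Rightarrow>\<^sub>0 nat) \<Rightarrow>\<^sub>0 'a"

definition sym_var :: "'i + 'j \<Rightarrow> ('i, 'j, 'a::field) sym_alg"
  where "sym_var s = Poly_Mapping.single (Poly_Mapping.single s 1) 1"

definition sym_scale :: "'a::field \<Rightarrow> ('i, 'j, 'a) sym_alg \<Rightarrow> ('i, 'j, 'a) sym_alg"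
  where "sym_scale c F = Poly_Mapping.single 0 c * F"

definition sym_comp :: "'i set \<Rightarrow> 'j set \<Rightarrow> nat \<Rightarrow> nat \<Rightarrow> ('i, 'j, 'a::field) sym_alg set"
  where "sym_comp I J d e = {F. \<forall>m \<in> Poly_Mapping.keys F.
    Poly_Mapping.keys m \<subseteq> I <+> J \<and>
    (\<Sum>i\<in>I. Poly_Mapping.lookup m (Inl i)) = d \<and>
    (\<Sum>j\<in>J. Poly_Mapping.lookup m (Inr j)) = e}"

text \<open>A pure tensor \<open>w \<otimes> F\<close> in \<open>k\<^sup>L \<otimes> Sym V\<close>.\<close>

definition pure_tensor ::
    "('l \<Rightarrow> 'a::field) \<Rightarrow> ('i, 'j, 'a) sym_alg \<Rightarrow> 'l \<Rightarrow> ('i, 'j, 'a) sym_alg"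
  where "pure_tensor w F = (\<lambda>l. sym_scale (w l) F)"

definition tensor_scale ::
    "'a::field \<Rightarrow> ('l \<Rightarrow> ('i, 'j, 'a) sym_alg) \<Rightarrow> 'l \<Rightarrow> ('i, 'j, 'a) sym_alg"
  where "tensor_scale c T = (\<lambda>l. sym_scale c (T l))"

definition pair_scale ::
    "'a::field \<Rightarrow> ('i \<Rightarrow> ('i, 'j, 'a) sym_alg) \<times> ('j \<Rightarrow> ('i, 'j, 'a) sym_alg) \<Rightarrow>
      ('i \<Rightarrow> ('i, 'j, 'a) sym_alg) \<times> ('j \<Rightarrow> ('i, 'j, 'a) sym_alg)"
  where "pair_scale c = map_prod (tensor_scale c) (tensor_scale c)"

lemma sym_scale_simps:
  "sym_scale c (F + G) = sym_scale c F + sym_scale c G"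
  "sym_scale (c + d) F = sym_scale c F + sym_scale d F"
  "sym_scale c (sym_scale d F) = sym_scale (c * d) F"
  "sym_scale 1 F = F"
  "sym_scale c F * G = sym_scale c (F * G)"
  "F * sym_scale c G = sym_scale c (F * G)"
proof -
  show "sym_scale c (sym_scale d F) = sym_scale (c * d) F"
    by (simp add: sym_scale_def mult_single flip: mult.assoc)
  show "F * sym_scale c G = sym_scale c (F * G)"
    unfolding sym_scale_def by (rule mult.left_commute)
qed (simp_all add: sym_scale_def distrib_left distrib_right Poly_Mapping.single_add mult.assoc)

lemma vector_space_scales:
  "vector_space sym_scale" "vector_space tensor_scale" "vector_space pair_scale"
  by unfold_locales
    (auto simp: pair_scale_def tensor_scale_def sym_scale_simps fun_eq_iff plus_prod_def)

text \<open>\<open>K \<otimes> S\<^sub>d\<^sub>,\<^sub>e\<close> as a subspace of \<open>V\<^sub>1 \<otimes> V\<^sub>2 \<otimes> S\<^sub>d\<^sub>,\<^sub>e\<close>.\<close>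

definition koszul_left :: "'i set \<Rightarrow> 'j set \<Rightarrow> ('i \<times> 'j \<Rightarrow> 'a::field) set \<Rightarrow> nat \<Rightarrow> nat \<Rightarrow>
    ('i \<times> 'j \<Rightarrow> ('i, 'j, 'a) sym_alg) set"
  where "koszul_left I J K d e =
    module.span tensor_scale {pure_tensor w F |w F. w \<in> K \<and> F \<in> sym_comp I J d e}"

definition koszul_mid :: "'i set \<Rightarrow> 'j set \<Rightarrow> nat \<Rightarrow> nat \<Rightarrow>
    (('i \<Rightarrow> ('i, 'j, 'a::field) sym_alg) \<times> ('j \<Rightarrow> ('i, 'j, 'a) sym_alg)) set"
  where "koszul_mid I J d e =
    coord_space I (sym_comp I J d (e + 1)) \<times> coord_space J (sym_comp I J (d + 1) e)"

text \<open>The two differentials, which on pure tensors are \<open>(v\<^sub>1 \<otimes> v\<^sub>2) \<otimes> F \<mapsto> v\<^sub>1 \<otimes> v\<^sub>2F - v\<^sub>2 \<otimes> v\<^sub>1F\<close> and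
  \<open>v \<otimes> F \<mapsto> vF\<close>; see \<open>koszul_d2_pure\<close> and \<open>koszul_d1_pure\<close>.\<close>

definition koszul_d2 :: "'i set \<Rightarrow> 'j set \<Rightarrow> ('i \<times> 'j \<Rightarrow> ('i, 'j, 'a::field) sym_alg) \<Rightarrow>
    ('i \<Rightarrow> ('i, 'j, 'a) sym_alg) \<times> ('j \<Rightarrow> ('i, 'j, 'a) sym_alg)"
  where "koszul_d2 I J T =
    (\<lambda>i. \<Sum>j\<in>J. sym_var (Inr j) * T (i, j), \<lambda>j. - (\<Sum>i\<in>I. sym_var (Inl i) * T (i, j)))"

definition koszul_d1 :: "'i set \<Rightarrow> 'j set \<Rightarrow>
    ('i \<Rightarrow> ('i, 'j, 'a::field) sym_alg) \<times> ('j \<Rightarrow> ('i, 'j, 'a) sym_alg) \<Rightarrow> ('i, 'j, 'a) sym_alg"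
  where "koszul_d1 I J AB =
    (\<Sum>i\<in>I. sym_var (Inl i) * fst AB i) + (\<Sum>j\<in>J. sym_var (Inr j) * snd AB j)"

definition sym_linear :: "('l \<Rightarrow> 'i + 'j) \<Rightarrow> 'l set \<Rightarrow> ('l \<Rightarrow> 'a::field) \<Rightarrow> ('i, 'j, 'a) sym_alg"
  where "sym_linear h L w = (\<Sum>l\<in>L. sym_scale (w l) (sym_var (h l)))"

lemma koszul_d2_pure:
  "koszul_d2 I J (pure_tensor (\<lambda>(i, j). v1 i * v2 j) F) =
    (pure_tensor v1 (sym_linear Inr J v2 * F), - pure_tensor v2 (sym_linear Inl I v1 * F))"
proof -
  interpret vector_space sym_scale by (rule vector_space_scales)
  show ?thesis
    by (simp add: koszul_d2_def pure_tensor_def sym_linear_def fun_eq_iff sum_distrib_left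
        sum_distrib_right sym_scale_simps scale_sum_right mult.commute)
qed

lemma koszul_d1_pure:
  "koszul_d1 I J (pure_tensor v1 F, 0) = sym_linear Inl I v1 * F"
  "koszul_d1 I J (0, pure_tensor v2 F) = sym_linear Inr J v2 * F"
  by (simp_all add: koszul_d1_def pure_tensor_def sym_linear_def sum_distrib_right
      sym_scale_simps)

lemma koszul_d1_d2: "koszul_d1 I J (koszul_d2 I J T) = 0"
proof -
  have "(\<Sum>i\<in>I. \<Sum>j\<in>J. sym_var (Inl i) * (sym_var (Inr j) * T (i, j))) =
      (\<Sum>j\<in>J. \<Sum>i\<in>I. sym_var (Inr j) * (sym_var (Inl i) * T (i, j)))"
    by (subst sum.swap) (simp add: mult.left_commute)
  thus ?thesis
    by (simp add: koszul_d1_def koszul_d2_def sum_distrib_left sum_negf)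
qed

text \<open>The component \<open>W\<^sub>d\<^sub>,\<^sub>e(V, K)\<close> as a vector space.\<close>

definition koszul_module :: "'i set \<Rightarrow> 'j set \<Rightarrow> ('i \<times> 'j \<Rightarrow> 'a::field) set \<Rightarrow> nat \<Rightarrow> nat \<Rightarrow>
    ('a, (('i \<Rightarrow> ('i, 'j, 'a) sym_alg) \<times> ('j \<Rightarrow> ('i, 'j, 'a) sym_alg)) set) module"
  where "koszul_module I J K d e = quotient_space pair_scale
    {AB \<in> koszul_mid I J d e. koszul_d1 I J AB = 0}
    (koszul_d2 I J ` koszul_left I J K d e)"

lemma sym_var_mult_comp:
  fixes F :: "('i, 'j, 'a::field) sym_alg"
  assumes "finite I" "finite J" and F: "F \<in> sym_comp I J d e"
  shows "i \<in> I \<Longrightarrow> sym_var (Inl i) * F \<in> sym_comp I J (d + 1) e"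
    and "j \<in> J \<Longrightarrow> sym_var (Inr j) * F \<in> sym_comp I J d (e + 1)"
proof -
  have *: "\<exists>n\<in>Poly_Mapping.keys F. m = Poly_Mapping.single s 1 + n"
    if "m \<in> Poly_Mapping.keys (sym_var s * F)" for s m
    using subsetD[OF keys_mult that] by (auto simp: sym_var_def)
  have **: "Poly_Mapping.keys (Poly_Mapping.single s 1 + n) \<subseteq> insert s (Poly_Mapping.keys n)"
    for s :: "'i + 'j" and n :: "('i + 'j) \<Rightarrow>\<^sub>0 nat"
    using Poly_Mapping.keys_add[of "Poly_Mapping.single s 1" n] by auto
  {
    assume "i \<in> I"
    show "sym_var (Inl i) * F \<in> sym_comp I J (d + 1) e"
      unfolding sym_comp_def
    proof (intro CollectI ballI)
      fix m assume "m \<in> Poly_Mapping.keys (sym_var (Inl i) * F)"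
      from *[OF this] obtain n where n: "n \<in> Poly_Mapping.keys F"
        "m = Poly_Mapping.single (Inl i) 1 + n" by blast
      thus "Poly_Mapping.keys m \<subseteq> I <+> J \<and>
          (\<Sum>i\<in>I. Poly_Mapping.lookup m (Inl i)) = d + 1 \<and>
          (\<Sum>j\<in>J. Poly_Mapping.lookup m (Inr j)) = e"
        using F **[of "Inl i" n] \<open>i \<in> I\<close> assms(1)
        by (auto simp: sym_comp_def lookup_add lookup_single sum.distrib when_def)
    qed
  }
  {
    assume "j \<in> J"
    show "sym_var (Inr j) * F \<in> sym_comp I J d (e + 1)"
      unfolding sym_comp_def
    proof (intro CollectI ballI)
      fix m assume "m \<in> Poly_Mapping.keys (sym_var (Inr j) * F)"
      from *[OF this] obtain n where n: "n \<in> Poly_Mapping.keys F"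
        "m = Poly_Mapping.single (Inr j) 1 + n" by blast
      thus "Poly_Mapping.keys m \<subseteq> I <+> J \<and>
          (\<Sum>i\<in>I. Poly_Mapping.lookup m (Inl i)) = d \<and>
          (\<Sum>j\<in>J. Poly_Mapping.lookup m (Inr j)) = e + 1"
        using F **[of "Inr j" n] \<open>j \<in> J\<close> assms(2)
        by (auto simp: sym_comp_def lookup_add lookup_single sum.distrib when_def)
    qed
  }
qed

lemma subspace_sym_comp:
  fixes I :: "'i set" and J :: "'j set"
  shows "module.subspace sym_scale (sym_comp I J d e :: ('i, 'j, 'a::field) sym_alg set)"
proof -
  interpret vector_space sym_scale by (rule vector_space_scales)
  have "Poly_Mapping.keys (sym_scale c F) \<subseteq> Poly_Mapping.keys F"
    for c :: 'a and F :: "('i, 'j, 'a) sym_alg"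
    using keys_mult[of "Poly_Mapping.single 0 c" F]
    by (auto simp: sym_scale_def split: if_splits)
  moreover have "Poly_Mapping.keys (F + G) \<subseteq> Poly_Mapping.keys F \<union> Poly_Mapping.keys G"
    for F G :: "('i, 'j, 'a) sym_alg"
    by (rule Poly_Mapping.keys_add)
  ultimately show ?thesis
    unfolding subspace_def by (fastforce simp: sym_comp_def)
qed

lemma subspace_coord_space:
  assumes "module.subspace sym_scale M"
  shows "module.subspace tensor_scale (coord_space L M)"
proof -
  interpret A: vector_space sym_scale by (rule vector_space_scales)
  interpret B: vector_space tensor_scale by (rule vector_space_scales)
  show ?thesis
    using assms unfolding A.subspace_def B.subspace_def
    by (auto simp: coord_space_def tensor_scale_def)
qed

lemma koszul_d2_left_subset:
  assumes fin: "finite I" "finite J" and K: "K \<subseteq> coord_space (I \<times> J) UNIV"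
  shows "koszul_d2 I J ` koszul_left I J K d e \<subseteq> {AB \<in> koszul_mid I J d e. koszul_d1 I J AB = 0}"
proof -
  interpret A: vector_space sym_scale by (rule vector_space_scales)
  interpret B: vector_space tensor_scale by (rule vector_space_scales)
  note sub = subspace_sym_comp
  have left: "koszul_left I J K d e \<subseteq> coord_space (I \<times> J) (sym_comp I J d e)"
    unfolding koszul_left_def
  proof (rule B.span_minimal)
    show "B.subspace (coord_space (I \<times> J) (sym_comp I J d e))"
      by (intro subspace_coord_space sub)
    show "{pure_tensor w F |w F. w \<in> K \<and> F \<in> sym_comp I J d e}
        \<subseteq> coord_space (I \<times> J) (sym_comp I J d e)"
      using K A.subspace_scale[OF sub]
      by (fastforce simp: coord_space_def pure_tensor_def)
  qed
  show ?thesis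
  proof (intro subsetI, elim imageE)
    fix AB T assume T: "T \<in> koszul_left I J K d e" and AB: "AB = koszul_d2 I J T"
    have T': "T (i, j) \<in> sym_comp I J d e" if "i \<in> I" "j \<in> J" for i j
      using left T that by (auto simp: coord_space_def)
    have T0: "T (i, j) = 0" if "i \<notin> I \<or> j \<notin> J" for i j
      using left T that by (auto simp: coord_space_def)
    have "koszul_d2 I J T \<in> koszul_mid I J d e"
      unfolding koszul_mid_def koszul_d2_def coord_space_def
      by (auto intro!: A.subspace_sum A.subspace_neg sub sym_var_mult_comp[OF fin, simplified] T'
          sum.neutral simp: T0)
    thus "AB \<in> {AB \<in> koszul_mid I J d e. koszul_d1 I J AB = 0}"
      by (simp add: AB koszul_d1_d2)
  qed
qed

lemma module_koszul_module:
  fixes K :: "('i \<times> 'j \<Rightarrow> 'a::field) set"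
  assumes fin: "finite I" "finite J" and K: "K \<subseteq> coord_space (I \<times> J) UNIV"
  shows "module (ring_of_type_algebra :: 'a ring) (koszul_module I J K d e)"
  unfolding koszul_module_def
proof (rule module_quotient_space)
  interpret A: vector_space sym_scale by (rule vector_space_scales)
  interpret B: vector_space tensor_scale by (rule vector_space_scales)
  interpret C: vector_space pair_scale by (rule vector_space_scales)
  show "vector_space (pair_scale :: 'a \<Rightarrow> ('i \<Rightarrow> ('i, 'j, 'a) sym_alg) \<times> _ \<Rightarrow> _)"
    by (rule vector_space_scales)
  have "B.subspace (coord_space I (sym_comp I J d (e + 1)))"
    and "B.subspace (coord_space J (sym_comp I J (d + 1) e))"
    by (intro subspace_coord_space subspace_sym_comp)+
  hence mid: "C.subspace (koszul_mid I J d e)"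
    unfolding koszul_mid_def B.subspace_def C.subspace_def
    by (auto simp: pair_scale_def plus_prod_def zero_prod_def)
  interpret d1: Vector_Spaces.linear pair_scale sym_scale "koszul_d1 I J"
    by unfold_locales
      (auto simp: koszul_d1_def pair_scale_def tensor_scale_def sym_scale_simps distrib_left
        sum.distrib A.scale_sum_right)
  have "C.subspace {AB. koszul_d1 I J AB = 0}"
    by (rule d1.subspace_kernel)
  with mid have "C.subspace (koszul_mid I J d e \<inter> {AB. koszul_d1 I J AB = 0})"
    by (rule C.subspace_inter)
  thus "C.subspace {AB \<in> koszul_mid I J d e. koszul_d1 I J AB = 0}"
    by (simp add: Int_def)
  interpret lin: Vector_Spaces.linear tensor_scale pair_scale "koszul_d2 I J"
    by unfold_locales
      (auto simp: koszul_d2_def pair_scale_def tensor_scale_def sym_scale_simps distrib_left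
        sum.distrib fun_eq_iff A.scale_sum_right A.scale_minus_right)
  show "C.subspace (koszul_d2 I J ` koszul_left I J K d e)"
    unfolding koszul_left_def by (intro lin.subspace_image B.subspace_span)
qed (use assms in \<open>rule koszul_d2_left_subset\<close>)

section \<open>Bi-graded Weyman modules\<close>

text \<open>\<open>Sym\<^sup>d U\<close>, which is zero for \<open>d < 0\<close>.\<close>

definition symU :: "int \<Rightarrow> 'a::field poly set"
  where "symU d = {f. \<forall>n. d < int n \<longrightarrow> coeff f n = 0}"

text \<open>\<open>k[x] \<otimes> k[x]\<close> is encoded by \<open>'a poly poly\<close>, where the outer variable
  belongs to the first tensor factor and the coefficients to the second one.\<close>

definition tensorU :: "'a::field poly \<Rightarrow> 'a poly \<Rightarrow> 'a poly poly"
  where "tensorU f g = map_poly (\<lambda>c. Polynomial.smult c g) f"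

definition scaleU :: "'a::field \<Rightarrow> 'a poly poly \<Rightarrow> 'a poly poly"
  where "scaleU c P = Polynomial.smult [:c:] P"

definition symU2 :: "int \<Rightarrow> int \<Rightarrow> 'a::field poly poly set"
  where "symU2 a b = module.span scaleU {tensorU f g |f g. f \<in> symU a \<and> g \<in> symU b}"

text \<open>The formula \<open>f \<otimes> g \<mapsto> f \<otimes> xg - xf \<otimes> g\<close> for \<open>\<iota>\<^sub>u\<^sub>,\<^sub>v\<close> (see \<open>iota_tensorU\<close>); it does not
  involve \<open>u\<close> and \<open>v\<close>, which only determine the domain.\<close>

definition iota :: "'a::field poly poly \<Rightarrow> 'a poly poly"
  where "iota P = Polynomial.smult [:0, 1:] P - pCons 0 P"

lemma iota_tensorU: "iota (tensorU f g) = tensorU f ([:0, 1:] * g) - tensorU ([:0, 1:] * f) g"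
  by (intro poly_eqI)
    (simp add: iota_def tensorU_def coeff_map_poly coeff_pCons split: nat.split)

definition weyman_im :: "nat \<Rightarrow> nat \<Rightarrow> 'a::field poly poly set"
  where "weyman_im u v = (iota \<circ> iota) ` symU2 (int u - 2) (int v - 2)"

definition weyman_Q :: "nat \<Rightarrow> nat \<Rightarrow> ('a::field, 'a poly poly set) module"
  where "weyman_Q u v = quotient_space scaleU (symU2 (int u) (int v)) (weyman_im u v)"

lemma vector_space_scaleU: "vector_space scaleU"
  by unfold_locales (simp_all add: scaleU_def smult_add_right mult.commute pCons_one flip: smult_add_left)

lemma linear_iota: "Vector_Spaces.linear scaleU scaleU iota"
proof -
  interpret vector_space scaleU by (rule vector_space_scaleU)
  show ?thesis
    by unfold_locales
      (auto simp: iota_def scaleU_def smult_add_right smult_diff_right mult.commute)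
qed

lemma iota_symU2: "iota ` symU2 (a - 1) (b - 1) \<subseteq> symU2 a b"
proof -
  interpret vector_space scaleU by (rule vector_space_scaleU)
  interpret iota: Vector_Spaces.linear scaleU scaleU iota by (rule linear_iota)
  have "f \<in> symU c" "[:0, 1:] * f \<in> symU c" if "f \<in> symU (c - 1)" for c and f :: "'a poly"
    using that by (auto simp: symU_def coeff_pCons split: nat.split)
  hence "iota (tensorU f g) \<in> symU2 a b" if "f \<in> symU (a - 1)" "g \<in> symU (b - 1)" for f g :: "'a poly"
    using that unfolding iota_tensorU symU2_def by (intro span_diff span_base) blast+
  thus ?thesis
    unfolding symU2_def[of "a - 1"] iota.span_image[symmetric]
    by (intro span_minimal) (auto simp: symU2_def)
qed

lemma module_weyman_Q:
  "module (ring_of_type_algebra :: 'a ring) (weyman_Q u v :: ('a::field, _) module)"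
  unfolding weyman_Q_def
proof (rule module_quotient_space)
  interpret vector_space scaleU by (rule vector_space_scaleU)
  interpret iota: Vector_Spaces.linear scaleU scaleU iota by (rule linear_iota)
  show "vector_space scaleU" by (rule vector_space_scaleU)
  show "subspace (symU2 (int u) (int v))" by (simp add: symU2_def)
  show "subspace (weyman_im u v)"
    unfolding weyman_im_def symU2_def image_comp[symmetric]
    by (intro iota.subspace_image subspace_span)
  show "weyman_im u v \<subseteq> symU2 (int u) (int v)"
    using iota_symU2[of "int u - 1" "int v - 1"] iota_symU2[of "int u" "int v"]
    by (auto simp: weyman_im_def)
qed

definition weyman_Psi :: "nat \<Rightarrow> nat \<Rightarrow> 'a::field poly poly \<Rightarrow> 'a poly poly set"
  where "weyman_Psi u v = coset (weyman_im u v)"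

text \<open>\<open>D\<^sup>uU\<close> and \<open>D\<^sup>vU\<close> carry the bases dual to the monomials, so a functional \<open>\<psi>\<close> on
  \<open>Sym\<^sup>u U \<otimes> Sym\<^sup>v U\<close>, i.e. an element of \<open>D\<^sup>uU \<otimes> D\<^sup>vU\<close>, has the coordinates \<open>\<psi> (x\<^sup>i \<otimes> x\<^sup>j)\<close>.\<close>

definition dual_coords ::
    "nat \<Rightarrow> nat \<Rightarrow> ('a::field poly poly \<Rightarrow> 'a) \<Rightarrow> nat \<times> nat \<Rightarrow> 'a"
  where "dual_coords u v \<psi> = (\<lambda>(i, j).
    if i \<le> u \<and> j \<le> v then \<psi> (tensorU (monom 1 i) (monom 1 j)) else 0)"

definition weyman_K :: "nat \<Rightarrow> nat \<Rightarrow> (nat \<times> nat \<Rightarrow> 'a::field) set"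
  where "weyman_K u v = {dual_coords u v (\<phi> \<circ> weyman_Psi u v) |\<phi>. \<phi> \<in> dual_space (weyman_Q u v)}"

definition weyman_module :: "nat \<Rightarrow> nat \<Rightarrow> nat \<Rightarrow> nat \<Rightarrow>
    ('a::field, ((nat \<Rightarrow> (nat, nat, 'a) sym_alg) \<times> (nat \<Rightarrow> (nat, nat, 'a) sym_alg)) set) module"
  where "weyman_module u v d e = koszul_module {0..u} {0..v} (weyman_K u v) d e"

lemma module_weyman_module:
  "module (ring_of_type_algebra :: 'a ring) (weyman_module u v d e :: ('a::field, _) module)"
  unfolding weyman_module_def
  by (rule module_koszul_module) (auto simp: weyman_K_def coord_space_def dual_coords_def)

end

theory Submission
  imports Defs
    "HOL-Library.Infinite_Typeclass"
    "HOL-Library.Multiset"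
    "HOL-Combinatorics.Transposition"
begin

text \<open>Suppose \<open>\<Lambda>\<close> is a linear form on the middle term of the Koszul complex that kills the image of
  \<open>K \<otimes> S\<^sub>d\<^sub>,\<^sub>e\<close>. Since \<open>K\<close> is spanned by first order jets of the diagonal rational curve,
  evaluating \<open>\<Lambda>\<close> at products of points of the curves \<open>a (x) = \<Sum> x\<^sup>i a\<^sub>i\<close> in \<open>V\<^sub>1\<close> and
  \<open>b (y) = \<Sum> y\<^sup>j b\<^sub>j\<close> in \<open>V\<^sub>2\<close> gives polynomials \<open>H\<close>, \<open>G\<close> in \<open>x\<^sub>0, \<dots>, x\<^sub>v, y\<^sub>0, \<dots>, y\<^sub>u\<close>, where
  \<open>H\<close> is symmetric in the \<open>x\<^sub>k\<close> with \<open>k \<ge> 1\<close> and in all \<open>y\<^sub>l\<close>, \<open>G\<close> is symmetric in all \<open>x\<^sub>k\<close> and in the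
  \<open>y\<^sub>l\<close> with \<open>l \<ge> 1\<close>, and \<open>H + G = (x\<^sub>0 - y\<^sub>0)\<^sup>2 q\<close>. If \<open>H + G = 0\<close>, then \<open>\<Lambda>\<close> factors through the
  multiplication map to \<open>S\<^sub>d\<^sub>+\<^sub>1\<^sub>,\<^sub>e\<^sub>+\<^sub>1\<close>, so that the complex is exact.

  To see that \<open>H + G = 0\<close>, restrict \<open>q\<close> to \<open>y\<^sub>0 = x\<^sub>1\<close>, \<open>y\<^sub>1 = x\<^sub>0\<close> and multiply by the Vandermonde
  determinants of the other \<open>x\<^sub>k\<close> and of the other \<open>y\<^sub>l\<close>. Symmetry and Lagrange interpolation show that the
  resulting polynomial in \<open>u + v\<close> variables is antisymmetric in \<open>x\<^sub>0, x\<^sub>1\<close> and is killed by the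
  Dunkl operators in \<open>x\<^sub>0\<close> and \<open>x\<^sub>1\<close>; its degree in each variable is at most \<open>u + v\<close>. Such a
  polynomial is zero if \<open>1, \<dots>, u + v\<close> are invertible, and \<open>q = 0\<close> follows by counting roots.\<close>

text \<open>The four values of \<open>H + G\<close> obtained by exchanging \<open>x_0\<close> with
  \<open>x_1\<close> and \<open>y_0\<close> with \<open>y_1\<close> have alternating sum zero, since
  \<open>G\<close> ignores the first exchange and \<open>H\<close> the second. At a point with
  \<open>x_0 = y_0\<close> one of them drops out. The locus \<open>y_0 = x_1\<close>,
  \<open>y_1 = x_0\<close> is made for the remaining relation: there it gives antisymmetry and
  expresses the derivative of \<open>q\<close> in \<open>x_1\<close> by one in \<open>x_0\<close>,
  which interpolation can reach. The interpolation weights are ratios of Vandermonde determinants;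
  multiplication by these determinants turns the weighted values into transposed ones, and the
  formula into a Dunkl equation. Commutativity of the Dunkl operators upgrades two equations to all
  of them, by induction on the total degree. What is killed by all of them is shown to be constant
  by comparing leading coefficients in single variables: degree \<open>m\<close> in \<open>N\<close>
  variables is excluded if \<open>m\<close> and \<open>N - m\<close> are invertible. The obstacle is
  \<open>m = N\<close>. It has to be faced because \<open>u + v\<close> is both the number of
  variables and the degree bound, and it is settled by looking at the coefficient of the product of
  all variables.\<close>

instance alg_closed_field \<subseteq> infinite
proof
  show "infinite (UNIV :: 'a set)"
  proof
    assume fin: "finite (UNIV :: 'a set)"
    \<comment> \<open>Euclid's argument: \<open>?P\<close> has positive degree but takes the value 1
      at every element of a finite field.\<close>
    let ?P = "(\<Prod>a\<in>(UNIV :: 'a set). [:- a, 1:]) + 1"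
    have deg: "degree (\<Prod>a\<in>(UNIV :: 'a set). [:- a, 1:]) = card (UNIV :: 'a set)"
      by (subst degree_prod_eq_sum_degree) auto
    have "card (UNIV :: 'a set) > 0"
      using fin by (simp add: card_gt_0_iff)
    hence "degree ?P > 0"
      using deg by (subst degree_add_eq_left) auto
    then obtain x where "poly ?P x = 0"
      using alg_closed_imp_poly_has_root by blast
    moreover have "poly (\<Prod>a\<in>(UNIV :: 'a set). [:- a, 1:]) x = 0"
      using fin by (auto simp: poly_prod)
    ultimately show False by simp
  qed
qed

text \<open>A nonzero polynomial has finitely many roots. The exceptional set \<open>A\<close> will
  hold parameters at which two coordinates collide.\<close>

lemma poly_eqI_infinite:
  fixes P Q :: "'a::{idom,infinite} poly"
  assumes "finite A" "\<And>t. t \<notin> A \<Longrightarrow> poly P t = poly Q t"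
  shows "P = Q"
proof (rule ccontr)
  assume "P \<noteq> Q"
  hence "finite {t. poly (P - Q) t = 0}" by (intro poly_roots_finite) simp
  moreover have "UNIV \<subseteq> A \<union> {t. poly (P - Q) t = 0}" using assms(2) by auto
  ultimately show False
    using assms(1) infinite_UNIV by (meson finite_Un finite_subset)
qed

section \<open>Polynomial functions\<close>

text \<open>Polynomials in the variables \<open>I\<close> are represented by the functions that they induce, which is
  faithful over an infinite domain; \<open>n\<close> bounds the total degree.\<close>

inductive polyfun :: "'v set \<Rightarrow> nat \<Rightarrow> (('v \<Rightarrow> 'a::comm_ring_1) \<Rightarrow> 'a) \<Rightarrow> bool" for I where
  const: "polyfun I n (\<lambda>_. c)"
| var: "i \<in> I \<Longrightarrow> polyfun I (Suc n) (\<lambda>\<zeta>. \<zeta> i)"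
| add: "polyfun I n f \<Longrightarrow> polyfun I n g \<Longrightarrow> polyfun I n (\<lambda>\<zeta>. f \<zeta> + g \<zeta>)"
| mult: "polyfun I m f \<Longrightarrow> polyfun I n g \<Longrightarrow> polyfun I (m + n) (\<lambda>\<zeta>. f \<zeta> * g \<zeta>)"

definition PF :: "'v set \<Rightarrow> (('v \<Rightarrow> 'a::comm_ring_1) \<Rightarrow> 'a) \<Rightarrow> bool"
  where "PF I f \<longleftrightarrow> (\<exists>n. polyfun I n f)"

lemma polyfun_mono: "polyfun I m f \<Longrightarrow> m \<le> n \<Longrightarrow> polyfun I n f"
proof (induction arbitrary: n rule: polyfun.induct)
  case (var i m)
  then obtain n' where "n = Suc n'" by (cases n) auto
  with var show ?case by (auto intro: polyfun.var)
next
  case (mult m f m' g)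
  have "polyfun I (m + (n - m)) (\<lambda>\<zeta>. f \<zeta> * g \<zeta>)"
    using mult by (intro polyfun.mult) auto
  with mult show ?case by simp
qed (auto intro: polyfun.intros)

lemma PF_const [simp, intro]: "PF I (\<lambda>_. c)"
  and PF_var [intro]: "i \<in> I \<Longrightarrow> PF I (\<lambda>\<zeta>. \<zeta> i)"
  by (auto simp: PF_def intro: polyfun.intros)

lemma PF_add [intro]:
  assumes "PF I f" "PF I g" shows "PF I (\<lambda>\<zeta>. f \<zeta> + g \<zeta>)"
proof -
  from assms obtain m n where "polyfun I m f" "polyfun I n g" by (auto simp: PF_def)
  hence "polyfun I (max m n) (\<lambda>\<zeta>. f \<zeta> + g \<zeta>)"
    by (intro polyfun.add) (auto intro: polyfun_mono)
  thus ?thesis by (auto simp: PF_def)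
qed

lemma PF_mult [intro]: "PF I f \<Longrightarrow> PF I g \<Longrightarrow> PF I (\<lambda>\<zeta>. f \<zeta> * g \<zeta>)"
  by (auto simp: PF_def intro: polyfun.mult)

lemma polyfun_minus: "polyfun I n f \<Longrightarrow> polyfun I n (\<lambda>\<zeta>. - f \<zeta>)"
  using polyfun.mult[OF polyfun.const[of I 0 "-1"], of n f] by simp

lemma polyfun_diff: "polyfun I n f \<Longrightarrow> polyfun I n g \<Longrightarrow> polyfun I n (\<lambda>\<zeta>. f \<zeta> - g \<zeta>)"
  using polyfun.add[OF _ polyfun_minus, of I n f g] by simp

lemma polyfun_sum: "(\<And>a. a \<in> A \<Longrightarrow> polyfun I n (f a)) \<Longrightarrow> polyfun I n (\<lambda>\<zeta>. \<Sum>a\<in>A. f a \<zeta>)"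
  by (induction A rule: infinite_finite_induct) (auto intro: polyfun.intros)

lemma PF_minus [intro]: "PF I f \<Longrightarrow> PF I (\<lambda>\<zeta>. - f \<zeta>)"
  by (auto simp: PF_def intro: polyfun_minus)

lemma PF_diff [intro]: "PF I f \<Longrightarrow> PF I g \<Longrightarrow> PF I (\<lambda>\<zeta>. f \<zeta> - g \<zeta>)"
  using PF_add[OF _ PF_minus, of I f g] by simp

lemma PF_sum [intro]: "(\<And>a. a \<in> A \<Longrightarrow> PF I (f a)) \<Longrightarrow> PF I (\<lambda>\<zeta>. \<Sum>a\<in>A. f a \<zeta>)"
  by (induction A rule: infinite_finite_induct) auto

lemma PF_prod [intro]: "(\<And>a. a \<in> A \<Longrightarrow> PF I (f a)) \<Longrightarrow> PF I (\<lambda>\<zeta>. \<Prod>a\<in>A. f a \<zeta>)"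
  by (induction A rule: infinite_finite_induct) auto

lemma PF_power [intro]: "PF I f \<Longrightarrow> PF I (\<lambda>\<zeta>. f \<zeta> ^ n)"
  by (induction n) auto

text \<open>Hides the degree index and supplies polynomiality of both operands, which the rules for
  \<open>uni\<close>, \<open>cf\<close> and \<open>der\<close> demand.\<close>

lemma PF_induct [consumes 1, case_names const var add mult]:
  assumes "PF I f" and "\<And>c. P (\<lambda>_. c)" and "\<And>i. i \<in> I \<Longrightarrow> P (\<lambda>\<zeta>. \<zeta> i)"
    and "\<And>f g. PF I f \<Longrightarrow> PF I g \<Longrightarrow> P f \<Longrightarrow> P g \<Longrightarrow> P (\<lambda>\<zeta>. f \<zeta> + g \<zeta>)"
    and "\<And>f g. PF I f \<Longrightarrow> PF I g \<Longrightarrow> P f \<Longrightarrow> P g \<Longrightarrow> P (\<lambda>\<zeta>. f \<zeta> * g \<zeta>)"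
  shows "P f"
proof -
  from assms(1) obtain n where "polyfun I n f" by (auto simp: PF_def)
  thus ?thesis
  proof induction
    case (add n f g)
    thus ?case by (intro assms(4)) (auto simp: PF_def)
  next
    case (mult m f n g)
    thus ?case by (intro assms(5)) (auto simp: PF_def)
  qed (use assms(2,3) in auto)
qed

lemma polyfun_comp: "polyfun I n f \<Longrightarrow> \<sigma> ` I \<subseteq> J \<Longrightarrow> polyfun J n (\<lambda>\<zeta>. f (\<lambda>v. \<zeta> (\<sigma> v)))"
  by (induction rule: polyfun.induct) (auto intro: polyfun.intros)

lemma PF_comp: "PF I f \<Longrightarrow> \<sigma> ` I \<subseteq> J \<Longrightarrow> PF J (\<lambda>\<zeta>. f (\<lambda>v. \<zeta> (\<sigma> v)))"
  by (auto simp: PF_def intro: polyfun_comp)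

lemma PF_mono: "PF I f \<Longrightarrow> I \<subseteq> J \<Longrightarrow> PF J f"
  using PF_comp[of I f "\<lambda>v. v" J] by auto

lemma PF_cong_point: "PF I f \<Longrightarrow> (\<And>v. v \<in> I \<Longrightarrow> \<zeta> v = \<xi> v) \<Longrightarrow> f \<zeta> = f \<xi>"
  by (induction rule: PF_induct) auto

text \<open>Index 0 leaves no room for a variable. This settles the case \<open>n = 0\<close>
  wherever a bound \<open>n - 1\<close> is claimed and subtraction is truncated.\<close>

lemma polyfun_0: "polyfun I n f \<Longrightarrow> n = 0 \<Longrightarrow> f \<zeta> = f \<xi>"
  by (induction rule: polyfun.induct) auto

subsection \<open>Restriction to one variable\<close>

text \<open>Over an infinite domain the description is unique; that it denotes something for
  polynomial \<open>f\<close> is \<open>poly_uni\<close>.\<close>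

definition uni :: "'v \<Rightarrow> (('v \<Rightarrow> 'a::{idom,infinite}) \<Rightarrow> 'a) \<Rightarrow> ('v \<Rightarrow> 'a) \<Rightarrow> 'a poly"
  where "uni i f \<zeta> = (THE P. \<forall>t. poly P t = f (\<zeta>(i := t)))"

lemma uni_eqI:
  fixes f :: "('v \<Rightarrow> 'a::{idom,infinite}) \<Rightarrow> 'a"
  assumes "\<And>t. poly P t = f (\<zeta>(i := t))"
  shows "uni i f \<zeta> = P"
  unfolding uni_def
proof (rule the_equality)
  fix Q assume "\<forall>t. poly Q t = f (\<zeta>(i := t))"
  thus "Q = P" using assms by (intro poly_eqI_infinite[of "{}"]) auto
qed (use assms in auto)

lemma poly_uni:
  fixes f :: "('v \<Rightarrow> 'a::{idom,infinite}) \<Rightarrow> 'a"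
  assumes "PF I f"
  shows "poly (uni i f \<zeta>) t = f (\<zeta>(i := t))"
proof -
  have "\<exists>P. \<forall>t. poly P t = f (\<zeta>(i := t))"
    using assms
  proof (induction rule: PF_induct)
    case (const c)
    show ?case by (rule exI[of _ "[:c:]"]) simp
  next
    case (var j)
    show ?case by (rule exI[of _ "if j = i then [:0, 1:] else [:\<zeta> j:]"]) simp
  next
    case (add f g)
    then obtain P Q where "\<forall>t. poly P t = f (\<zeta>(i := t))" "\<forall>t. poly Q t = g (\<zeta>(i := t))" by blast
    hence "\<forall>t. poly (P + Q) t = f (\<zeta>(i := t)) + g (\<zeta>(i := t))" by simp
    thus ?case by blast
  next
    case (mult f g)
    then obtain P Q where "\<forall>t. poly P t = f (\<zeta>(i := t))" "\<forall>t. poly Q t = g (\<zeta>(i := t))" by blast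
    hence "\<forall>t. poly (P * Q) t = f (\<zeta>(i := t)) * g (\<zeta>(i := t))" by simp
    thus ?case by blast
  qed
  thus ?thesis using uni_eqI by metis
qed

lemma poly_uni_self: "PF I f \<Longrightarrow> poly (uni i f \<zeta>) (\<zeta> i) = f \<zeta>"
  by (simp add: poly_uni)

lemma uni_const [simp]: "uni i (\<lambda>_. c) \<zeta> = [:c:]"
  by (rule uni_eqI) simp

lemma uni_var: "uni i (\<lambda>\<zeta>. \<zeta> j) \<zeta> = (if i = j then [:0, 1:] else [:\<zeta> j:])"
  by (rule uni_eqI) simp

lemma uni_add: "PF I f \<Longrightarrow> PF I g \<Longrightarrow> uni i (\<lambda>\<zeta>. f \<zeta> + g \<zeta>) \<zeta> = uni i f \<zeta> + uni i g \<zeta>"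
  by (rule uni_eqI) (simp add: poly_uni)

lemma uni_minus: "PF I f \<Longrightarrow> uni i (\<lambda>\<zeta>. - f \<zeta>) \<zeta> = - uni i f \<zeta>"
  by (rule uni_eqI) (simp add: poly_uni)

lemma uni_diff: "PF I f \<Longrightarrow> PF I g \<Longrightarrow> uni i (\<lambda>\<zeta>. f \<zeta> - g \<zeta>) \<zeta> = uni i f \<zeta> - uni i g \<zeta>"
  by (rule uni_eqI) (simp add: poly_uni)

lemma uni_mult: "PF I f \<Longrightarrow> PF I g \<Longrightarrow> uni i (\<lambda>\<zeta>. f \<zeta> * g \<zeta>) \<zeta> = uni i f \<zeta> * uni i g \<zeta>"
  by (rule uni_eqI) (simp add: poly_uni)

lemma uni_sum: "(\<And>a. a \<in> A \<Longrightarrow> PF I (f a)) \<Longrightarrow>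
    uni i (\<lambda>\<zeta>. \<Sum>a\<in>A. f a \<zeta>) \<zeta> = (\<Sum>a\<in>A. uni i (f a) \<zeta>)"
  by (rule uni_eqI) (auto simp: poly_uni[of I] poly_sum intro!: sum.cong)

lemma uni_prod: "(\<And>a. a \<in> A \<Longrightarrow> PF I (f a)) \<Longrightarrow>
    uni i (\<lambda>\<zeta>. \<Prod>a\<in>A. f a \<zeta>) \<zeta> = (\<Prod>a\<in>A. uni i (f a) \<zeta>)"
  by (rule uni_eqI) (auto simp: poly_uni[of I] poly_prod intro!: prod.cong)

lemma uni_upd [simp]: "uni i f (\<zeta>(i := t)) = uni i f \<zeta>"
  by (simp add: uni_def)

lemma uni_notin: "PF I f \<Longrightarrow> i \<notin> I \<Longrightarrow> uni i f \<zeta> = [:f \<zeta>:]"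
proof (rule uni_eqI)
  fix t assume "PF I f" "i \<notin> I"
  thus "poly [:f \<zeta>:] t = f (\<zeta>(i := t))"
    using PF_cong_point[of I f \<zeta> "\<zeta>(i := t)"] by fastforce
qed

lemma PF_cancel_diff:
  fixes f :: "('v \<Rightarrow> 'a::{idom,infinite}) \<Rightarrow> 'a"
  assumes f: "PF I f" and "i \<noteq> j" and z: "\<And>\<zeta>. \<zeta> i \<noteq> \<zeta> j \<Longrightarrow> f \<zeta> = 0"
  shows "f \<zeta> = 0"
proof -
  have "uni i f \<zeta> = 0"
  proof (rule poly_eqI_infinite[of "{\<zeta> j}"])
    fix t assume "t \<notin> {\<zeta> j}"
    thus "poly (uni i f \<zeta>) t = poly 0 t"
      using z[of "\<zeta>(i := t)"] \<open>i \<noteq> j\<close> by (simp add: poly_uni[OF f])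
  qed simp
  thus ?thesis using poly_uni_self[OF f, of i \<zeta>] by simp
qed

text \<open>Points with distinct coordinates are dense, so identities between divided differences
  need only be checked where all denominators are nonzero.\<close>

lemma PF_cancel_inj:
  fixes f :: "('v \<Rightarrow> 'a::{idom,infinite}) \<Rightarrow> 'a"
  assumes "finite I" and f: "PF I f" and z: "\<And>\<zeta>. inj_on \<zeta> I \<Longrightarrow> f \<zeta> = 0"
  shows "f \<zeta> = 0"
proof -
  define R where "R = {(i, j). i \<in> I \<and> j \<in> I \<and> i \<noteq> j}"
  have "finite R" by (rule finite_subset[of _ "I \<times> I"]) (use assms(1) in \<open>auto simp: R_def\<close>)
  \<comment> \<open>\<open>A\<close> collects the pairs whose disequality is no longer assumed; the
    case \<open>A = R\<close> is the claim. A pair is dropped by moving one coordinate, which meets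
    only finitely many forbidden values.\<close>
  have "\<forall>\<zeta> :: 'v \<Rightarrow> 'a. (\<forall>(i, j)\<in>R - A. \<zeta> i \<noteq> \<zeta> j) \<longrightarrow> f \<zeta> = 0" if "finite A" "A \<subseteq> R" for A
    using that
  proof (induction A rule: finite_induct)
    case empty
    thus ?case using z by (force simp: R_def inj_on_def)
  next
    case (insert r A)
    obtain i j where r: "r = (i, j)" by (cases r)
    show ?case
    proof (intro allI impI)
      fix \<zeta> :: "'v \<Rightarrow> 'a" assume ne: "\<forall>(i, j)\<in>R - insert r A. \<zeta> i \<noteq> \<zeta> j"
      have "uni i f \<zeta> = 0"
      proof (rule poly_eqI_infinite[of "\<zeta> ` I"])
        fix t assume t: "t \<notin> \<zeta> ` I"
        have "(\<zeta>(i := t)) a \<noteq> (\<zeta>(i := t)) b" if "(a, b) \<in> R - A" for a b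
        proof (cases "a = i \<or> b = i")
          case True
          with that t show ?thesis by (auto simp: R_def)
        next
          case False
          hence "(a, b) \<in> R - insert r A" using that r by auto
          with ne have "\<zeta> a \<noteq> \<zeta> b" by blast
          with False show ?thesis by simp
        qed
        hence "f (\<zeta>(i := t)) = 0" using insert by blast
        thus "poly (uni i f \<zeta>) t = poly 0 t" by (simp add: poly_uni[OF f])
      qed (use assms(1) in auto)
      thus "f \<zeta> = 0" using poly_uni_self[OF f, of i \<zeta>] by simp
    qed
  qed
  from this[OF \<open>finite R\<close>] show ?thesis by auto
qed

lemma PF_eqI_diff:
  fixes f g :: "('v \<Rightarrow> 'a::{idom,infinite}) \<Rightarrow> 'a"
  assumes "i \<noteq> j" "PF I f" "PF I g" "\<And>\<zeta>. \<zeta> i \<noteq> \<zeta> j \<Longrightarrow> f \<zeta> = g \<zeta>"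
  shows "f = g"
proof
  fix \<zeta> show "f \<zeta> = g \<zeta>"
    using PF_cancel_diff[of I "\<lambda>\<zeta>. f \<zeta> - g \<zeta>" i j \<zeta>] assms by (auto simp: PF_diff)
qed

lemma PF_eqI_inj:
  fixes f g :: "('v \<Rightarrow> 'a::{idom,infinite}) \<Rightarrow> 'a"
  assumes "finite I" "PF I f" "PF I g" "\<And>\<zeta>. inj_on \<zeta> I \<Longrightarrow> f \<zeta> = g \<zeta>"
  shows "f = g"
proof
  fix \<zeta> show "f \<zeta> = g \<zeta>"
    using PF_cancel_inj[of I "\<lambda>\<zeta>. f \<zeta> - g \<zeta>" \<zeta>] assms by (auto simp: PF_diff)
qed

subsection \<open>Coefficients and derivatives\<close>

text \<open>Still a function of the whole point, although independent of \<open>\<zeta> i\<close>,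
  so that coefficients and derivatives in several variables can be composed.\<close>

definition cf :: "'v \<Rightarrow> nat \<Rightarrow> (('v \<Rightarrow> 'a::{idom,infinite}) \<Rightarrow> 'a) \<Rightarrow> ('v \<Rightarrow> 'a) \<Rightarrow> 'a"
  where "cf i m f \<zeta> = coeff (uni i f \<zeta>) m"

definition der :: "'v \<Rightarrow> (('v \<Rightarrow> 'a::{idom,infinite}) \<Rightarrow> 'a) \<Rightarrow> ('v \<Rightarrow> 'a) \<Rightarrow> 'a"
  where "der i f \<zeta> = poly (pderiv (uni i f \<zeta>)) (\<zeta> i)"

lemma cf_const: "cf i m (\<lambda>_. c) = (\<lambda>_. if m = 0 then c else 0)"
  by (auto simp: cf_def fun_eq_iff coeff_pCons split: nat.split)

lemma cf_var: "cf i m (\<lambda>\<zeta>. \<zeta> j) =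
    (\<lambda>\<zeta>. if i = j then (if m = 1 then 1 else 0) else if m = 0 then \<zeta> j else 0)"
  by (auto simp: cf_def fun_eq_iff uni_var coeff_pCons split: nat.split)

lemma cf_add: "PF I f \<Longrightarrow> PF I g \<Longrightarrow> cf i m (\<lambda>\<zeta>. f \<zeta> + g \<zeta>) = (\<lambda>\<zeta>. cf i m f \<zeta> + cf i m g \<zeta>)"
  by (simp add: cf_def fun_eq_iff uni_add)

lemma cf_minus: "PF I f \<Longrightarrow> cf i m (\<lambda>\<zeta>. - f \<zeta>) = (\<lambda>\<zeta>. - cf i m f \<zeta>)"
  by (simp add: cf_def fun_eq_iff uni_minus)

lemma cf_diff: "PF I f \<Longrightarrow> PF I g \<Longrightarrow> cf i m (\<lambda>\<zeta>. f \<zeta> - g \<zeta>) = (\<lambda>\<zeta>. cf i m f \<zeta> - cf i m g \<zeta>)"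
  by (simp add: cf_def fun_eq_iff uni_diff)

lemma cf_sum: "(\<And>a. a \<in> A \<Longrightarrow> PF I (f a)) \<Longrightarrow>
    cf i m (\<lambda>\<zeta>. \<Sum>a\<in>A. f a \<zeta>) = (\<lambda>\<zeta>. \<Sum>a\<in>A. cf i m (f a) \<zeta>)"
  by (simp add: cf_def fun_eq_iff uni_sum[of A I] coeff_sum)

lemma cf_mult: "PF I f \<Longrightarrow> PF I g \<Longrightarrow>
    cf i m (\<lambda>\<zeta>. f \<zeta> * g \<zeta>) = (\<lambda>\<zeta>. \<Sum>r\<le>m. cf i r f \<zeta> * cf i (m - r) g \<zeta>)"
  by (simp add: cf_def fun_eq_iff uni_mult coeff_mult)

lemma PF_cf: "PF I f \<Longrightarrow> PF (I - {i}) (cf i m f)"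
proof (induction arbitrary: m rule: PF_induct)
  case (var j)
  thus ?case by (cases "i = j"; cases "m = 0") (auto simp: cf_var)
next
  case (mult f g)
  show ?case unfolding cf_mult[OF mult(1,2)] by (intro PF_sum PF_mult mult)
qed (auto simp: cf_const cf_add)

lemma cf_upd [simp]: "cf i m f (\<zeta>(i := t)) = cf i m f \<zeta>"
  by (simp add: cf_def)

lemma der_const [simp]: "der i (\<lambda>_. c) = (\<lambda>_. 0)"
  by (simp add: der_def fun_eq_iff)

lemma der_var: "der i (\<lambda>\<zeta>. \<zeta> j) = (\<lambda>_. if i = j then 1 else 0)"
  by (simp add: der_def fun_eq_iff uni_var pderiv_pCons)

lemma der_add: "PF I f \<Longrightarrow> PF I g \<Longrightarrow> der i (\<lambda>\<zeta>. f \<zeta> + g \<zeta>) = (\<lambda>\<zeta>. der i f \<zeta> + der i g \<zeta>)"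
  by (simp add: der_def fun_eq_iff uni_add pderiv_add)

lemma der_minus: "PF I f \<Longrightarrow> der i (\<lambda>\<zeta>. - f \<zeta>) = (\<lambda>\<zeta>. - der i f \<zeta>)"
  by (simp add: der_def fun_eq_iff uni_minus pderiv_minus)

lemma der_diff: "PF I f \<Longrightarrow> PF I g \<Longrightarrow> der i (\<lambda>\<zeta>. f \<zeta> - g \<zeta>) = (\<lambda>\<zeta>. der i f \<zeta> - der i g \<zeta>)"
  by (simp add: der_def fun_eq_iff uni_diff pderiv_diff)

lemma der_mult: "PF I f \<Longrightarrow> PF I g \<Longrightarrow>
    der i (\<lambda>\<zeta>. f \<zeta> * g \<zeta>) = (\<lambda>\<zeta>. f \<zeta> * der i g \<zeta> + der i f \<zeta> * g \<zeta>)"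
  by (simp add: der_def fun_eq_iff uni_mult pderiv_mult poly_uni_self algebra_simps)

lemma der_sum: "(\<And>a. a \<in> A \<Longrightarrow> PF I (f a)) \<Longrightarrow>
    der i (\<lambda>\<zeta>. \<Sum>a\<in>A. f a \<zeta>) = (\<lambda>\<zeta>. \<Sum>a\<in>A. der i (f a) \<zeta>)"
  by (simp add: der_def fun_eq_iff uni_sum[of A I] poly_sum higher_pderiv_sum[of 1, simplified])

lemma polyfun_der: "polyfun I n f \<Longrightarrow> polyfun I (n - 1) (der i f)"
proof (induction rule: polyfun.induct)
  case (mult m f n g)
  have pf: "PF I f" "PF I g" using mult by (auto simp: PF_def)
  \<comment> \<open>For \<open>n = 0\<close> the bound from the induction hypotheses is one too
    large, but then \<open>g\<close> is constant and the term vanishes.\<close>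
  have 1: "polyfun I (m + n - 1) (\<lambda>\<zeta>. f \<zeta> * der i g \<zeta>)"
  proof (cases "n = 0")
    case True
    have "der i g = (\<lambda>_. 0)"
      using polyfun_0[OF mult(2) True] True mult.IH(2) 
      by (metis (no_types, lifting) der_const ext)
    thus ?thesis by (simp add: polyfun.const)
  next
    case False
    with polyfun.mult[OF mult(1) mult.IH(2)] show ?thesis by simp
  qed
  have 2: "polyfun I (m + n - 1) (\<lambda>\<zeta>. der i f \<zeta> * g \<zeta>)"
  proof (cases "m = 0")
    case True
    have "der i f = (\<lambda>_. 0)"
      using polyfun_0[OF mult(1) True] by (metis (no_types, lifting) der_const ext)
    thus ?thesis by (simp add: polyfun.const)
  next
    case False
    with polyfun.mult[OF mult.IH(1) mult(2)] show ?thesis by simp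
  qed
  show ?case unfolding der_mult[OF pf] by (rule polyfun.add[OF 1 2])
next
  case (add n f g)
  thus ?case by (subst der_add[of I]) (auto simp: PF_def intro: polyfun.add)
qed (auto simp: der_var intro: polyfun.const)

lemma PF_der [intro]: "PF I f \<Longrightarrow> PF I (der i f)"
  by (auto simp: PF_def intro: polyfun_der)

lemma der_commute: "PF I f \<Longrightarrow> der i (der j f) = der j (der i f)"
proof (induction rule: PF_induct)
  case (mult f g)
  have "der i (der j (\<lambda>\<zeta>. f \<zeta> * g \<zeta>)) = (\<lambda>\<zeta>. (f \<zeta> * der i (der j g) \<zeta> + der i f \<zeta> * der j g \<zeta>) +
    (der j f \<zeta> * der i g \<zeta> + der i (der j f) \<zeta> * g \<zeta>))" for i j
    using mult(1,2) by (simp add: der_mult[of I] der_add[of I] PF_mult PF_der)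
  with mult show ?case by (simp add: algebra_simps fun_eq_iff)
qed (auto simp: der_var der_add[of I] PF_der)

lemma cf_der: "PF I f \<Longrightarrow> cf i m (der i f) = (\<lambda>\<zeta>. of_nat (Suc m) * cf i (Suc m) f \<zeta>)"
proof
  fix \<zeta> assume f: "PF I f"
  have "uni i (der i f) \<zeta> = pderiv (uni i f \<zeta>)"
    by (rule uni_eqI) (simp add: der_def)
  thus "cf i m (der i f) \<zeta> = of_nat (Suc m) * cf i (Suc m) f \<zeta>"
    by (simp add: cf_def coeff_pderiv)
qed

lemma cf_der_neq: "PF I f \<Longrightarrow> i \<noteq> j \<Longrightarrow> cf i m (der j f) = der j (cf i m f)"
proof (induction arbitrary: m rule: PF_induct)
  case (mult f g)
  have "cf i m (der j (\<lambda>\<zeta>. f \<zeta> * g \<zeta>)) =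
      (\<lambda>\<zeta>. (\<Sum>r\<le>m. cf i r f \<zeta> * cf i (m - r) (der j g) \<zeta>) + (\<Sum>r\<le>m. cf i r (der j f) \<zeta> * cf i (m - r) g \<zeta>))"
    using mult(1,2) by (simp add: der_mult[of I] cf_add[of I] cf_mult[of I] PF_mult PF_der)
  also have "\<dots> = der j (cf i m (\<lambda>\<zeta>. f \<zeta> * g \<zeta>))"
    using mult by (simp add: cf_mult[of I] der_sum[of _ I] der_mult[of I] sum.distrib
        PF_mono[OF PF_cf] PF_mult)
  finally show ?case .
next
  case (var k)
  thus ?case by (cases "m = 0"; cases "m = 1"; cases "i = k"; cases "j = k") (auto simp: der_var cf_var cf_const)
qed (auto simp: der_add[of I] cf_add[of I] cf_const PF_der PF_mono[OF PF_cf])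

lemma cf_commute: "PF I f \<Longrightarrow> i \<noteq> j \<Longrightarrow> cf i m (cf j n f) = cf j n (cf i m f)"
proof (induction arbitrary: m n rule: PF_induct)
  case (mult f g)
  have *: "cf i m (cf j n (\<lambda>\<zeta>. f \<zeta> * g \<zeta>)) =
      (\<lambda>\<zeta>. \<Sum>r\<le>n. \<Sum>s\<le>m. cf i s (cf j r f) \<zeta> * cf i (m - s) (cf j (n - r) g) \<zeta>)" for i j m n
    using mult(1,2) by (simp add: cf_mult[of I] cf_sum[of _ I] PF_mono[OF PF_cf] PF_mult)
  show ?case unfolding * using mult(3-5) by (subst sum.swap) simp
next
  case (var k)
  thus ?case
    by (cases "m = 0"; cases "m = 1"; cases "n = 0"; cases "n = 1"; cases "i = k"; cases "j = k")
      (auto simp: cf_var cf_const)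
qed (auto simp: cf_add[of I] cf_const PF_mono[OF PF_cf])

section \<open>Divided differences and Dunkl operators\<close>

definition sw :: "'v \<Rightarrow> 'v \<Rightarrow> (('v \<Rightarrow> 'a) \<Rightarrow> 'a) \<Rightarrow> ('v \<Rightarrow> 'a) \<Rightarrow> 'a"
  where "sw i j f \<zeta> = f (\<zeta> \<circ> transpose i j)"

lemma sw_commute: "sw i j = sw j i"
  by (simp add: sw_def fun_eq_iff transpose_commute)

lemma sw_const [simp]: "sw i j (\<lambda>_. c) = (\<lambda>_. c)"
  by (simp add: sw_def fun_eq_iff)

lemma comp_transpose_upd: "\<zeta> \<circ> transpose i j = \<zeta>(i := \<zeta> j, j := \<zeta> i)"
  by (auto simp: fun_eq_iff transpose_def)

lemma upd_comp_transpose: "\<zeta>(k := t) \<circ> transpose i j = (\<zeta> \<circ> transpose i j)(transpose i j k := t)"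
  by (auto simp: fun_eq_iff transpose_def)

lemma transpose_image: "i \<in> I \<Longrightarrow> j \<in> I \<Longrightarrow> transpose i j ` I = I"
  by (simp add: transpose_image_eq)

lemma polyfun_sw: "polyfun I n f \<Longrightarrow> i \<in> I \<Longrightarrow> j \<in> I \<Longrightarrow> polyfun I n (sw i j f)"
  using polyfun_comp[of I n f "transpose i j" I]
  by (simp add: transpose_image sw_def[abs_def] comp_def)

lemma PF_sw: "PF I f \<Longrightarrow> i \<in> I \<Longrightarrow> j \<in> I \<Longrightarrow> PF I (sw i j f)"
  by (auto simp: PF_def intro: polyfun_sw)

lemma PF_sw_image: "PF I f \<Longrightarrow> PF (transpose i j ` I) (sw i j f)"
  using PF_comp[of I f "transpose i j" "transpose i j ` I"] by (simp add: sw_def[abs_def] comp_def)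

lemma uni_sw: "PF I f \<Longrightarrow> uni k (sw i j f) \<zeta> = uni (transpose i j k) f (\<zeta> \<circ> transpose i j)"
  by (rule uni_eqI) (simp add: poly_uni sw_def upd_comp_transpose)

lemma cf_sw: "PF I f \<Longrightarrow> cf k m (sw i j f) = sw i j (cf (transpose i j k) m f)"
  by (simp add: cf_def fun_eq_iff uni_sw sw_def)

lemma der_sw: "PF I f \<Longrightarrow> der k (sw i j f) = sw i j (der (transpose i j k) f)"
  by (simp add: der_def fun_eq_iff uni_sw sw_def)

text \<open>The choice ranges over \<open>PF UNIV\<close>, so that \<open>dd\<close> carries no
  index set; density of the points with \<open>\<zeta> i \<noteq> \<zeta> j\<close> makes the
  quotient unique (\<open>dd_eqI\<close>). On the diagonal it is still the polynomial value, not a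
  division by zero.\<close>

definition dd :: "'v \<Rightarrow> 'v \<Rightarrow> (('v \<Rightarrow> 'a::{field,infinite}) \<Rightarrow> 'a) \<Rightarrow> ('v \<Rightarrow> 'a) \<Rightarrow> 'a"
  where "dd i j f = (SOME g. PF UNIV g \<and> (\<forall>\<zeta>. (\<zeta> i - \<zeta> j) * g \<zeta> = f \<zeta> - sw i j f \<zeta>))"

text \<open>Products obey a twisted Leibniz rule: the quotient for \<open>f g\<close> is
  \<open>f' g\<close> plus the swapped \<open>f\<close> times \<open>g'\<close>. Constant factors
  are split off because of truncated subtraction in the degree bound.\<close>

lemma dd_exists:
  fixes f :: "('v \<Rightarrow> 'a::{field,infinite}) \<Rightarrow> 'a"
  assumes "polyfun I n f" and ij: "i \<in> I" "j \<in> I" "i \<noteq> j"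
  shows "\<exists>g. polyfun I (n - 1) g \<and> (\<forall>\<zeta>. (\<zeta> i - \<zeta> j) * g \<zeta> = f \<zeta> - sw i j f \<zeta>)"
  using assms(1)
proof induction
  case (const n c)
  show ?case by (rule exI[of _ "\<lambda>_. 0"]) (auto intro: polyfun.const)
next
  case (var k n)
  show ?case using ij
    by (intro exI[of _ "\<lambda>_. if k = i then 1 else if k = j then -1 else 0"])
      (auto intro: polyfun.const simp: sw_def transpose_def)
next
  case (add n f g)
  then obtain f' g' where "polyfun I (n - 1) f'" "polyfun I (n - 1) g'"
    "\<forall>\<zeta>. (\<zeta> i - \<zeta> j) * f' \<zeta> = f \<zeta> - sw i j f \<zeta>" "\<forall>\<zeta>. (\<zeta> i - \<zeta> j) * g' \<zeta> = g \<zeta> - sw i j g \<zeta>"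
    by blast
  thus ?case
    by (intro exI[of _ "\<lambda>\<zeta>. f' \<zeta> + g' \<zeta>"]) (auto intro: polyfun.add simp: sw_def algebra_simps)
next
  case (mult m f n g)
  then obtain f' g' where *: "polyfun I (m - 1) f'" "polyfun I (n - 1) g'"
    "\<And>\<zeta>. (\<zeta> i - \<zeta> j) * f' \<zeta> = f \<zeta> - sw i j f \<zeta>" "\<And>\<zeta>. (\<zeta> i - \<zeta> j) * g' \<zeta> = g \<zeta> - sw i j g \<zeta>"
    by blast
  consider "m = 0" | "n = 0" | "m > 0" "n > 0" by auto
  thus ?case
  proof cases
    case 1
    have c: "sw i j f \<zeta> = f \<zeta>" for \<zeta> using polyfun_0[OF mult(1) 1] by (simp add: sw_def)
    have "polyfun I (m + n - 1) (\<lambda>\<zeta>. f \<zeta> * g' \<zeta>)"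
      using polyfun.mult[OF mult(1) *(2)] 1 by simp
    moreover have "(\<zeta> i - \<zeta> j) * (f \<zeta> * g' \<zeta>) = f \<zeta> * g \<zeta> - sw i j (\<lambda>\<zeta>. f \<zeta> * g \<zeta>) \<zeta>" for \<zeta>
    proof -
      have "(\<zeta> i - \<zeta> j) * (f \<zeta> * g' \<zeta>) = f \<zeta> * ((\<zeta> i - \<zeta> j) * g' \<zeta>)" by simp
      thus ?thesis using c[of \<zeta>] unfolding *(4) by (simp add: sw_def algebra_simps)
    qed
    ultimately show ?thesis by blast
  next
    case 2
    have c: "sw i j g \<zeta> = g \<zeta>" for \<zeta> using polyfun_0[OF mult(2) 2] by (simp add: sw_def)
    have "polyfun I (m + n - 1) (\<lambda>\<zeta>. f' \<zeta> * g \<zeta>)"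
      using polyfun.mult[OF *(1) mult(2)] 2 by simp
    moreover have "(\<zeta> i - \<zeta> j) * (f' \<zeta> * g \<zeta>) = f \<zeta> * g \<zeta> - sw i j (\<lambda>\<zeta>. f \<zeta> * g \<zeta>) \<zeta>" for \<zeta>
    proof -
      have "(\<zeta> i - \<zeta> j) * (f' \<zeta> * g \<zeta>) = ((\<zeta> i - \<zeta> j) * f' \<zeta>) * g \<zeta>" by simp
      thus ?thesis using c[of \<zeta>] unfolding *(3) by (simp add: sw_def algebra_simps)
    qed
    ultimately show ?thesis by blast
  next
    case 3
    have "polyfun I (m + n - 1) (\<lambda>\<zeta>. f' \<zeta> * g \<zeta> + sw i j f \<zeta> * g' \<zeta>)"
      using polyfun.mult[OF *(1) mult(2)] polyfun.mult[OF polyfun_sw[OF mult(1) ij(1,2)] *(2)] 3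
      by (intro polyfun.add) auto
    moreover have "(\<zeta> i - \<zeta> j) * (f' \<zeta> * g \<zeta> + sw i j f \<zeta> * g' \<zeta>) =
        f \<zeta> * g \<zeta> - sw i j (\<lambda>\<zeta>. f \<zeta> * g \<zeta>) \<zeta>" for \<zeta>
    proof -
      have "(\<zeta> i - \<zeta> j) * (f' \<zeta> * g \<zeta> + sw i j f \<zeta> * g' \<zeta>) =
          ((\<zeta> i - \<zeta> j) * f' \<zeta>) * g \<zeta> + sw i j f \<zeta> * ((\<zeta> i - \<zeta> j) * g' \<zeta>)"
        by (simp add: algebra_simps)
      thus ?thesis unfolding *(3,4) by (simp add: sw_def algebra_simps)
    qed
    ultimately show ?thesis by blast
  qed
qed

lemma dd_eqI:
  fixes f :: "('v \<Rightarrow> 'a::{field,infinite}) \<Rightarrow> 'a"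
  assumes "i \<noteq> j" and g: "PF I g" and eq: "\<And>\<zeta>. (\<zeta> i - \<zeta> j) * g \<zeta> = f \<zeta> - sw i j f \<zeta>"
  shows "dd i j f = g"
  unfolding dd_def
proof (rule some_equality)
  show "PF UNIV g \<and> (\<forall>\<zeta>. (\<zeta> i - \<zeta> j) * g \<zeta> = f \<zeta> - sw i j f \<zeta>)"
    using PF_mono[OF g] eq by simp
next
  fix h assume h: "PF UNIV h \<and> (\<forall>\<zeta>. (\<zeta> i - \<zeta> j) * h \<zeta> = f \<zeta> - sw i j f \<zeta>)"
  show "h = g"
  proof (rule PF_eqI_diff[OF \<open>i \<noteq> j\<close>, of UNIV])
    show "PF UNIV h" "PF UNIV g" using h PF_mono[OF g] by auto
    fix \<zeta> :: "'v \<Rightarrow> 'a" assume "\<zeta> i \<noteq> \<zeta> j"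
    moreover have "(\<zeta> i - \<zeta> j) * h \<zeta> = (\<zeta> i - \<zeta> j) * g \<zeta>" using h eq by simp
    ultimately show "h \<zeta> = g \<zeta>" by simp
  qed
qed

lemma
  fixes f :: "('v \<Rightarrow> 'a::{field,infinite}) \<Rightarrow> 'a"
  assumes "i \<in> I" "j \<in> I" "i \<noteq> j"
  shows polyfun_dd: "polyfun I n f \<Longrightarrow> polyfun I (n - 1) (dd i j f)"
    and PF_dd: "PF I f \<Longrightarrow> PF I (dd i j f)"
    and dd_mult: "PF I f \<Longrightarrow> (\<zeta> i - \<zeta> j) * dd i j f \<zeta> = f \<zeta> - sw i j f \<zeta>"
proof -
  have *: "polyfun I (n - 1) (dd i j f) \<and> (\<forall>\<zeta>. (\<zeta> i - \<zeta> j) * dd i j f \<zeta> = f \<zeta> - sw i j f \<zeta>)"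
    if f: "polyfun I n f" for n
  proof -
    from dd_exists[OF f assms] obtain g where g: "polyfun I (n - 1) g"
      "\<forall>\<zeta>. (\<zeta> i - \<zeta> j) * g \<zeta> = f \<zeta> - sw i j f \<zeta>" by blast
    hence "dd i j f = g" by (intro dd_eqI[OF assms(3)]) (auto simp: PF_def)
    with g show ?thesis by simp
  qed
  thus "polyfun I n f \<Longrightarrow> polyfun I (n - 1) (dd i j f)"
    "PF I f \<Longrightarrow> PF I (dd i j f)" "PF I f \<Longrightarrow> (\<zeta> i - \<zeta> j) * dd i j f \<zeta> = f \<zeta> - sw i j f \<zeta>"
    by (auto simp: PF_def)
qed

lemma dd_val:
  fixes f :: "('v \<Rightarrow> 'a::{field,infinite}) \<Rightarrow> 'a"
  assumes "PF I f" "i \<in> I" "j \<in> I" "\<zeta> i \<noteq> \<zeta> j"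
  shows "dd i j f \<zeta> = (f \<zeta> - f (\<zeta>(i := \<zeta> j, j := \<zeta> i))) / (\<zeta> i - \<zeta> j)"
  using dd_mult[OF assms(2,3) _ assms(1), of \<zeta>] assms(4)
  by (auto simp: field_simps sw_def comp_transpose_upd)

context
  fixes I :: "'v set" and i j :: 'v
  assumes ij: "i \<in> I" "j \<in> I" "i \<noteq> j"
begin

lemma dd_const [simp]: "dd i j (\<lambda>_. c) = (\<lambda>_. 0 :: 'a::{field,infinite})"
  by (rule dd_eqI[OF ij(3) PF_const]) simp

lemma dd_add:
  fixes f g :: "('v \<Rightarrow> 'a::{field,infinite}) \<Rightarrow> 'a"
  assumes "PF I f" "PF I g"
  shows "dd i j (\<lambda>\<zeta>. f \<zeta> + g \<zeta>) = (\<lambda>\<zeta>. dd i j f \<zeta> + dd i j g \<zeta>)"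
  using assms ij
  by (intro dd_eqI[of _ _ I] PF_add PF_dd) (auto simp: dd_mult[of _ I] distrib_left, simp add: sw_def)

lemma dd_diff:
  fixes f g :: "('v \<Rightarrow> 'a::{field,infinite}) \<Rightarrow> 'a"
  assumes "PF I f" "PF I g"
  shows "dd i j (\<lambda>\<zeta>. f \<zeta> - g \<zeta>) = (\<lambda>\<zeta>. dd i j f \<zeta> - dd i j g \<zeta>)"
  using assms ij
  by (intro dd_eqI[of _ _ I] PF_diff PF_dd) (auto simp: dd_mult[of _ I] right_diff_distrib, simp add: sw_def)

lemma dd_minus:
  fixes f :: "('v \<Rightarrow> 'a::{field,infinite}) \<Rightarrow> 'a"
  assumes "PF I f"
  shows "dd i j (\<lambda>\<zeta>. - f \<zeta>) = (\<lambda>\<zeta>. - dd i j f \<zeta>)"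
  using assms ij
  by (intro dd_eqI[of _ _ I] PF_minus PF_dd) (auto simp: dd_mult[of _ I], simp add: sw_def)

lemma dd_sum:
  fixes f :: "'b \<Rightarrow> ('v \<Rightarrow> 'a::{field,infinite}) \<Rightarrow> 'a"
  assumes "\<And>a. a \<in> A \<Longrightarrow> PF I (f a)"
  shows "dd i j (\<lambda>\<zeta>. \<Sum>a\<in>A. f a \<zeta>) = (\<lambda>\<zeta>. \<Sum>a\<in>A. dd i j (f a) \<zeta>)"
  using assms by (induction A rule: infinite_finite_induct) (auto simp: dd_add PF_sum)

lemma dd_sym:
  fixes f :: "('v \<Rightarrow> 'a::{field,infinite}) \<Rightarrow> 'a"
  assumes "PF I f"
  shows "dd j i f = (\<lambda>\<zeta>. - dd i j f \<zeta>)"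
proof (rule dd_eqI)
  show "PF I (\<lambda>\<zeta>. - dd i j f \<zeta>)" using assms ij by (intro PF_minus PF_dd)
  fix \<zeta> :: "'v \<Rightarrow> 'a"
  have "(\<zeta> j - \<zeta> i) * - dd i j f \<zeta> = (\<zeta> i - \<zeta> j) * dd i j f \<zeta>" by (simp add: algebra_simps)
  thus "(\<zeta> j - \<zeta> i) * - dd i j f \<zeta> = f \<zeta> - sw j i f \<zeta>"
    using dd_mult[OF ij assms] by (simp add: sw_commute)
qed (use ij in auto)

lemma dd_swap_inv:
  fixes f :: "('v \<Rightarrow> 'a::{field,infinite}) \<Rightarrow> 'a"
  assumes "sw i j f = f"
  shows "dd i j f = (\<lambda>_. 0)"
  by (rule dd_eqI[OF ij(3) PF_const]) (simp add: assms)

lemma der_dd_neq: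
  fixes f :: "('v \<Rightarrow> 'a::{field,infinite}) \<Rightarrow> 'a"
  assumes f: "PF I f" and k: "k \<noteq> i" "k \<noteq> j"
  shows "der k (dd i j f) = dd i j (der k f)"
proof (rule sym, rule dd_eqI[OF ij(3)])
  fix \<zeta> :: "'v \<Rightarrow> 'a"
  have "der k (\<lambda>\<zeta>. (\<zeta> i - \<zeta> j) * dd i j f \<zeta>) \<zeta> = (\<zeta> i - \<zeta> j) * der k (dd i j f) \<zeta>"
    using k ij f by (simp add: der_mult[of I] der_diff[of I] der_var PF_dd PF_diff PF_var)
  also have "(\<lambda>\<zeta>. (\<zeta> i - \<zeta> j) * dd i j f \<zeta>) = (\<lambda>\<zeta>. f \<zeta> - sw i j f \<zeta>)"
    using dd_mult[OF ij f] by simp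
  also have "der k \<dots> \<zeta> = der k f \<zeta> - sw i j (der k f) \<zeta>"
    using k f ij by (simp add: der_diff[of I] PF_sw der_sw[of I])
  finally show "(\<zeta> i - \<zeta> j) * der k (dd i j f) \<zeta> = der k f \<zeta> - sw i j (der k f) \<zeta>" by simp
qed (rule PF_der[OF PF_dd[OF ij f]])

lemma cf_dd_neq:
  fixes f :: "('v \<Rightarrow> 'a::{field,infinite}) \<Rightarrow> 'a"
  assumes f: "PF I f" and k: "k \<noteq> i" "k \<noteq> j"
  shows "cf k m (dd i j f) = dd i j (cf k m f)"
proof (rule sym, rule dd_eqI[OF ij(3)])
  show "PF I (cf k m (dd i j f))"
    by (rule PF_mono[OF PF_cf[OF PF_dd[OF ij f]]]) auto
  fix \<zeta> :: "'v \<Rightarrow> 'a"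
  have "cf k m (\<lambda>\<zeta>. (\<zeta> i - \<zeta> j) * dd i j f \<zeta>) \<zeta> =
      (\<Sum>r\<le>m. (if r = 0 then \<zeta> i - \<zeta> j else 0) * cf k (m - r) (dd i j f) \<zeta>)"
    using k ij f
    by (subst cf_mult[of I]) (auto simp: cf_diff[of I] cf_var PF_dd PF_diff PF_var intro!: sum.cong)
  also have "\<dots> = (\<zeta> i - \<zeta> j) * cf k m (dd i j f) \<zeta>"
    by (subst sum.remove[of _ 0]) auto
  also have "(\<lambda>\<zeta>. (\<zeta> i - \<zeta> j) * dd i j f \<zeta>) = (\<lambda>\<zeta>. f \<zeta> - sw i j f \<zeta>)"
    using dd_mult[OF ij f] by simp
  also have "cf k m \<dots> \<zeta> = cf k m f \<zeta> - sw i j (cf k m f) \<zeta>"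
    using k f ij by (simp add: cf_diff[of I] PF_sw cf_sw[of I])
  finally show "(\<zeta> i - \<zeta> j) * cf k m (dd i j f) \<zeta> = cf k m f \<zeta> - sw i j (cf k m f) \<zeta>" by simp
qed

text \<open>Compares coefficients of \<open>\<zeta> i ^ Suc m\<close> in the equation defining
  \<open>dd\<close>; the coefficient in \<open>\<zeta> i\<close> of the swapped \<open>f\<close> is
  the swapped coefficient of \<open>f\<close> in \<open>\<zeta> j\<close>.\<close>

lemma cf_dd:
  fixes f :: "('v \<Rightarrow> 'a::{field,infinite}) \<Rightarrow> 'a"
  assumes f: "PF I f"
  shows "cf i (Suc m) f \<zeta> - sw i j (cf j (Suc m) f) \<zeta> = cf i m (dd i j f) \<zeta> - \<zeta> j * cf i (Suc m) (dd i j f) \<zeta>"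
proof -
  have "[:- \<zeta> j, 1:] * uni i (dd i j f) \<zeta> = uni i (\<lambda>\<zeta>. (\<zeta> i - \<zeta> j) * dd i j f \<zeta>) \<zeta>"
    using ij f by (subst uni_mult[of I]) (auto simp: uni_diff[of I] uni_var PF_dd PF_var PF_diff)
  also have "(\<lambda>\<zeta>. (\<zeta> i - \<zeta> j) * dd i j f \<zeta>) = (\<lambda>\<zeta>. f \<zeta> - sw i j f \<zeta>)"
    using dd_mult[OF ij f] by simp
  also have "uni i \<dots> \<zeta> = uni i f \<zeta> - uni j f (\<zeta> \<circ> transpose i j)"
    using ij f by (simp add: uni_diff[of I] PF_sw uni_sw[of I])
  finally have "coeff ([:- \<zeta> j, 1:] * uni i (dd i j f) \<zeta>) (Suc m) =
      coeff (uni i f \<zeta> - uni j f (\<zeta> \<circ> transpose i j)) (Suc m)" by simp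
  thus ?thesis by (simp add: cf_def sw_def)
qed

text \<open>Division by \<open>\<zeta> i - \<zeta> j\<close> costs one degree in
  \<open>\<zeta> i\<close>. Bounds in both variables enter because the swap turns degree in
  \<open>\<zeta> j\<close> into degree in \<open>\<zeta> i\<close>.\<close>

lemma cf_dd_eq_0:
  fixes f :: "('v \<Rightarrow> 'a::{field,infinite}) \<Rightarrow> 'a"
  assumes f: "PF I f" and "\<And>m. m > M \<Longrightarrow> cf i m f = (\<lambda>_. 0)" "\<And>m. m > M \<Longrightarrow> cf j m f = (\<lambda>_. 0)"
    and "m \<ge> M"
  shows "cf i m (dd i j f) = (\<lambda>_. 0)"
proof (rule ext, rule ccontr)
  fix \<zeta> assume "cf i m (dd i j f) \<zeta> \<noteq> 0"
  hence m: "m \<le> degree (uni i (dd i j f) \<zeta>)" (is "_ \<le> ?d") and ne: "uni i (dd i j f) \<zeta> \<noteq> 0"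
    by (auto simp: cf_def le_degree)
  \<comment> \<open>At the exact degree \<open>?d\<close> the last term of \<open>cf_dd\<close>
    vanishes, and the left side involves only coefficients of \<open>f\<close> beyond
    \<open>M\<close>.\<close>
  have "cf i ?d (dd i j f) \<zeta> = 0"
    using cf_dd[OF f, of "?d" \<zeta>] assms(2,3)[of "Suc ?d"] m \<open>m \<ge> M\<close>
    by (simp add: cf_def[of i "Suc ?d" "dd i j f"] coeff_eq_0)
  thus False using ne by (simp add: cf_def)
qed

text \<open>The operator \<open>der i + der j\<close> commutes with the swap and kills
  \<open>\<zeta> i - \<zeta> j\<close>; neither summand alone does.\<close>

lemma der_add_dd:
  fixes f :: "('v \<Rightarrow> 'a::{field,infinite}) \<Rightarrow> 'a"
  assumes f: "PF I f"
  shows "der i (dd i j f) \<zeta> + der j (dd i j f) \<zeta> = dd i j (der i f) \<zeta> + dd i j (der j f) \<zeta>"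
proof -
  have "dd i j (\<lambda>\<zeta>. der i f \<zeta> + der j f \<zeta>) = (\<lambda>\<zeta>. der i (dd i j f) \<zeta> + der j (dd i j f) \<zeta>)"
  proof (rule dd_eqI[OF ij(3)])
    show "PF I (\<lambda>\<zeta>. der i (dd i j f) \<zeta> + der j (dd i j f) \<zeta>)"
      using f ij by (intro PF_add PF_der PF_dd)
    fix \<zeta> :: "'v \<Rightarrow> 'a"
    have eq: "(\<lambda>\<zeta>. (\<zeta> i - \<zeta> j) * dd i j f \<zeta>) = (\<lambda>\<zeta>. f \<zeta> - sw i j f \<zeta>)"
      using dd_mult[OF ij f] by simp
    have r: "der k (\<lambda>\<zeta>. f \<zeta> - sw i j f \<zeta>) \<zeta> = der k f \<zeta> - sw i j (der (transpose i j k) f) \<zeta>" for k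
      using f ij by (simp add: der_diff[of I] PF_sw der_sw[of I])
    have l: "der k (\<lambda>\<zeta>. (\<zeta> i - \<zeta> j) * dd i j f \<zeta>) \<zeta> = (\<zeta> i - \<zeta> j) * der k (dd i j f) \<zeta> +
        ((if k = i then 1 else 0) - (if k = j then 1 else 0)) * dd i j f \<zeta>" for k
      using ij f by (subst der_mult[of I]) (auto simp: der_diff[of I] der_var PF_dd PF_diff PF_var)
    have 1: "(\<zeta> i - \<zeta> j) * der i (dd i j f) \<zeta> + dd i j f \<zeta> = der i f \<zeta> - sw i j (der j f) \<zeta>"
      using l[of i] r[of i] ij by (simp add: eq)
    have 2: "(\<zeta> i - \<zeta> j) * der j (dd i j f) \<zeta> - dd i j f \<zeta> = der j f \<zeta> - sw i j (der i f) \<zeta>"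
      using l[of j] r[of j] ij by (simp add: eq)
    show "(\<zeta> i - \<zeta> j) * (der i (dd i j f) \<zeta> + der j (dd i j f) \<zeta>) =
        der i f \<zeta> + der j f \<zeta> - sw i j (\<lambda>\<zeta>. der i f \<zeta> + der j f \<zeta>) \<zeta>"
    proof -
      have "(\<zeta> i - \<zeta> j) * (der i (dd i j f) \<zeta> + der j (dd i j f) \<zeta>) =
          ((\<zeta> i - \<zeta> j) * der i (dd i j f) \<zeta> + dd i j f \<zeta>) +
          ((\<zeta> i - \<zeta> j) * der j (dd i j f) \<zeta> - dd i j f \<zeta>)"
        by (simp add: algebra_simps)
      thus ?thesis unfolding 1 2 by (simp add: sw_def)
    qed
  qed
  moreover have "dd i j (\<lambda>\<zeta>. der i f \<zeta> + der j f \<zeta>) = (\<lambda>\<zeta>. dd i j (der i f) \<zeta> + dd i j (der j f) \<zeta>)"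
    using f by (intro dd_add PF_der)
  ultimately show ?thesis by (metis (mono_tags, lifting))
qed

end

section \<open>Relations between divided differences with different indices\<close>

lemma transpose_conj:
  "transpose (transpose a b i) (transpose a b j) \<circ> transpose a b = transpose a b \<circ> transpose i j"
  by (auto simp: fun_eq_iff transpose_def)

lemma sw_dd:
  fixes f :: "('v \<Rightarrow> 'a::{field,infinite}) \<Rightarrow> 'a"
  assumes "PF I f" "i \<in> I" "j \<in> I" "i \<noteq> j"
  shows "sw a b (dd i j f) = dd (transpose a b i) (transpose a b j) (sw a b f)"
proof (rule sym, rule dd_eqI)
  show "PF (transpose a b ` I) (sw a b (dd i j f))"
    using assms by (intro PF_sw_image PF_dd)
  fix \<zeta> :: "'v \<Rightarrow> 'a"
  show "(\<zeta> (transpose a b i) - \<zeta> (transpose a b j)) * sw a b (dd i j f) \<zeta> =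
      sw a b f \<zeta> - sw (transpose a b i) (transpose a b j) (sw a b f) \<zeta>"
    using dd_mult[OF assms(2-4,1), of "\<zeta> \<circ> transpose a b"]
    by (simp add: sw_def comp_assoc transpose_conj)
qed (use assms in \<open>metis transpose_involutory\<close>)

text \<open>At points with distinct coordinates both sides are the same alternating sum over the two
  commuting swaps, divided by the same two differences.\<close>

lemma dd_dd_disjoint:
  fixes f :: "('v \<Rightarrow> 'a::{field,infinite}) \<Rightarrow> 'a"
  assumes I: "finite I" and f: "PF I f" and mem: "i \<in> I" "p \<in> I" "j \<in> I" "q \<in> I"
    and d: "distinct [i, p, j, q]"
  shows "dd i p (dd j q f) \<zeta> = dd j q (dd i p f) \<zeta>"
proof -
  have "dd i p (dd j q f) = dd j q (dd i p f)"
  proof (rule PF_eqI_inj[OF I])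
    show "PF I (dd i p (dd j q f))" "PF I (dd j q (dd i p f))"
      using f mem d by (auto intro!: PF_dd)
    fix \<zeta> :: "'v \<Rightarrow> 'a" assume inj: "inj_on \<zeta> I"
    \<comment> \<open>Making the four coordinates explicit turns an iterated divided difference into
      plain rewriting with \<open>v1\<close> and \<open>v2\<close>.\<close>
    define P where "P x y z t = \<zeta>(i := x, p := y, j := z, q := t)" for x y z t
    have v1: "dd i p h (P x y z t) = (h (P x y z t) - h (P y x z t)) / (x - y)"
      if "PF I h" "x \<noteq> y" for h x y z t
    proof -
      have "P y x z t = (P x y z t)(i := P x y z t p, p := P x y z t i)"
        using d by (auto simp: P_def)
      thus ?thesis using dd_val[OF that(1) mem(1,2), of "P x y z t"] that(2) d by (auto simp: P_def)
    qed
    have v2: "dd j q h (P x y z t) = (h (P x y z t) - h (P x y t z)) / (z - t)"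
      if "PF I h" "z \<noteq> t" for h x y z t
    proof -
      have "P x y t z = (P x y z t)(j := P x y z t q, q := P x y z t j)"
        using d by (auto simp: P_def)
      thus ?thesis using dd_val[OF that(1) mem(3,4), of "P x y z t"] that(2) d by (auto simp: P_def)
    qed
    have ne: "\<zeta> i \<noteq> \<zeta> p" "\<zeta> j \<noteq> \<zeta> q" using inj mem d by (auto simp: inj_on_def)
    have pf: "PF I (dd j q f)" "PF I (dd i p f)" using f mem d by (auto intro!: PF_dd)
    have "dd i p (dd j q f) (P x y z t) = dd j q (dd i p f) (P x y z t)"
      if "x \<noteq> y" "z \<noteq> t" for x y z t
      using that by (simp add: v1 v2 pf f divide_inverse algebra_simps)
    from this[OF ne] show "dd i p (dd j q f) \<zeta> = dd j q (dd i p f) \<zeta>"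
      by (simp only: P_def fun_upd_triv)
  qed
  thus ?thesis by simp
qed

text \<open>The relation behind the commutativity of Dunkl operators. With \<open>a\<close>,
  \<open>b\<close>, \<open>c\<close> the inverses of \<open>x - y\<close>, \<open>x - z\<close>,
  \<open>y - z\<close>, the terms at the identity and at the transpositions cancel, and those at the
  two 3-cycles carry the factor \<open>a c - b c - a b\<close>, which is zero by Arnold's partial
  fraction identity.\<close>

lemma dd_yang_baxter:
  fixes f :: "('v \<Rightarrow> 'a::{field,infinite}) \<Rightarrow> 'a"
  assumes I: "finite I" and f: "PF I f" and mem: "i \<in> I" "j \<in> I" "p \<in> I"
    and d: "distinct [i, j, p]"
  shows "dd i j (dd j p f) \<zeta> - dd i p (dd i j f) \<zeta> + dd i p (dd j p f) \<zeta> =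
    - dd i j (dd i p f) \<zeta> + dd j p (dd i j f) \<zeta> + dd j p (dd i p f) \<zeta>"
proof -
  have "(\<lambda>\<zeta>. dd i j (dd j p f) \<zeta> - dd i p (dd i j f) \<zeta> + dd i p (dd j p f) \<zeta>) =
      (\<lambda>\<zeta>. - dd i j (dd i p f) \<zeta> + dd j p (dd i j f) \<zeta> + dd j p (dd i p f) \<zeta>)"
  proof (rule PF_eqI_inj[OF I])
    show "PF I (\<lambda>\<zeta>. dd i j (dd j p f) \<zeta> - dd i p (dd i j f) \<zeta> + dd i p (dd j p f) \<zeta>)"
      "PF I (\<lambda>\<zeta>. - dd i j (dd i p f) \<zeta> + dd j p (dd i j f) \<zeta> + dd j p (dd i p f) \<zeta>)"
      using f mem d by (intro PF_diff PF_add PF_minus PF_dd; simp)+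
    fix \<zeta> :: "'v \<Rightarrow> 'a" assume inj: "inj_on \<zeta> I"
    define P where "P x y z = \<zeta>(i := x, j := y, p := z)" for x y z
    have v1: "dd i j h (P x y z) = (h (P x y z) - h (P y x z)) / (x - y)"
      if "PF I h" "x \<noteq> y" for h x y z
    proof -
      have "P y x z = (P x y z)(i := P x y z j, j := P x y z i)"
        using d by (auto simp: P_def)
      thus ?thesis using dd_val[OF that(1) mem(1,2), of "P x y z"] that(2) d by (auto simp: P_def)
    qed
    have v2: "dd i p h (P x y z) = (h (P x y z) - h (P z y x)) / (x - z)"
      if "PF I h" "x \<noteq> z" for h x y z
    proof -
      have "P z y x = (P x y z)(i := P x y z p, p := P x y z i)"
        using d by (auto simp: P_def)
      thus ?thesis using dd_val[OF that(1) mem(1,3), of "P x y z"] that(2) d by (auto simp: P_def)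
    qed
    have v3: "dd j p h (P x y z) = (h (P x y z) - h (P x z y)) / (y - z)"
      if "PF I h" "y \<noteq> z" for h x y z
    proof -
      have "P x z y = (P x y z)(j := P x y z p, p := P x y z j)"
        using d by (auto simp: P_def)
      thus ?thesis using dd_val[OF that(1) mem(2,3), of "P x y z"] that(2) d by (auto simp: P_def)
    qed
    have ne: "\<zeta> i \<noteq> \<zeta> j" "\<zeta> i \<noteq> \<zeta> p" "\<zeta> j \<noteq> \<zeta> p" using inj mem d by (auto simp: inj_on_def)
    have pf: "PF I (dd i j f)" "PF I (dd i p f)" "PF I (dd j p f)" using f mem d by (auto intro!: PF_dd)
    have "dd i j (dd j p f) (P x y z) - dd i p (dd i j f) (P x y z) + dd i p (dd j p f) (P x y z) =
        - dd i j (dd i p f) (P x y z) + dd j p (dd i j f) (P x y z) + dd j p (dd i p f) (P x y z)"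
      if ne: "x \<noteq> y" "x \<noteq> z" "y \<noteq> z" for x y z
    proof -
      define a b c where "a = inverse (x - y)" and "b = inverse (x - z)" and "c = inverse (y - z)"
      have inv: "inverse (y - x) = - a" "inverse (z - x) = - b" "inverse (z - y) = - c"
        using inverse_minus_eq[of "x - y"] inverse_minus_eq[of "x - z"] inverse_minus_eq[of "y - z"]
        by (simp_all add: a_def b_def c_def)
      have "a * (x - y) = 1" "b * (x - z) = 1" "c * (y - z) = 1"
        using ne by (simp_all add: a_def b_def c_def)
      moreover have "a * c * (b * (x - z)) = b * c * (a * (x - y)) + a * b * (c * (y - z))"
        by (simp add: algebra_simps)
      ultimately have arnold: "a * c = b * c + a * b" by simp
      have "dd i j (dd j p f) (P x y z) =
          ((f (P x y z) - f (P x z y)) * c - (f (P y x z) - f (P y z x)) * b) * a"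
        using ne by (simp add: v1 v3 pf f divide_inverse a_def b_def c_def)
      moreover have "dd i p (dd i j f) (P x y z) =
          ((f (P x y z) - f (P y x z)) * a + (f (P z y x) - f (P y z x)) * c) * b"
        using ne by (simp add: v1 v2 pf f divide_inverse inv) (simp add: a_def b_def)
      moreover have "dd i p (dd j p f) (P x y z) =
          ((f (P x y z) - f (P x z y)) * c + (f (P z y x) - f (P z x y)) * a) * b"
        using ne by (simp add: v2 v3 pf f divide_inverse inv) (simp add: c_def b_def)
      moreover have "dd i j (dd i p f) (P x y z) =
          ((f (P x y z) - f (P z y x)) * b - (f (P y x z) - f (P z x y)) * c) * a"
        using ne by (simp add: v1 v2 pf f divide_inverse a_def b_def c_def)
      moreover have "dd j p (dd i j f) (P x y z) =
          ((f (P x y z) - f (P y x z)) * a - (f (P x z y) - f (P z x y)) * b) * c"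
        using ne by (simp add: v1 v3 pf f divide_inverse a_def b_def c_def)
      moreover have "dd j p (dd i p f) (P x y z) =
          ((f (P x y z) - f (P z y x)) * b - (f (P x z y) - f (P y z x)) * a) * c"
        using ne by (simp add: v2 v3 pf f divide_inverse a_def b_def c_def)
      ultimately have "dd i j (dd j p f) (P x y z) - dd i p (dd i j f) (P x y z) + dd i p (dd j p f) (P x y z) -
          (- dd i j (dd i p f) (P x y z) + dd j p (dd i j f) (P x y z) + dd j p (dd i p f) (P x y z)) =
          (a * c - (b * c + a * b)) * (f (P z x y) - f (P y z x))"
        by (simp only:) (simp add: algebra_simps)
      thus ?thesis unfolding arnold by (simp only: diff_self mult_zero_left right_minus_eq)
    qed
    from this[OF ne] show "dd i j (dd j p f) \<zeta> - dd i p (dd i j f) \<zeta> + dd i p (dd j p f) \<zeta> =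
      - dd i j (dd i p f) \<zeta> + dd j p (dd i j f) \<zeta> + dd j p (dd i p f) \<zeta>"
      by (simp only: P_def fun_upd_triv)
  qed
  thus ?thesis by (rule fun_cong)
qed

text \<open>The Dunkl operator of the symmetric group on \<open>I\<close> with parameter -1. The
  sign is the one that \<open>lagrange_derivative\<close> produces in
  \<open>dunkl_w\<close>.\<close>

definition dunkl :: "'v set \<Rightarrow> 'v \<Rightarrow> (('v \<Rightarrow> 'a::{field,infinite}) \<Rightarrow> 'a) \<Rightarrow> ('v \<Rightarrow> 'a) \<Rightarrow> 'a"
  where "dunkl I i f = (\<lambda>\<zeta>. der i f \<zeta> - (\<Sum>p\<in>I - {i}. dd i p f \<zeta>))"

text \<open>A bound for each variable separately, which Dunkl operators preserve; the total degree,
  which they lower, is tracked by \<open>polyfun\<close>.\<close>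

definition bdeg :: "'v set \<Rightarrow> nat \<Rightarrow> (('v \<Rightarrow> 'a::{field,infinite}) \<Rightarrow> 'a) \<Rightarrow> bool"
  where "bdeg I M f \<longleftrightarrow> (\<forall>k\<in>I. \<forall>m>M. cf k m f = (\<lambda>_. 0))"

lemma bdegD: "bdeg I M f \<Longrightarrow> k \<in> I \<Longrightarrow> m > M \<Longrightarrow> cf k m f = (\<lambda>_. 0)"
  by (auto simp: bdeg_def)

lemma bdeg_diff: "PF I f \<Longrightarrow> PF I g \<Longrightarrow> bdeg I M f \<Longrightarrow> bdeg I M g \<Longrightarrow> bdeg I M (\<lambda>\<zeta>. f \<zeta> - g \<zeta>)"
  by (auto simp: bdeg_def cf_diff[of I])

lemma bdeg_sum: "(\<And>a. a \<in> A \<Longrightarrow> PF I (f a)) \<Longrightarrow> (\<And>a. a \<in> A \<Longrightarrow> bdeg I M (f a)) \<Longrightarrow>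
    bdeg I M (\<lambda>\<zeta>. \<Sum>a\<in>A. f a \<zeta>)"
  by (auto simp: bdeg_def cf_sum[of _ I])

lemma bdeg_sw: "PF I f \<Longrightarrow> i \<in> I \<Longrightarrow> j \<in> I \<Longrightarrow> bdeg I M f \<Longrightarrow> bdeg I M (sw i j f)"
  unfolding bdeg_def
proof (intro ballI allI impI)
  fix k m assume *: "PF I f" "i \<in> I" "j \<in> I" "\<forall>k\<in>I. \<forall>m>M. cf k m f = (\<lambda>_. 0)" "k \<in> I" "M < m"
  have "transpose i j k \<in> I" using transpose_image[of i I j] * by blast
  with * show "cf k m (sw i j f) = (\<lambda>_. 0)" by (simp add: cf_sw[of I])
qed

lemma bdeg_der: "PF I f \<Longrightarrow> bdeg I M f \<Longrightarrow> bdeg I M (der i f)"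
  unfolding bdeg_def
proof (intro ballI allI impI)
  fix k m assume *: "PF I f" "\<forall>k\<in>I. \<forall>m>M. cf k m f = (\<lambda>_. 0)" "k \<in> I" "M < m"
  show "cf k m (der i f) = (\<lambda>_. 0)"
    using * by (cases "k = i") (auto simp: cf_der[of I] cf_der_neq[of I])
qed

lemma bdeg_dd:
  fixes f :: "('v \<Rightarrow> 'a::{field,infinite}) \<Rightarrow> 'a"
  assumes ij: "i \<in> I" "j \<in> I" "i \<noteq> j" and f: "PF I f" and b: "bdeg I M f"
  shows "bdeg I M (dd i j f)"
  unfolding bdeg_def
proof (intro ballI allI impI)
  fix k m assume *: "k \<in> I" "M < m"
  consider "k = i" | "k = j" | "k \<noteq> i" "k \<noteq> j" by blast
  thus "cf k m (dd i j f) = (\<lambda>_. 0)"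
  proof cases
    case 1
    thus ?thesis using cf_dd_eq_0[OF ij f, of M m] bdegD[OF b] ij * by simp
  next
    case 2
    have "cf j m (dd j i f) = (\<lambda>_. 0)"
      using cf_dd_eq_0[OF ij(2,1) _ f, of M m] bdegD[OF b] ij * by simp
    moreover have "dd i j f = (\<lambda>\<zeta>. - dd j i f \<zeta>)" using dd_sym[of j I i f] ij f by auto
    ultimately show ?thesis using 2 PF_dd[of j I i f] ij f by (simp add: cf_minus[of I])
  next
    case 3
    thus ?thesis using cf_dd_neq[OF ij f 3] bdegD[OF b *] ij by simp
  qed
qed

section \<open>Linearity, equivariance and commutativity of the Dunkl operators\<close>

context
  fixes I :: "'v set"
  assumes I: "finite I"
begin

lemma polyfun_dunkl:
  fixes f :: "('v \<Rightarrow> 'a::{field,infinite}) \<Rightarrow> 'a"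
  assumes "i \<in> I" "polyfun I n f"
  shows "polyfun I (n - 1) (dunkl I i f)"
  unfolding dunkl_def using assms by (intro polyfun_diff polyfun_sum polyfun_der polyfun_dd) auto

lemma PF_dunkl:
  fixes f :: "('v \<Rightarrow> 'a::{field,infinite}) \<Rightarrow> 'a"
  assumes "i \<in> I" "PF I f"
  shows "PF I (dunkl I i f)"
  using polyfun_dunkl assms by (auto simp: PF_def)

lemma dunkl_const [simp]: "i \<in> I \<Longrightarrow> dunkl I i (\<lambda>_. c) = (\<lambda>_. 0 :: 'a::{field,infinite})"
proof -
  assume "i \<in> I"
  hence "dd i p (\<lambda>_. c) = (\<lambda>_. 0)" if "p \<in> I - {i}" for p
    using that dd_const[of i I p] by auto
  thus ?thesis by (simp add: dunkl_def)
qed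

lemma dunkl_add:
  fixes f g :: "('v \<Rightarrow> 'a::{field,infinite}) \<Rightarrow> 'a"
  assumes "i \<in> I" "PF I f" "PF I g"
  shows "dunkl I i (\<lambda>\<zeta>. f \<zeta> + g \<zeta>) = (\<lambda>\<zeta>. dunkl I i f \<zeta> + dunkl I i g \<zeta>)"
proof -
  have "dd i p (\<lambda>\<zeta>. f \<zeta> + g \<zeta>) = (\<lambda>\<zeta>. dd i p f \<zeta> + dd i p g \<zeta>)" if "p \<in> I - {i}" for p
    using that assms dd_add[of i I p f g] by auto
  thus ?thesis using assms by (simp add: dunkl_def der_add[of I] sum.distrib algebra_simps)
qed

lemma dunkl_diff:
  fixes f g :: "('v \<Rightarrow> 'a::{field,infinite}) \<Rightarrow> 'a"
  assumes "i \<in> I" "PF I f" "PF I g"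
  shows "dunkl I i (\<lambda>\<zeta>. f \<zeta> - g \<zeta>) = (\<lambda>\<zeta>. dunkl I i f \<zeta> - dunkl I i g \<zeta>)"
proof -
  have "dd i p (\<lambda>\<zeta>. f \<zeta> - g \<zeta>) = (\<lambda>\<zeta>. dd i p f \<zeta> - dd i p g \<zeta>)" if "p \<in> I - {i}" for p
    using that assms dd_diff[of i I p f g] by auto
  thus ?thesis using assms by (simp add: dunkl_def der_diff[of I] sum_subtractf algebra_simps)
qed

lemma dunkl_minus:
  fixes f :: "('v \<Rightarrow> 'a::{field,infinite}) \<Rightarrow> 'a"
  assumes "i \<in> I" "PF I f"
  shows "dunkl I i (\<lambda>\<zeta>. - f \<zeta>) = (\<lambda>\<zeta>. - dunkl I i f \<zeta>)"
proof -
  have "dd i p (\<lambda>\<zeta>. - f \<zeta>) = (\<lambda>\<zeta>. - dd i p f \<zeta>)" if "p \<in> I - {i}" for p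
    using that assms dd_minus[of i I p f] by auto
  thus ?thesis using assms by (simp add: dunkl_def der_minus[of I] sum_negf)
qed

lemma dunkl_sum:
  fixes f :: "'b \<Rightarrow> ('v \<Rightarrow> 'a::{field,infinite}) \<Rightarrow> 'a"
  assumes "i \<in> I" "\<And>a. a \<in> A \<Longrightarrow> PF I (f a)"
  shows "dunkl I i (\<lambda>\<zeta>. \<Sum>a\<in>A. f a \<zeta>) = (\<lambda>\<zeta>. \<Sum>a\<in>A. dunkl I i (f a) \<zeta>)"
  using assms(2) by (induction A rule: infinite_finite_induct) (auto simp: dunkl_add PF_sum assms(1))

lemma bdeg_dunkl:
  fixes f :: "('v \<Rightarrow> 'a::{field,infinite}) \<Rightarrow> 'a"
  assumes "i \<in> I" "PF I f" "bdeg I M f"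
  shows "bdeg I M (dunkl I i f)"
  unfolding dunkl_def using assms
  by (intro bdeg_diff bdeg_sum bdeg_der bdeg_dd PF_sum PF_der PF_dd) auto

lemma sw_dunkl:
  fixes f :: "('v \<Rightarrow> 'a::{field,infinite}) \<Rightarrow> 'a"
  assumes ab: "a \<in> I" "b \<in> I" and i: "i \<in> I" and f: "PF I f"
  shows "sw a b (dunkl I i f) = dunkl I (transpose a b i) (sw a b f)"
proof
  fix \<zeta> :: "'v \<Rightarrow> 'a"
  let ?\<tau> = "transpose a b"
  have "der i f (\<zeta> \<circ> ?\<tau>) = der (?\<tau> i) (sw a b f) \<zeta>"
    using f by (simp add: der_sw[of I]) (simp add: sw_def)
  moreover have "(\<Sum>p\<in>I - {i}. dd i p f (\<zeta> \<circ> ?\<tau>)) = (\<Sum>p\<in>I - {?\<tau> i}. dd (?\<tau> i) p (sw a b f) \<zeta>)"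
  proof (rule sum.reindex_bij_witness[of _ ?\<tau> ?\<tau>])
    fix p assume p: "p \<in> I - {i}"
    show "?\<tau> p \<in> I - {?\<tau> i}"
      using p transpose_image[OF ab] by (auto simp: dest: injD[OF inj_transpose])
    show "dd (?\<tau> i) (?\<tau> p) (sw a b f) \<zeta> = dd i p f (\<zeta> \<circ> ?\<tau>)"
      using sw_dd[of I f i p a b] f p i by (auto simp: sw_def fun_eq_iff)
  next
    fix p assume p: "p \<in> I - {?\<tau> i}"
    thus "?\<tau> p \<in> I - {i}"
      using p transpose_image[OF ab] by auto
  qed auto
  ultimately show "sw a b (dunkl I i f) \<zeta> = dunkl I (?\<tau> i) (sw a b f) \<zeta>"
    by (simp only: sw_def[of a b "dunkl I i f"]) (simp only: dunkl_def)
qed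

text \<open>The expansion has three kinds of terms. Derivatives commute. A derivative against a
  divided difference is settled by \<open>der_add_dd\<close> for the pair \<open>i\<close>,
  \<open>j\<close> and by \<open>der_dd_neq\<close> when a third index occurs. Products of two
  divided differences commute for disjoint pairs and otherwise obey the Yang-Baxter
  relation.\<close>

lemma dunkl_commute:
  fixes f :: "('v \<Rightarrow> 'a::{field,infinite}) \<Rightarrow> 'a"
  assumes ij: "i \<in> I" "j \<in> I" "i \<noteq> j" and f: "PF I f"
  shows "dunkl I i (dunkl I j f) = dunkl I j (dunkl I i f)"
proof
  fix \<zeta> :: "'v \<Rightarrow> 'a"
  define J where "J = I - {i, j}"
  have J: "finite J" and pJ: "p \<in> I" "p \<noteq> i" "p \<noteq> j" if "p \<in> J" for p
    using that I by (auto simp: J_def)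
  have Jf: "finite J" using I by (auto simp: J_def)
  have pf: "PF I (der k f)" for k using f by (rule PF_der)
  have pfd: "PF I (dd i p f)" "PF I (dd j p f)" if "p \<in> J" for p
    using pJ[OF that] f ij by (auto intro!: PF_dd)
  have pfij: "PF I (dd i j f)" using f ij by (intro PF_dd)
  have ex1: "(\<Sum>p\<in>I - {i}. dd i p h \<zeta>) = dd i j h \<zeta> + (\<Sum>p\<in>J. dd i p h \<zeta>)" for h :: "('v \<Rightarrow> 'a) \<Rightarrow> 'a" and \<zeta>
  proof -
    have "I - {i} = insert j J" using ij by (auto simp: J_def)
    moreover have "j \<notin> J" by (simp add: J_def)
    ultimately show ?thesis using sum.insert[OF Jf, of j "\<lambda>p. dd i p h \<zeta>"] by simp
  qed
  have ex2: "(\<Sum>p\<in>I - {j}. dd j p h \<zeta>) = - dd i j h \<zeta> + (\<Sum>p\<in>J. dd j p h \<zeta>)"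
    if "PF I h" for h :: "('v \<Rightarrow> 'a) \<Rightarrow> 'a" and \<zeta>
  proof -
    have "I - {j} = insert i J" using ij by (auto simp: J_def)
    moreover have "i \<notin> J" by (simp add: J_def)
    ultimately show ?thesis
      using sum.insert[OF Jf, of i "\<lambda>p. dd j p h \<zeta>"] dd_sym[OF ij that] by simp
  qed
  have di: "dunkl I i h = (\<lambda>\<zeta>. der i h \<zeta> - dd i j h \<zeta> - (\<Sum>p\<in>J. dd i p h \<zeta>))" for h :: "('v \<Rightarrow> 'a) \<Rightarrow> 'a"
    by (simp add: dunkl_def ex1 diff_diff_eq)
  have dj: "dunkl I j h = (\<lambda>\<zeta>. der j h \<zeta> + dd i j h \<zeta> - (\<Sum>p\<in>J. dd j p h \<zeta>))"
    if "PF I h" for h :: "('v \<Rightarrow> 'a) \<Rightarrow> 'a"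
    using that by (simp add: dunkl_def ex2 fun_eq_iff)
  have pfs: "PF I (\<lambda>\<zeta>. \<Sum>p\<in>J. dd i p f \<zeta>)" "PF I (\<lambda>\<zeta>. \<Sum>p\<in>J. dd j p f \<zeta>)"
    using pfd by (auto intro!: PF_sum)
  have der_r: "der k (dunkl I i f) \<zeta> = der k (der i f) \<zeta> - der k (dd i j f) \<zeta> - (\<Sum>p\<in>J. der k (dd i p f) \<zeta>)"
    "der k (dunkl I j f) \<zeta> = der k (der j f) \<zeta> + der k (dd i j f) \<zeta> - (\<Sum>p\<in>J. der k (dd j p f) \<zeta>)" for k
    unfolding di dj[OF f] using pf pfij pfs pfd
    by (simp_all add: der_diff[of I] der_add[of I] PF_diff PF_add der_sum[of _ I])
  have dd_r: "dd k l (dunkl I i f) \<zeta> = dd k l (der i f) \<zeta> - dd k l (dd i j f) \<zeta> - (\<Sum>p\<in>J. dd k l (dd i p f) \<zeta>)"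
    "dd k l (dunkl I j f) \<zeta> = dd k l (der j f) \<zeta> + dd k l (dd i j f) \<zeta> - (\<Sum>p\<in>J. dd k l (dd j p f) \<zeta>)"
    if "k \<in> I" "l \<in> I" "k \<noteq> l" for k l
    unfolding di dj[OF f] using pf pfij pfs pfd that
    by (simp_all add: dd_diff[of _ I] dd_add[of _ I] PF_diff PF_add dd_sum[of _ I])
  have pfi: "PF I (dunkl I i f)" using PF_dunkl ij f by blast
  \<comment> \<open>The part with two divided differences. Once the double sums are aligned, only
    the diagonal \<open>q = p\<close> fails to cancel, and \<open>dd_yang_baxter\<close> rewrites it
    into the remaining single sums.\<close>
  have pp: "(\<Sum>p\<in>J. dd i p (dd i j f) \<zeta>) - (\<Sum>p\<in>J. dd i j (dd j p f) \<zeta>) - (\<Sum>p\<in>J. \<Sum>q\<in>J. dd i p (dd j q f) \<zeta>)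
      = (\<Sum>p\<in>J. dd i j (dd i p f) \<zeta>) - (\<Sum>p\<in>J. dd j p (dd i j f) \<zeta>) - (\<Sum>p\<in>J. \<Sum>q\<in>J. dd j p (dd i q f) \<zeta>)"
  proof -
    have "(\<Sum>p\<in>J. \<Sum>q\<in>J. dd i p (dd j q f) \<zeta>) - (\<Sum>p\<in>J. \<Sum>q\<in>J. dd j p (dd i q f) \<zeta>) =
        (\<Sum>p\<in>J. \<Sum>q\<in>J. dd i p (dd j q f) \<zeta>) - (\<Sum>q\<in>J. \<Sum>p\<in>J. dd j p (dd i q f) \<zeta>)"
      by (subst (2) sum.swap) simp
    also have "\<dots> = (\<Sum>p\<in>J. \<Sum>q\<in>J. dd i p (dd j q f) \<zeta> - dd j q (dd i p f) \<zeta>)"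
      by (simp add: sum_subtractf)
    also have "\<dots> = (\<Sum>p\<in>J. \<Sum>q\<in>J. if q = p then dd i p (dd j p f) \<zeta> - dd j p (dd i p f) \<zeta> else 0)"
    proof (intro sum.cong refl)
      fix p q assume "p \<in> J" "q \<in> J"
      thus "dd i p (dd j q f) \<zeta> - dd j q (dd i p f) \<zeta> =
          (if q = p then dd i p (dd j p f) \<zeta> - dd j p (dd i p f) \<zeta> else 0)"
        using dd_dd_disjoint[OF I f, of i p j q] pJ ij by auto
    qed
    also have "\<dots> = (\<Sum>p\<in>J. dd i p (dd j p f) \<zeta> - dd j p (dd i p f) \<zeta>)"
      using Jf by (simp add: sum.delta)
    also have "\<dots> = (\<Sum>p\<in>J. dd i p (dd i j f) \<zeta> - dd i j (dd j p f) \<zeta> - dd i j (dd i p f) \<zeta> + dd j p (dd i j f) \<zeta>)"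
    proof (intro sum.cong refl)
      fix p assume "p \<in> J"
      hence "distinct [i, j, p]" "p \<in> I" using pJ[of p] ij by auto
      thus "dd i p (dd j p f) \<zeta> - dd j p (dd i p f) \<zeta> =
          dd i p (dd i j f) \<zeta> - dd i j (dd j p f) \<zeta> - dd i j (dd i p f) \<zeta> + dd j p (dd i j f) \<zeta>"
        using dd_yang_baxter[OF I f, of i j p \<zeta>] ij by (simp add: algebra_simps)
    qed
    finally show ?thesis by (simp add: sum.distrib sum_subtractf algebra_simps)
  qed
  have "dunkl I i (dunkl I j f) \<zeta> = der i (dunkl I j f) \<zeta> - dd i j (dunkl I j f) \<zeta> - (\<Sum>p\<in>J. dd i p (dunkl I j f) \<zeta>)"
    by (simp add: di[of "dunkl I j f"])
  also have "(\<Sum>p\<in>J. dd i p (dunkl I j f) \<zeta>) = (\<Sum>p\<in>J. dd i p (der j f) \<zeta> + dd i p (dd i j f) \<zeta> - (\<Sum>q\<in>J. dd i p (dd j q f) \<zeta>))"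
    using pJ ij by (intro sum.cong refl dd_r) auto
  finally have 1: "dunkl I i (dunkl I j f) \<zeta> =
      der i (der j f) \<zeta> + der i (dd i j f) \<zeta> - (\<Sum>p\<in>J. der i (dd j p f) \<zeta>)
      - (dd i j (der j f) \<zeta> + dd i j (dd i j f) \<zeta> - (\<Sum>p\<in>J. dd i j (dd j p f) \<zeta>))
      - ((\<Sum>p\<in>J. dd i p (der j f) \<zeta>) + (\<Sum>p\<in>J. dd i p (dd i j f) \<zeta>) - (\<Sum>p\<in>J. \<Sum>q\<in>J. dd i p (dd j q f) \<zeta>))"
    using ij by (simp add: der_r dd_r sum.distrib sum_subtractf)
  have "dunkl I j (dunkl I i f) \<zeta> = der j (dunkl I i f) \<zeta> + dd i j (dunkl I i f) \<zeta> - (\<Sum>p\<in>J. dd j p (dunkl I i f) \<zeta>)"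
    by (simp add: dj[OF pfi])
  also have "(\<Sum>p\<in>J. dd j p (dunkl I i f) \<zeta>) = (\<Sum>p\<in>J. dd j p (der i f) \<zeta> - dd j p (dd i j f) \<zeta> - (\<Sum>q\<in>J. dd j p (dd i q f) \<zeta>))"
    using pJ ij by (intro sum.cong refl dd_r) auto
  finally have 2: "dunkl I j (dunkl I i f) \<zeta> =
      der j (der i f) \<zeta> - der j (dd i j f) \<zeta> - (\<Sum>p\<in>J. der j (dd i p f) \<zeta>)
      + (dd i j (der i f) \<zeta> - dd i j (dd i j f) \<zeta> - (\<Sum>p\<in>J. dd i j (dd i p f) \<zeta>))
      - ((\<Sum>p\<in>J. dd j p (der i f) \<zeta>) - (\<Sum>p\<in>J. dd j p (dd i j f) \<zeta>) - (\<Sum>p\<in>J. \<Sum>q\<in>J. dd j p (dd i q f) \<zeta>))"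
    using ij by (simp add: der_r dd_r sum.distrib sum_subtractf)
  have 3: "der i (der j f) \<zeta> = der j (der i f) \<zeta>" by (simp add: der_commute[OF f])
  have 4: "der i (dd i j f) \<zeta> - dd i j (der j f) \<zeta> = - der j (dd i j f) \<zeta> + dd i j (der i f) \<zeta>"
    using der_add_dd[OF ij f, of \<zeta>] by (simp add: algebra_simps)
  have 5: "(\<Sum>p\<in>J. der i (dd j p f) \<zeta>) = (\<Sum>p\<in>J. dd j p (der i f) \<zeta>)"
    using pJ ij f by (intro sum.cong refl fun_cong[OF der_dd_neq[of j I]]) auto
  have 6: "(\<Sum>p\<in>J. der j (dd i p f) \<zeta>) = (\<Sum>p\<in>J. dd i p (der j f) \<zeta>)"
    using pJ ij f by (intro sum.cong refl fun_cong[OF der_dd_neq[of i I]]) auto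
  show "dunkl I i (dunkl I j f) \<zeta> = dunkl I j (dunkl I i f) \<zeta>"
    unfolding 1 2 3 5 6 using 4 pp by (simp add: algebra_simps)
qed

end

section \<open>Polynomials annihilated by the Dunkl operators\<close>

lemma bdeg_0_const:
  fixes f :: "('v \<Rightarrow> 'a::{field,infinite}) \<Rightarrow> 'a"
  assumes I: "finite I" and f: "PF I f" and b: "bdeg I 0 f"
  shows "f = (\<lambda>_. f (\<lambda>_. 0))"
proof
  fix \<zeta> :: "'v \<Rightarrow> 'a"
  have upd: "f (\<zeta>(k := t)) = f \<zeta>" if "k \<in> I" for k t \<zeta>
  proof -
    have "coeff (uni k f \<zeta>) m = 0" if "m > 0" for m
      using bdegD[OF b \<open>k \<in> I\<close> that] by (auto simp: cf_def fun_eq_iff)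
    hence "degree (uni k f \<zeta>) = 0" by (metis leading_coeff_0_iff degree_0 gr0I)
    then obtain c where "uni k f \<zeta> = [:c:]" by (rule degree_eq_zeroE)
    thus ?thesis using poly_uni[OF f, of k \<zeta> t] poly_uni_self[OF f, of k \<zeta>] by simp
  qed
  have "f (\<lambda>v. if v \<in> A then 0 else \<zeta> v) = f \<zeta>" if "finite A" "A \<subseteq> I" for A
    using that
  proof (induction A rule: finite_induct)
    case (insert k A)
    have "(\<lambda>v. if v \<in> insert k A then 0 else \<zeta> v) = (\<lambda>v. if v \<in> A then 0 else \<zeta> v)(k := 0)"
      by auto
    thus ?case using insert upd[of k] by simp
  qed simp
  from this[OF I] have "f (\<lambda>v. if v \<in> I then 0 else \<zeta> v) = f \<zeta>" by simp
  moreover have "f (\<lambda>v. if v \<in> I then 0 else \<zeta> v) = f (\<lambda>_. 0)"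
    by (rule PF_cong_point[OF f]) simp
  ultimately show "f \<zeta> = f (\<lambda>_. 0)" by simp
qed

definition flat :: "'v set \<Rightarrow> (('v \<Rightarrow> 'a::{field,infinite}) \<Rightarrow> 'a) \<Rightarrow> bool"
  where "flat I f \<longleftrightarrow> PF I f \<and> (\<forall>i\<in>I. dunkl I i f = (\<lambda>_. 0))"

lemma flat_diff: "finite I \<Longrightarrow> flat I f \<Longrightarrow> flat I g \<Longrightarrow> flat I (\<lambda>\<zeta>. f \<zeta> - g \<zeta>)"
  by (auto simp: flat_def dunkl_diff)

lemma flat_sum: "finite I \<Longrightarrow> (\<And>a. a \<in> A \<Longrightarrow> flat I (f a)) \<Longrightarrow> flat I (\<lambda>\<zeta>. \<Sum>a\<in>A. f a \<zeta>)"
  by (auto simp: flat_def dunkl_sum)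

lemma flat_sw:
  assumes "finite I" "a \<in> I" "b \<in> I" "flat I f"
  shows "flat I (sw a b f)"
  unfolding flat_def
proof (intro conjI ballI)
  show "PF I (sw a b f)" using assms by (auto simp: flat_def intro: PF_sw)
  fix i assume "i \<in> I"
  hence "transpose a b i \<in> I" using transpose_image[OF assms(2,3)] by blast
  thus "dunkl I i (sw a b f) = (\<lambda>_. 0)"
    using sw_dunkl[OF assms(1-3), of "transpose a b i" f] assms(4) by (simp add: flat_def)
qed

lemma cf_dunkl:
  fixes f :: "('v \<Rightarrow> 'a::{field,infinite}) \<Rightarrow> 'a"
  assumes "PF I f" "i \<in> I"
  shows "cf k m (dunkl I i f) \<zeta> = cf k m (der i f) \<zeta> - (\<Sum>p\<in>I - {i}. cf k m (dd i p f) \<zeta>)"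
proof -
  have pfd: "PF I (dd i p f)" if "p \<in> I - {i}" for p using that assms by (intro PF_dd) auto
  show ?thesis
    unfolding dunkl_def
    by (subst cf_diff[of I], rule PF_der[OF assms(1)], rule PF_sum, erule pfd,
        subst cf_sum[of _ I], erule pfd) (rule refl)
qed

text \<open>The term \<open>dd j i f\<close> has degree less than \<open>m\<close> in
  \<open>\<zeta> i\<close> and contributes nothing to the top coefficient; every other term of
  \<open>dunkl I j\<close> commutes with taking it. This is what permits induction on the number of
  variables.\<close>

lemma leading_coeff_flat:
  fixes f :: "('v \<Rightarrow> 'a::{field,infinite}) \<Rightarrow> 'a"
  assumes I: "finite I" and f: "flat I f" and b: "bdeg I m f" and i: "i \<in> I"
  shows "flat (I - {i}) (cf i m f)" "bdeg (I - {i}) m (cf i m f)"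
proof -
  have pf: "PF I f" using f by (simp add: flat_def)
  show "bdeg (I - {i}) m (cf i m f)"
    unfolding bdeg_def
  proof (intro ballI allI impI)
    fix k m' assume "k \<in> I - {i}" "m < m'"
    thus "cf k m' (cf i m f) = (\<lambda>_. 0)"
      using cf_commute[OF pf, of k i m' m] bdegD[OF b, of k m'] by (simp add: cf_const)
  qed
  show "flat (I - {i}) (cf i m f)"
    unfolding flat_def
  proof (intro conjI ballI)
    show "PF (I - {i}) (cf i m f)" using pf by (rule PF_cf)
    fix j assume j: "j \<in> I - {i}"
    have split: "I - {j} = insert i (I - {i} - {j})" using i j by auto
    have pfd: "PF I (dd j p f)" if "p \<in> I - {j}" for p using that j pf by (intro PF_dd) auto
    have "cf i m (dunkl I j f) = (\<lambda>_. 0)" using f j by (simp add: flat_def cf_const)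
    hence "(\<lambda>\<zeta>. der j (cf i m f) \<zeta> - (\<Sum>p\<in>I - {j}. cf i m (dd j p f) \<zeta>)) = (\<lambda>_. 0)"
      using cf_dunkl[OF pf, of j i m] j cf_der_neq[OF pf, of i j m] by (auto simp: fun_eq_iff)
    moreover have "(\<Sum>p\<in>I - {j}. cf i m (dd j p f) \<zeta>) = (\<Sum>p\<in>I - {i} - {j}. dd j p (cf i m f) \<zeta>)" for \<zeta>
    proof -
      have "cf i m (dd i j f) = (\<lambda>_. 0)"
        using cf_dd_eq_0[of i I j f m m] bdegD[OF b] i j pf by auto
      moreover have "dd j i f = (\<lambda>\<zeta>. - dd i j f \<zeta>)" using dd_sym[of i I j f] i j pf by auto
      moreover have "PF I (dd i j f)" using i j pf by (intro PF_dd) auto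
      ultimately have 0: "cf i m (dd j i f) = (\<lambda>_. 0)" by (simp add: cf_minus[of I])
      have "cf i m (dd j p f) = dd j p (cf i m f)" if "p \<in> I - {i} - {j}" for p
        using that j pf by (intro cf_dd_neq[of j I]) auto
      thus ?thesis unfolding split using I 0 by (subst sum.insert) auto
    qed
    ultimately show "dunkl (I - {i}) j (cf i m f) = (\<lambda>_. 0)"
      by (simp add: dunkl_def)
  qed
qed

text \<open>Evaluation at the origin loses nothing when the leading coefficient is constant, and
  swaps fix the origin, so they merely permute these values.\<close>

definition topc :: "nat \<Rightarrow> (('v \<Rightarrow> 'a::{field,infinite}) \<Rightarrow> 'a) \<Rightarrow> 'v \<Rightarrow> 'a"
  where "topc m f i = cf i m f (\<lambda>_. 0)"

lemma topc_sw: "PF I f \<Longrightarrow> topc m (sw a b f) i = topc m f (transpose a b i)"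
  by (simp add: topc_def cf_sw[of I]) (simp add: sw_def comp_def)

lemma topc_diff: "PF I f \<Longrightarrow> PF I g \<Longrightarrow> topc m (\<lambda>\<zeta>. f \<zeta> - g \<zeta>) i = topc m f i - topc m g i"
  by (simp add: topc_def cf_diff[of I])

lemma topc_sum: "(\<And>a. a \<in> A \<Longrightarrow> PF I (f a)) \<Longrightarrow> topc m (\<lambda>\<zeta>. \<Sum>a\<in>A. f a \<zeta>) i = (\<Sum>a\<in>A. topc m (f a) i)"
  by (simp add: topc_def cf_sum[of _ I])

text \<open>The coefficient of \<open>\<zeta> i ^ m\<close> in \<open>dunkl I i f = 0\<close>, taken
  at the origin: the derivative gives \<open>Suc m\<close> times the leading coefficient at
  \<open>i\<close>, and the divided difference with \<open>p\<close> gives the leading coefficient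
  at \<open>i\<close> minus the one at \<open>p\<close>.\<close>

lemma topc_flat_eq:
  fixes f :: "('v \<Rightarrow> 'a::{field,infinite}) \<Rightarrow> 'a"
  assumes I: "finite I" and f: "flat I f" and b: "bdeg I (Suc m) f"
    and const: "\<And>i. i \<in> I \<Longrightarrow> cf i (Suc m) f = (\<lambda>_. topc (Suc m) f i)"
    and i: "i \<in> I"
  shows "of_nat (Suc m) * topc (Suc m) f i = of_nat (card I) * topc (Suc m) f i - (\<Sum>j\<in>I. topc (Suc m) f j)"
proof -
  have pf: "PF I f" using f by (simp add: flat_def)
  have pfd: "PF I (dd i p f)" if "p \<in> I - {i}" for p using that i pf by (intro PF_dd) auto
  let ?t = "topc (Suc m) f"
  have "cf i m (dunkl I i f) (\<lambda>_. 0) = 0" using f i by (simp add: flat_def cf_const)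
  hence "of_nat (Suc m) * ?t i - (\<Sum>p\<in>I - {i}. cf i m (dd i p f) (\<lambda>_. 0)) = 0"
    using cf_dunkl[OF pf i, of i m] pf by (simp add: cf_der[of I] topc_def)
  moreover have "cf i m (dd i p f) (\<lambda>_. 0) = ?t i - ?t p" if "p \<in> I - {i}" for p
  proof -
    have "cf i (Suc m) f (\<lambda>_. 0) - sw i p (cf p (Suc m) f) (\<lambda>_. 0) = cf i m (dd i p f) (\<lambda>_. 0)"
      using cf_dd[of i I p f m "\<lambda>_. 0"] that i pf by auto
    thus ?thesis using const[OF i] const[of p] that by simp
  qed
  ultimately have "of_nat (Suc m) * ?t i = (\<Sum>p\<in>I - {i}. ?t i - ?t p)" by simp
  also have "\<dots> = (\<Sum>p\<in>I. ?t i - ?t p)" using I i by (subst (2) sum.remove[of _ i]) auto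
  finally show ?thesis by (simp add: sum_subtractf)
qed

lemma bdeg_mono: "bdeg I m f \<Longrightarrow> m \<le> n \<Longrightarrow> bdeg I n f"
  by (auto simp: bdeg_def)

lemma bdeg_Suc_iff: "bdeg I m f \<longleftrightarrow> bdeg I (Suc m) f \<and> (\<forall>i\<in>I. cf i (Suc m) f = (\<lambda>_. 0))"
  (is "?l \<longleftrightarrow> ?r")
proof
  assume ?r
  show ?l unfolding bdeg_def
  proof (intro ballI allI impI)
    fix k n assume "k \<in> I" "n > m"
    thus "cf k n f = (\<lambda>_. 0)" using \<open>?r\<close> by (cases "n = Suc m") (auto simp: bdeg_def)
  qed
qed (auto simp: bdeg_def)

text \<open>Away from degree \<open>card I\<close> the linear system of \<open>topc_flat_eq\<close>
  makes all leading coefficients equal to some \<open>t\<close>; then their sum is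
  \<open>card I\<close> times \<open>t\<close>, which leaves \<open>Suc m\<close> times
  \<open>t\<close> equal to zero.\<close>

lemma topc_zero:
  fixes f :: "('v \<Rightarrow> 'a::{field,infinite}) \<Rightarrow> 'a"
  assumes I: "finite I" and f: "flat I f" and b: "bdeg I (Suc m) f"
    and const: "\<And>i. i \<in> I \<Longrightarrow> cf i (Suc m) f = (\<lambda>_. topc (Suc m) f i)"
    and nz: "\<And>n. 0 < n \<Longrightarrow> n \<le> B \<Longrightarrow> of_nat n \<noteq> (0 :: 'a)"
    and le: "Suc m \<le> B" "card I \<le> B" and ne: "Suc m \<noteq> card I"
  shows "bdeg I m f"
proof -
  let ?t = "topc (Suc m) f"
  \<comment> \<open>Up to sign a positive integer of size at most \<open>B\<close>: this is why
    \<open>B\<close> has to bound both the degree and the number of variables.\<close>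
  define d :: 'a where "d = of_nat (card I) - of_nat (Suc m)"
  have d: "d \<noteq> 0"
  proof (cases "Suc m < card I")
    case True
    hence "d = of_nat (card I - Suc m)" by (simp add: d_def of_nat_diff)
    thus ?thesis using nz[of "card I - Suc m"] True le by simp
  next
    case False
    hence "d = - of_nat (Suc m - card I)" by (simp add: d_def of_nat_diff)
    moreover have "of_nat (Suc m - card I) \<noteq> (0 :: 'a)"
      using nz[of "Suc m - card I"] False le ne by linarith
    ultimately show ?thesis by simp
  qed
  have eq: "d * ?t i = (\<Sum>j\<in>I. ?t j)" if "i \<in> I" for i
    using topc_flat_eq[OF I f b const that] by (simp add: d_def algebra_simps)
  have "?t i = 0" if i: "i \<in> I" for i
  proof -
    have "?t j = ?t i" if "j \<in> I" for j
    proof -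
      have "d * ?t j = d * ?t i" using eq[OF i] eq[OF that] by simp
      thus ?thesis using d by simp
    qed
    hence "(\<Sum>j\<in>I. ?t j) = of_nat (card I) * ?t i" by simp
    hence "of_nat (Suc m) * ?t i = 0" using topc_flat_eq[OF I f b const i] by simp
    thus ?thesis using nz[of "Suc m"] le by simp
  qed
  thus ?thesis using b const bdeg_Suc_iff[of I m f] by simp
qed

text \<open>Below degree \<open>card I\<close> there is no resonance, so \<open>topc_zero\<close>
  lowers the degree down to 0.\<close>

lemma flat_small_const:
  fixes f :: "('v \<Rightarrow> 'a::{field,infinite}) \<Rightarrow> 'a"
  assumes I: "finite I"
    and IH: "\<And>i g. i \<in> I \<Longrightarrow> flat (I - {i}) g \<Longrightarrow> bdeg (I - {i}) B g \<Longrightarrow> \<exists>c. g = (\<lambda>_. c :: 'a)"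
    and nz: "\<And>n. 0 < n \<Longrightarrow> n \<le> B \<Longrightarrow> of_nat n \<noteq> (0 :: 'a)"
    and le: "card I \<le> B" and f: "flat I f"
  shows "bdeg I m f \<Longrightarrow> m < card I \<Longrightarrow> \<exists>c. f = (\<lambda>_. c)"
proof (induction m)
  case 0
  thus ?case using bdeg_0_const[OF I, of f] f by (auto simp: flat_def)
next
  case (Suc m)
  have const: "cf i (Suc m) f = (\<lambda>_. topc (Suc m) f i)" if "i \<in> I" for i
  proof -
    have "\<exists>c. cf i (Suc m) f = (\<lambda>_. c)"
      using leading_coeff_flat[OF I f Suc.prems(1) that] Suc.prems(2) le
      by (intro IH[OF that]) (auto elim: bdeg_mono)
    thus ?thesis by (auto simp: topc_def)
  qed
  have "bdeg I m f"
    by (rule topc_zero[OF I f Suc.prems(1) const nz]) (use le Suc.prems(2) in auto)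
  thus ?case using Suc by simp
qed

section \<open>Multilinear coefficients and the Euler-Poisson-Darboux equation\<close>

definition mcoeff :: "'v list \<Rightarrow> (('v \<Rightarrow> 'a::{field,infinite}) \<Rightarrow> 'a) \<Rightarrow> ('v \<Rightarrow> 'a) \<Rightarrow> 'a"
  where "mcoeff = fold (\<lambda>k. cf k 1)"

lemma mcoeff_Cons: "mcoeff (k # ks) f = mcoeff ks (cf k 1 f)"
  and mcoeff_snoc: "mcoeff (ks @ [k]) f = cf k 1 (mcoeff ks f)"
  and mcoeff_Nil: "mcoeff [] f = f"
  by (simp_all add: mcoeff_def)

lemma mcoeff_sum: "(\<And>a. a \<in> A \<Longrightarrow> PF I (f a)) \<Longrightarrow>
    mcoeff ks (\<lambda>\<zeta>. \<Sum>a\<in>A. f a \<zeta>) = (\<lambda>\<zeta>. \<Sum>a\<in>A. mcoeff ks (f a) \<zeta>)"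
proof (induction ks arbitrary: f)
  case (Cons k ks)
  have "PF I (cf k 1 (f a))" if "a \<in> A" for a using PF_mono[OF PF_cf[OF Cons.prems[OF that]]] by auto
  thus ?case using Cons by (simp add: mcoeff_Cons cf_sum[of _ I])
qed (simp add: mcoeff_Nil)

lemma mcoeff_perm: "PF I f \<Longrightarrow> mset ks = mset ls \<Longrightarrow> mcoeff ks f = mcoeff ls f"
  unfolding mcoeff_def
proof (rule fold_permuted_eq[of ks ls "PF I"])
  fix i j and g :: "('a \<Rightarrow> 'b) \<Rightarrow> 'b" assume "PF I g"
  thus "cf i 1 (cf j 1 g) = cf j 1 (cf i 1 g)" by (cases "i = j") (auto intro: cf_commute)
qed (auto intro: PF_mono[OF PF_cf])

lemma mcoeff_sw: "PF I f \<Longrightarrow> mcoeff ks (sw a b f) = sw a b (mcoeff (map (transpose a b) ks) f)"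
proof (induction ks arbitrary: f)
  case (Cons k ks)
  thus ?case using PF_mono[OF PF_cf[OF Cons.prems]]
    by (simp add: mcoeff_Cons cf_sw[of I])
qed (simp add: mcoeff_Nil)

lemma mcoeff_const: "ks \<noteq> [] \<Longrightarrow> mcoeff ks (\<lambda>_. c) = (\<lambda>_. 0)"
proof (induction ks arbitrary: c)
  case (Cons k ks)
  thus ?case by (cases ks) (auto simp: mcoeff_Cons mcoeff_Nil cf_const)
qed simp

text \<open>The Euler--Poisson--Darboux equation relates the coefficients of the monomials in which
  \<open>\<zeta> a\<close> has degree \<open>r\<close>, resp. degree \<open>r - 1\<close> and \<open>\<zeta> k\<close> degree one.\<close>

lemma epd_step:
  fixes h :: "('v \<Rightarrow> 'a::{field,infinite}) \<Rightarrow> 'a"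
  assumes ka: "k \<in> I" "a \<in> I" "k \<noteq> a" and h: "PF I h" and eq: "der k h = dd k a h"
  shows "of_nat r * cf a r (cf k 1 h) (\<lambda>_. 0) = - of_nat (Suc r) * cf a (Suc r) h (\<lambda>_. 0)"
proof -
  let ?o = "\<lambda>_. 0 :: 'a"
  have sw0: "sw x y g ?o = g ?o" for x y :: 'v and g :: "('v \<Rightarrow> 'a) \<Rightarrow> 'a" by (simp add: sw_def comp_def)
  \<comment> \<open>Coefficient of a pure power of \<open>\<zeta> k\<close> in the equation: it ties
    the pure powers of \<open>\<zeta> k\<close> to those of \<open>\<zeta> a\<close>.\<close>
  have "cf k (Suc r) h ?o - cf a (Suc r) h ?o = cf k r (dd k a h) ?o"
    using cf_dd[OF ka h, of r ?o] by (simp add: sw0)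
  also have "\<dots> = of_nat (Suc r) * cf k (Suc r) h ?o" by (simp flip: eq add: cf_der[OF h])
  finally have 1: "of_nat r * cf k (Suc r) h ?o = - cf a (Suc r) h ?o"
    by (simp add: algebra_simps eq_neg_iff_add_eq_0)
  have pfk: "PF I (cf a r h)" using PF_mono[OF PF_cf[OF h]] by auto
  \<comment> \<open>A linear coefficient is a derivative at the origin, where the equation can be
    inserted again. The mixed coefficient becomes a difference of two pure ones, and fact 1
    eliminates the one in \<open>\<zeta> k\<close>.\<close>
  have "cf k 1 (cf a r h) ?o = der k (cf a r h) ?o"
    by (simp add: cf_def der_def poly_0_coeff_0 coeff_pderiv)
  also have "der k (cf a r h) = cf a r (der k h)" using ka by (simp add: cf_der_neq[OF h])
  also have "\<dots> ?o = - cf a r (dd a k h) ?o"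
  proof -
    have "dd k a h = (\<lambda>\<zeta>. - dd a k h \<zeta>)" using dd_sym[of a I k h] ka h by auto
    moreover have "PF I (dd a k h)" using ka h by (intro PF_dd) auto
    ultimately show ?thesis by (simp add: eq cf_minus[of I])
  qed
  also have "cf a r (dd a k h) ?o = cf a (Suc r) h ?o - cf k (Suc r) h ?o"
    using cf_dd[of a I k h r ?o] ka h by (simp add: sw0)
  finally have 2: "cf a r (cf k 1 h) ?o = cf k (Suc r) h ?o - cf a (Suc r) h ?o"
    using ka by (simp add: cf_commute[OF h])
  show ?thesis unfolding 2 right_diff_distrib 1 by (simp add: algebra_simps)
qed

text \<open>Each step trades one power of \<open>\<zeta> a\<close> for one new linear variable, and
  \<open>epd_step\<close> keeps the coefficient nonzero as long as \<open>Suc r\<close> is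
  invertible.\<close>

lemma epd_chain:
  fixes F :: "('v \<Rightarrow> 'a::{field,infinite}) \<Rightarrow> 'a"
  assumes F: "PF I F" and a: "a \<in> I" and L: "distinct L" "set L \<subseteq> I - {a}"
    and eq: "\<And>k. k \<in> set L \<Longrightarrow> der k F = dd k a F"
    and nz: "\<And>n. 0 < n \<Longrightarrow> n \<le> Suc (length L) \<Longrightarrow> of_nat n \<noteq> (0 :: 'a)"
    and start: "cf a (Suc (length L)) F (\<lambda>_. 0) \<noteq> 0"
  shows "cf a 1 (mcoeff L F) (\<lambda>_. 0) \<noteq> 0"
  using assms
proof (induction L arbitrary: F)
  case Nil
  thus ?case by (simp add: mcoeff_Nil)
next
  case (Cons k L)
  let ?h = "cf k 1 F"
  have h: "PF I ?h" using PF_mono[OF PF_cf[OF Cons.prems(1)]] by auto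
  have "of_nat (Suc (length L)) * cf a (Suc (length L)) ?h (\<lambda>_. 0) =
      - of_nat (Suc (Suc (length L))) * cf a (Suc (Suc (length L))) F (\<lambda>_. 0)"
    using Cons.prems by (intro epd_step[of k I a]) auto
  moreover have "of_nat (Suc (Suc (length L))) \<noteq> (0 :: 'a)"
    using Cons.prems(6)[of "Suc (Suc (length L))"] by simp
  ultimately have ne: "cf a (Suc (length L)) ?h (\<lambda>_. 0) \<noteq> 0"
    using Cons.prems(7) by (metis length_Cons mult_eq_0_iff neg_equal_0_iff_equal)
  \<comment> \<open>The coefficient in \<open>\<zeta> k\<close> commutes with operators in the other
    variables, so it inherits their equations.\<close>
  have "der l ?h = dd l a ?h" if "l \<in> set L" for l
  proof -
    have l: "l \<noteq> k" "l \<noteq> a" "l \<in> I" "k \<noteq> a" using that Cons.prems by auto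
    have "der l ?h = cf k 1 (der l F)" using l by (simp add: cf_der_neq[OF Cons.prems(1)])
    also have "der l F = dd l a F" using Cons.prems(5)[of l] that by simp
    also have "cf k 1 (dd l a F) = dd l a ?h"
      using l Cons.prems by (intro cf_dd_neq[of l I a]) auto
    finally show ?thesis .
  qed
  hence "cf a 1 (mcoeff L ?h) (\<lambda>_. 0) \<noteq> 0"
    using Cons.prems ne by (intro Cons.IH h) auto
  thus ?case by (simp add: mcoeff_Cons)
qed

text \<open>In degree \<open>card I\<close> the leading coefficients \<open>topc\<close> only have to sum to zero. If they do not
  vanish, antisymmetrising and averaging gives a solution \<open>F\<close> that is symmetric in the variables other than
  \<open>a\<close>. The multilinear coefficient of \<open>F\<close> is nonzero by the previous lemma, but the sum of the
  images of \<open>F\<close> under the transpositions \<open>(a i)\<close> is constant, so it has to vanish.\<close>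

lemma flat_resonant_const:
  fixes f :: "('v \<Rightarrow> 'a::{field,infinite}) \<Rightarrow> 'a"
  assumes I: "finite I"
    and IH: "\<And>i g. i \<in> I \<Longrightarrow> flat (I - {i}) g \<Longrightarrow> bdeg (I - {i}) B g \<Longrightarrow> \<exists>c. g = (\<lambda>_. c :: 'a)"
    and nz: "\<And>n. 0 < n \<Longrightarrow> n \<le> B \<Longrightarrow> of_nat n \<noteq> (0 :: 'a)"
    and le: "card I \<le> B" and f: "flat I f" and b: "bdeg I (card I) f"
  shows "\<exists>c. f = (\<lambda>_. c)"
proof (cases "card I")
  case 0
  thus ?thesis using bdeg_0_const[OF I, of f] f b by (auto simp: flat_def)
next
  case (Suc m)
  define N where "N = card I"
  have NS: "N = Suc m" using Suc by (simp add: N_def)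
  define C :: "(('v \<Rightarrow> 'a) \<Rightarrow> 'a) set" where "C = {g. flat I g \<and> bdeg I N g}"
  have CD: "flat I g" "bdeg I N g" "PF I g" if "g \<in> C" for g
    using that by (auto simp: C_def flat_def)
  have C_const: "cf i N g = (\<lambda>_. topc N g i)" if "g \<in> C" "i \<in> I" for g i
  proof -
    have "\<exists>c. cf i N g = (\<lambda>_. c)"
      using leading_coeff_flat[OF I CD(1,2)[OF that(1)] that(2)] le
      by (intro IH[OF that(2)]) (auto elim: bdeg_mono simp: N_def)
    thus ?thesis by (auto simp: topc_def)
  qed
  \<comment> \<open>Without leading coefficients the degree falls below the resonant one. Hence a
    member of \<open>C\<close> is determined by \<open>topc N\<close> up to a constant.\<close>
  have C_0: "\<exists>c. g = (\<lambda>_. c)" if "g \<in> C" "\<And>i. i \<in> I \<Longrightarrow> topc N g i = 0" for g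
  proof -
    have "bdeg I m g"
      using CD(2)[OF that(1)] C_const[OF that(1)] that(2) bdeg_Suc_iff[of I m g] NS by simp
    thus ?thesis using flat_small_const[OF I IH nz le CD(1)[OF that(1)], where m = m] Suc by auto
  qed
  have C_sum: "(\<lambda>\<zeta>. \<Sum>x\<in>A. g x \<zeta>) \<in> C" if "\<And>x. x \<in> A \<Longrightarrow> g x \<in> C" for A :: "'v set" and g
    using that flat_sum[OF I, of A g] bdeg_sum[of A I g N] by (auto simp: C_def flat_def)
  have C_diff: "(\<lambda>\<zeta>. g \<zeta> - h \<zeta>) \<in> C" if "g \<in> C" "h \<in> C" for g h
    using that flat_diff[OF I, of g h] bdeg_diff[of I g h N] by (auto simp: C_def flat_def)
  have C_sw: "sw x y g \<in> C" if "g \<in> C" "x \<in> I" "y \<in> I" for x y g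
    using that flat_sw[OF I, of x y g] bdeg_sw[of I g x y N] by (auto simp: C_def flat_def)
  have fC: "f \<in> C" using f b by (simp add: C_def N_def)
  have "topc N f a = 0" if a: "a \<in> I" for a
  proof (rule ccontr)
    assume ta: "topc N f a \<noteq> 0"
    have "of_nat N * topc N f a = of_nat N * topc N f a - (\<Sum>j\<in>I. topc N f j)"
      using topc_flat_eq[OF I f _ _ a, of m] b C_const[OF fC] Suc by (simp add: NS)
    hence s0: "(\<Sum>j\<in>I. topc N f j) = 0" by (simp add: eq_diff_eq)
    \<comment> \<open>If all leading coefficients agreed, their sum would be \<open>N\<close> times
      a nonzero value, but it is zero.\<close>
    obtain b where b: "b \<in> I" "topc N f b \<noteq> topc N f a"
    proof (rule ccontr)
      assume "\<not> thesis"
      hence "\<forall>b\<in>I. topc N f b = topc N f a" using that by blast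
      hence "(\<Sum>j\<in>I. topc N f j) = of_nat N * topc N f a" by (simp add: N_def)
      thus False using s0 ta nz[of N] le NS by (simp add: N_def)
    qed
    have ab: "a \<noteq> b" using b by auto
    define \<gamma> where "\<gamma> = topc N f a - topc N f b"
    have \<gamma>: "\<gamma> \<noteq> 0" using b by (simp add: \<gamma>_def)
    define f' where "f' = (\<lambda>\<zeta>. f \<zeta> - sw a b f \<zeta>)"
    have f'C: "f' \<in> C" unfolding f'_def using fC a b by (intro C_diff C_sw)
    have tf': "topc N f' i = (if i = a then \<gamma> else if i = b then - \<gamma> else 0)" for i
      unfolding f'_def using CD(3)[OF fC] a b PF_sw[of I f a b]
      by (auto simp: topc_diff[of I] topc_sw[of I] \<gamma>_def transpose_def)
    \<comment> \<open>The leading data of \<open>f'\<close> are \<open>\<gamma>\<close> at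
      \<open>a\<close> and \<open>- \<gamma>\<close> at \<open>b\<close>. Moving \<open>b\<close> to
      every place other than \<open>a\<close> and adding up yields data that are invariant under
      permutations fixing \<open>a\<close>.\<close>
    define F where "F = (\<lambda>\<zeta>. \<Sum>p\<in>I - {a}. sw b p f' \<zeta>)"
    have FC: "F \<in> C" unfolding F_def using f'C b by (intro C_sum C_sw) auto
    have tF: "topc N F i = (if i = a then of_nat m * \<gamma> else - \<gamma>)" if i: "i \<in> I" for i
    proof -
      have "topc N F i = (\<Sum>p\<in>I - {a}. topc N f' (transpose b p i))"
        unfolding F_def using CD(3)[OF f'C] b
        by (subst topc_sum[of _ I]) (auto simp: topc_sw[of I] intro: PF_sw)
      also have "\<dots> = (if i = a then of_nat m * \<gamma> else - \<gamma>)"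
      proof (cases "i = a")
        case True
        hence "(\<Sum>p\<in>I - {a}. topc N f' (transpose b p i)) = (\<Sum>p\<in>I - {a}. \<gamma>)"
          using ab by (intro sum.cong) (auto simp: tf' transpose_def)
        thus ?thesis using True a I Suc by simp
      next
        case False
        have "(\<Sum>p\<in>I - {a}. topc N f' (transpose b p i)) = (\<Sum>p\<in>I - {a}. if p = i then - \<gamma> else 0)"
          using ab False by (intro sum.cong) (auto simp: tf' transpose_def)
        thus ?thesis using False i I by (simp add: sum.delta)
      qed
      finally show ?thesis .
    qed
    \<comment> \<open>Equal leading data leave a constant difference, and its value at the origin is
      zero because a swap fixes the origin.\<close>
    have inv: "sw i j F = F" if ij: "i \<in> I - {a}" "j \<in> I - {a}" for i j
    proof -
      have "\<exists>c. (\<lambda>\<zeta>. sw i j F \<zeta> - F \<zeta>) = (\<lambda>_. c)"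
      proof (rule C_0)
        show "(\<lambda>\<zeta>. sw i j F \<zeta> - F \<zeta>) \<in> C" using FC ij by (intro C_diff C_sw) auto
        fix k assume k: "k \<in> I"
        have "transpose i j k \<in> I" using transpose_image[of i I j] ij k by blast
        thus "topc N (\<lambda>\<zeta>. sw i j F \<zeta> - F \<zeta>) k = 0"
          using CD(3)[OF FC] ij k PF_sw[of I F i j]
          by (auto simp: topc_diff[of I] topc_sw[of I] tF) (auto simp: transpose_def split: if_splits)
      qed
      then obtain c where "(\<lambda>\<zeta>. sw i j F \<zeta> - F \<zeta>) = (\<lambda>_. c)" by blast
      hence c: "sw i j F \<zeta> - F \<zeta> = c" for \<zeta> by (rule fun_cong)
      have "F (\<zeta> \<circ> transpose i j) - F \<zeta> = c" for \<zeta> using c[of \<zeta>] by (simp add: sw_def)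
      from this[of "\<lambda>_. 0"] have "c = 0" by (simp add: comp_def)
      thus ?thesis using c by (simp add: fun_eq_iff)
    qed
    have EPD: "der k F = dd k a F" if k: "k \<in> I - {a}" for k
    proof
      fix \<zeta>
      have "der k F \<zeta> = (\<Sum>p\<in>I - {k}. dd k p F \<zeta>)"
        using CD(1)[OF FC] k by (auto simp: flat_def dunkl_def fun_eq_iff)
      also have "\<dots> = (\<Sum>p\<in>I - {k}. if p = a then dd k a F \<zeta> else 0)"
      proof (intro sum.cong refl)
        fix p assume p: "p \<in> I - {k}"
        show "dd k p F \<zeta> = (if p = a then dd k a F \<zeta> else 0)"
        proof (cases "p = a")
          case False
          hence "dd k p F = (\<lambda>_. 0)" using p k inv by (intro dd_swap_inv[of k I p]) auto
          thus ?thesis using False by simp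
        qed auto
      qed
      also have "\<dots> = dd k a F \<zeta>" using a k I by (subst sum.delta) auto
      finally show "der k F \<zeta> = dd k a F \<zeta>" .
    qed
    obtain L where L: "set L = I - {a}" "distinct L" using I finite_distinct_list[of "I - {a}"] by auto
    have lenL: "length L = m" using distinct_card[OF L(2)] L(1) Suc a I by simp
    define ml where "ml = (\<lambda>h :: ('v \<Rightarrow> 'a) \<Rightarrow> 'a. mcoeff (a # L) h (\<lambda>_. 0))"
    have "b \<in> set L" using L b ab by auto
    hence m0: "m > 0" using lenL by (cases L) auto
    have "cf a 1 (mcoeff L F) (\<lambda>_. 0) \<noteq> 0"
    proof (rule epd_chain[OF CD(3)[OF FC] a])
      show "cf a (Suc (length L)) F (\<lambda>_. 0) \<noteq> 0"
        using tF[OF a] \<gamma> nz[of m] m0 le Suc by (auto simp: lenL NS topc_def)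
    qed (use L EPD nz le Suc lenL in auto)
    also have "cf a 1 (mcoeff L F) = mcoeff (L @ [a]) F" by (simp add: mcoeff_snoc)
    also have "\<dots> = mcoeff (a # L) F" by (rule mcoeff_perm[OF CD(3)[OF FC]]) simp
    finally have ml_F: "ml F \<noteq> 0" by (simp add: ml_def)
    \<comment> \<open>The summand \<open>i = a\<close> is \<open>F\<close> itself. The leading data
      cancel at every index, so \<open>G\<close> is constant, while all summands share the same
      nonzero multilinear coefficient.\<close>
    define G where "G = (\<lambda>\<zeta>. \<Sum>i\<in>I. sw a i F \<zeta>)"
    have pfsw: "PF I (sw a i F)" if "i \<in> I" for i using CD(3)[OF FC] a that by (intro PF_sw)
    have "\<exists>c. G = (\<lambda>_. c)"
    proof (rule C_0)
      show "G \<in> C" unfolding G_def using FC a by (intro C_sum C_sw) auto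
      fix k assume k: "k \<in> I"
      have mem: "transpose a i k \<in> I" if "i \<in> I" for i using transpose_image[of a I i] a that k by blast
      have "topc N G k = (\<Sum>i\<in>I. topc N F (transpose a i k))"
        unfolding G_def using CD(3)[OF FC] pfsw by (subst topc_sum[of _ I]) (auto simp: topc_sw[of I])
      also have "\<dots> = (\<Sum>i\<in>I. - \<gamma> + (if i = k then of_nat N * \<gamma> else 0))"
      proof (intro sum.cong refl)
        fix i assume i: "i \<in> I"
        have "transpose a i k = a \<longleftrightarrow> i = k" by (auto simp: transpose_def)
        thus "topc N F (transpose a i k) = - \<gamma> + (if i = k then of_nat N * \<gamma> else 0)"
          using tF[OF mem[OF i]] by (simp add: NS algebra_simps)
      qed
      also have "\<dots> = 0" using k I by (simp add: sum.distrib sum_subtractf sum.delta N_def)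
      finally show "topc N G k = 0" .
    qed
    then obtain c where "G = (\<lambda>_. c)" by blast
    hence "ml G = 0" by (simp add: ml_def mcoeff_const)
    moreover have "ml G = (\<Sum>i\<in>I. ml (sw a i F))"
      unfolding G_def ml_def using pfsw by (subst mcoeff_sum[of _ I]) auto
    moreover have "ml (sw a i F) = ml F" if i: "i \<in> I" for i
    proof -
      have inj: "inj_on (transpose a i) I" by (rule inj_on_inverseI[of _ "transpose a i"]) simp
      have "mset (map (transpose a i) (a # L)) = mset (a # L)"
      proof -
        have sI: "set (a # L) = I" and d: "distinct (a # L)" using L a by auto
        have "distinct (map (transpose a i) (a # L))"
          unfolding distinct_map using d inj sI by metis
        moreover have "set (map (transpose a i) (a # L)) = set (a # L)"
          unfolding set_map sI by (rule transpose_image[OF a i])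
        ultimately show ?thesis using d by (metis set_eq_iff_mset_eq_distinct)
      qed
      hence "mcoeff (map (transpose a i) (a # L)) F = mcoeff (a # L) F"
        by (rule mcoeff_perm[OF CD(3)[OF FC]])
      moreover have "mcoeff (a # L) (sw a i F) = sw a i (mcoeff (map (transpose a i) (a # L)) F)"
        by (rule mcoeff_sw[OF CD(3)[OF FC]])
      ultimately have "mcoeff (a # L) (sw a i F) = sw a i (mcoeff (a # L) F)" by simp
      thus ?thesis unfolding ml_def by (simp add: sw_def comp_def)
    qed
    ultimately have "of_nat N * ml F = 0" by (simp add: N_def)
    thus False using ml_F nz[of N] le NS by (simp add: N_def)
  qed
  thus ?thesis using C_0[OF fC] by blast
qed

text \<open>Leading coefficients live in one variable less, so they are constant by induction on
  \<open>card I\<close>. Then \<open>topc_zero\<close> lowers the degree from \<open>B\<close> to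
  the resonant value \<open>card I\<close>, where \<open>flat_resonant_const\<close> takes
  over.\<close>

theorem flat_const:
  fixes f :: "('v \<Rightarrow> 'a::{field,infinite}) \<Rightarrow> 'a"
  assumes I: "finite I" and nz: "\<And>n. 0 < n \<Longrightarrow> n \<le> B \<Longrightarrow> of_nat n \<noteq> (0 :: 'a)"
    and "card I \<le> B" "flat I f" "bdeg I B f"
  shows "\<exists>c. f = (\<lambda>_. c)"
  using assms(1,3-)
proof (induction "card I" arbitrary: I f)
  case 0
  hence "bdeg I 0 f" by (simp add: bdeg_def)
  thus ?case using bdeg_0_const[of I f] 0 by (auto simp: flat_def)
next
  case (Suc N)
  have IH: "\<exists>c. g = (\<lambda>_. c)" if "i \<in> I" "flat (I - {i}) g" "bdeg (I - {i}) B g"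
    for i and g :: "('v \<Rightarrow> 'a) \<Rightarrow> 'a"
  proof (rule Suc.hyps(1)[OF _ _ _ that(2,3)])
    show "N = card (I - {i})" using Suc.hyps(2) that(1) \<open>finite I\<close> by simp
    show "finite (I - {i})" using \<open>finite I\<close> by simp
    show "card (I - {i}) \<le> B" using card_Diff1_le[of I i] \<open>card I \<le> B\<close> by linarith
  qed
  have "bdeg I (card I) f" if "bdeg I m f" "m \<le> B" for m
    using that
  proof (induction m)
    case (Suc m)
    show ?case
    proof (cases "Suc m \<le> card I")
      case True
      with Suc.prems show ?thesis by (auto elim: bdeg_mono)
    next
      case False
      have "cf i (Suc m) f = (\<lambda>_. topc (Suc m) f i)" if "i \<in> I" for i
      proof -
        have "\<exists>c. cf i (Suc m) f = (\<lambda>_. c)"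
          using leading_coeff_flat[OF \<open>finite I\<close> \<open>flat I f\<close> Suc.prems(1) that] Suc.prems(2)
          by (intro IH[OF that]) (auto elim: bdeg_mono)
        thus ?thesis by (auto simp: topc_def)
      qed
      hence "bdeg I m f"
        using False Suc.prems(2) \<open>card I \<le> B\<close>
        by (intro topc_zero[OF \<open>finite I\<close> \<open>flat I f\<close> Suc.prems(1) _ nz]) auto
      thus ?thesis using Suc by simp
    qed
  qed (auto elim: bdeg_mono)
  from this[OF \<open>bdeg I B f\<close>] have "bdeg I (card I) f" by simp
  show ?case
    by (rule flat_resonant_const[OF \<open>finite I\<close> IH nz \<open>card I \<le> B\<close> \<open>flat I f\<close> \<open>bdeg I (card I) f\<close>])
qed

text \<open>For \<open>p\<close> other than \<open>z\<close> and \<open>w\<close>, the polynomial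
  \<open>dunkl I p f\<close> satisfies the same hypotheses in smaller total degree, by commutativity
  and equivariance, so it vanishes by induction. Then \<open>f\<close> is killed by all operators,
  hence constant, hence zero by antisymmetry.\<close>

theorem dunkl_antisymmetric_zero:
  fixes f :: "('v \<Rightarrow> 'a::{field,infinite}) \<Rightarrow> 'a"
  assumes I: "finite I" and nz: "\<And>n. 0 < n \<Longrightarrow> n \<le> B \<Longrightarrow> of_nat n \<noteq> (0 :: 'a)"
    and B: "card I \<le> B" and zw: "z \<in> I" "w \<in> I" "z \<noteq> w"
    and "polyfun I n f" and "dunkl I z f = (\<lambda>_. 0)" "dunkl I w f = (\<lambda>_. 0)"
    and "sw z w f = (\<lambda>\<zeta>. - f \<zeta>)" and "bdeg I B f"
  shows "f = (\<lambda>_. 0)"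
  using assms(7-)
proof (induction n arbitrary: f)
  \<comment> \<open>Two distinct indices force \<open>B \<ge> 2\<close>, so 2 is among the
    invertible integers.\<close>
  have "card {z, w} \<le> card I" using zw I by (intro card_mono) auto
  hence B2: "B \<ge> 2" using zw B by simp
  hence two: "(2 :: 'a) \<noteq> 0" using nz[of 2] by simp
  have const0: "f = (\<lambda>_. 0)" if "sw z w f = (\<lambda>\<zeta>. - f \<zeta>)" "f = (\<lambda>_. c)" for f and c :: 'a
  proof -
    have "c = - c" using fun_cong[OF that(1), of "\<lambda>_. 0"] by (simp add: that(2))
    hence "2 * c = 0" by (simp only: eq_neg_iff_add_eq_0 mult_2)
    hence "c = 0" using two by simp
    thus ?thesis by (simp only: that(2))
  qed
  {
    case 0
    have "f = (\<lambda>_. f (\<lambda>_. 0))" by (rule ext) (rule polyfun_0[OF 0(1) refl])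
    from const0[OF 0(4) this] show ?case .
  next
    case (Suc n)
    have pf: "PF I f" using Suc.prems(1) by (auto simp: PF_def)
    have "dunkl I p f = (\<lambda>_. 0)" if p: "p \<in> I" for p
    proof (cases "p = z \<or> p = w")
      case False
      hence zp: "z \<noteq> p" "w \<noteq> p" by auto
      show ?thesis
      proof (rule Suc.IH)
        show "polyfun I n (dunkl I p f)" using polyfun_dunkl[OF I p Suc.prems(1)] by simp
        show "dunkl I z (dunkl I p f) = (\<lambda>_. 0)"
          using dunkl_commute[OF I zw(1) p zp(1) pf] dunkl_const[OF I p, of 0] Suc.prems(2) by simp
        show "dunkl I w (dunkl I p f) = (\<lambda>_. 0)"
          using dunkl_commute[OF I zw(2) p zp(2) pf] dunkl_const[OF I p, of 0] Suc.prems(3) by simp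
        show "sw z w (dunkl I p f) = (\<lambda>\<zeta>. - dunkl I p f \<zeta>)"
          using sw_dunkl[OF I zw(1,2) p pf] False Suc.prems(4) dunkl_minus[OF I p pf] by simp
        show "bdeg I B (dunkl I p f)" by (rule bdeg_dunkl[OF I p pf Suc.prems(5)])
      qed
    next
      case True
      thus ?thesis using Suc.prems(2,3) by blast
    qed
    hence "flat I f" using pf by (simp add: flat_def)
    from flat_const[OF I nz B this Suc.prems(5)] obtain c where "f = (\<lambda>_. c)" by blast
    from const0[OF Suc.prems(4) this] show ?case .
  }
qed

section \<open>Interpolation\<close>

lemma lagrange_value:
  fixes P :: "'a::field poly"
  assumes K: "finite K" and inj: "inj_on a K" and deg: "degree P < card K"
  shows "poly P w = (\<Sum>k\<in>K. poly P (a k) * (\<Prod>l\<in>K - {k}. (w - a l) / (a k - a l)))"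
proof -
  define Q where "Q = (\<Sum>k\<in>K. smult (poly P (a k)) (\<Prod>l\<in>K - {k}. smult (inverse (a k - a l)) [:- a l, 1:]))"
  have val: "poly Q t = (\<Sum>k\<in>K. poly P (a k) * (\<Prod>l\<in>K - {k}. (t - a l) / (a k - a l)))" for t
  proof -
    have "poly (smult (inverse c) [:- b, 1:]) t = (t - b) / c" for b c :: 'a
    proof -
      have "poly [:- b, 1:] t = t - b" by simp
      thus ?thesis by (simp only: poly_smult divide_inverse mult.commute)
    qed
    thus ?thesis by (simp only: Q_def poly_sum poly_smult poly_prod)
  qed
  have "poly Q (a i) = poly P (a i)" if i: "i \<in> K" for i
  proof -
    have "(\<Prod>l\<in>K - {k}. (a i - a l) / (a k - a l)) = (if k = i then 1 else 0)" if "k \<in> K" for k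
    proof (cases "k = i")
      case True
      have "a i - a l \<noteq> 0" if "l \<in> K - {i}" for l using inj i that by (auto simp: inj_on_def)
      thus ?thesis using True by (simp add: prod.neutral)
    next
      case False
      hence "i \<in> K - {k}" using i by simp
      thus ?thesis using False K by (auto intro!: prod_zero)
    qed
    hence "poly Q (a i) = (\<Sum>k\<in>K. poly P (a k) * (if k = i then 1 else 0))"
      unfolding val by (intro sum.cong) auto
    also have "\<dots> = (\<Sum>k\<in>K. if k = i then poly P (a k) else 0)" by (intro sum.cong) auto
    finally show ?thesis using i K by (simp add: sum.delta)
  qed
  moreover have "degree Q < card K"
  proof -
    have "degree Q \<le> card K - 1"
      unfolding Q_def
    proof (rule degree_sum_le[OF K])
      fix k assume k: "k \<in> K"
      let ?e = "\<lambda>l. smult (inverse (a k - a l)) [:- a l, 1:]"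
      have "degree (prod ?e (K - {k})) \<le> sum (degree \<circ> ?e) (K - {k})"
        using K by (intro degree_prod_sum_le) auto
      also have "\<dots> \<le> (\<Sum>l\<in>K - {k}. 1)"
        unfolding comp_def by (intro sum_mono order.trans[OF degree_smult_le]) simp
      also have "\<dots> = card K - 1" using k K by simp
      finally show "degree (smult (poly P (a k)) (\<Prod>l\<in>K - {k}. smult (inverse (a k - a l)) [:- a l, 1:])) \<le> card K - 1"
        using degree_smult_le le_trans by blast
    qed
    thus ?thesis using deg by linarith
  qed
  ultimately have "P = Q"
    using deg by (intro poly_eqI_degree[of "a ` K"]) (auto simp: card_image[OF inj])
  hence "poly P w = poly Q w" by (rule arg_cong)
  also note val
  finally show ?thesis .
qed

text \<open>Degree \<open>card K\<close> is allowed, one more than for interpolation, because only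
  the difference quotient is interpolated. The term \<open>poly P w\<close> appears without Lagrange
  weight; this makes each summand a divided difference once a Vandermonde factor is
  attached.\<close>

lemma lagrange_derivative:
  fixes P :: "'a::field poly"
  assumes K: "finite K" and inj: "inj_on a K" and deg: "degree P \<le> card K"
    and w: "w \<notin> a ` K"
  shows "poly (pderiv P) w =
    (\<Sum>k\<in>K. (poly P w - poly P (a k) * (\<Prod>l\<in>K - {k}. (w - a l) / (a k - a l))) / (w - a k))"
proof -
  have main: "poly (pderiv P) w = (\<Sum>k\<in>K. (poly P w - poly P (a k)) * L k / (w - a k))"
    if deg: "degree P \<le> card K" and L: "L = (\<lambda>k. \<Prod>l\<in>K - {k}. (w - a l) / (a k - a l))"
    for P :: "'a poly" and L
  proof -
    \<comment> \<open>The difference quotient at \<open>w\<close>: its degree is one smaller and its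
      value at \<open>w\<close> is the derivative of \<open>P\<close>.\<close>
    define g where "g = (P - [:poly P w:]) div [:- w, 1:]"
    have "[:- w, 1:] dvd P - [:poly P w:]" by (rule iffD1[OF poly_eq_0_iff_dvd]) simp
    hence g: "P - [:poly P w:] = [:- w, 1:] * g" by (simp only: g_def dvd_mult_div_cancel)
    have Pg: "P = [:- w, 1:] * g + [:poly P w:]"
      using diff_add_cancel[of P "[:poly P w:]"] unfolding g by (rule sym)
    have "pderiv P = pderiv ([:- w, 1:] * g + [:poly P w:])" using Pg by (rule arg_cong)
    hence der: "poly (pderiv P) w = poly g w"
      by (simp add: pderiv_add pderiv_mult pderiv_pCons del: mult_pCons_left)
    show ?thesis
    proof (cases "g = 0")
      case True
      hence "P - [:poly P w:] = 0" using g by simp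
      hence c: "P = [:poly P w:]" by (simp only: right_minus_eq)
      have "poly P w - poly P t = 0" for t
      proof -
        have "poly P t = poly P w" by (subst c) simp
        thus ?thesis by (simp only: right_minus_eq)
      qed
      hence "(\<Sum>k\<in>K. (poly P w - poly P (a k)) * L k / (w - a k)) = 0" by (simp only: mult_zero_left div_0 sum.neutral_const)
      thus ?thesis using der True by simp
    next
      case False
      have "degree ([:- w, 1:] * g) = 1 + degree g" using False by (subst degree_mult_eq) auto
      moreover have "degree (P - [:poly P w:]) \<le> card K"
        using degree_diff_le[of P "card K" "[:poly P w:]"] deg by simp
      ultimately have "degree g < card K" using g by simp
      hence "poly g w = (\<Sum>k\<in>K. poly g (a k) * L k)" using lagrange_value[OF K inj] L by simp
      also have "\<dots> = (\<Sum>k\<in>K. (poly P w - poly P (a k)) * L k / (w - a k))"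
      proof (intro sum.cong refl)
        fix k assume "k \<in> K"
        hence ne: "w - a k \<noteq> 0" using w by auto
        have "poly P (a k) - poly P w = (a k - w) * poly g (a k)"
          using arg_cong[OF g, of "\<lambda>p. poly p (a k)"] by (simp del: mult_pCons_left)
        hence "poly P w - poly P (a k) = (w - a k) * poly g (a k)" by (simp add: algebra_simps)
        thus "poly g (a k) * L k = (poly P w - poly P (a k)) * L k / (w - a k)" using ne by simp
      qed
      finally show ?thesis using der by simp
    qed
  qed
  define L where "L = (\<lambda>k. \<Prod>l\<in>K - {k}. (w - a l) / (a k - a l))"
  define M where "M = (\<Prod>k\<in>K. [:- a k, 1:])"
  have Mt: "poly M t = (\<Prod>k\<in>K. t - a k)" for t by (simp add: M_def poly_prod)
  have "degree M = card K" unfolding M_def by (subst degree_prod_eq_sum_degree) auto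
  hence "poly (pderiv M) w = (\<Sum>k\<in>K. (poly M w - poly M (a k)) * L k / (w - a k))"
    by (intro main L_def) simp
  also have "\<dots> = (\<Sum>k\<in>K. poly M w * (L k / (w - a k)))"
  proof (intro sum.cong refl)
    fix k assume "k \<in> K"
    hence "poly M (a k) = 0" using K by (auto simp: Mt intro!: prod_zero)
    thus "(poly M w - poly M (a k)) * L k / (w - a k) = poly M w * (L k / (w - a k))" by simp
  qed
  finally have 1: "poly (pderiv M) w = poly M w * (\<Sum>k\<in>K. L k / (w - a k))"
    by (simp only: sum_distrib_left)
  have "poly (pderiv M) w = (\<Sum>k\<in>K. \<Prod>l\<in>K - {k}. (w - a l))"
    unfolding M_def pderiv_prod poly_sum poly_mult poly_prod
    by (intro sum.cong refl) (simp add: pderiv_pCons)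
  also have "\<dots> = (\<Sum>k\<in>K. poly M w * (1 / (w - a k)))"
  proof (intro sum.cong refl)
    fix k assume k: "k \<in> K"
    hence "poly M w = (w - a k) * (\<Prod>l\<in>K - {k}. (w - a l))"
      unfolding Mt using K by (rule_tac prod.remove)
    moreover have "w - a k \<noteq> 0" using w k by auto
    ultimately show "(\<Prod>l\<in>K - {k}. (w - a l)) = poly M w * (1 / (w - a k))" by simp
  qed
  finally have 2: "poly (pderiv M) w = poly M w * (\<Sum>k\<in>K. 1 / (w - a k))"
    by (simp only: sum_distrib_left)
  have "poly M w \<noteq> 0" using w K by (auto simp: Mt)
  hence eq: "(\<Sum>k\<in>K. L k / (w - a k)) = (\<Sum>k\<in>K. 1 / (w - a k))"
    using trans[OF 1[symmetric] 2] by (simp only: mult_left_cancel simp_thms)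
  have "poly (pderiv P) w = (\<Sum>k\<in>K. poly P w * (L k / (w - a k)) - poly P (a k) * L k / (w - a k))"
    unfolding main[OF deg L_def] by (intro sum.cong refl) (simp add: left_diff_distrib diff_divide_distrib)
  also have "\<dots> = poly P w * (\<Sum>k\<in>K. L k / (w - a k)) - (\<Sum>k\<in>K. poly P (a k) * L k / (w - a k))"
    by (simp only: sum_subtractf sum_distrib_left)
  also have "\<dots> = (\<Sum>k\<in>K. poly P w * (1 / (w - a k)) - poly P (a k) * L k / (w - a k))"
    unfolding eq by (simp only: sum_subtractf sum_distrib_left)
  also have "\<dots> = (\<Sum>k\<in>K. (poly P w - poly P (a k) * L k) / (w - a k))"
    by (intro sum.cong refl) (simp add: diff_divide_distrib)
  finally show ?thesis by (simp only: L_def)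
qed

section \<open>Vandermonde determinants\<close>

definition vdm :: "nat set \<Rightarrow> (nat \<Rightarrow> 'a::comm_ring_1) \<Rightarrow> 'a"
  where "vdm K a = (\<Prod>(i, j)\<in>{(i, j). i \<in> K \<and> j \<in> K \<and> i < j}. a i - a j)"

lemma vdm_remove:
  assumes K: "finite K" and k: "k \<in> K"
  shows "vdm K a = vdm (K - {k}) a * (\<Prod>l\<in>K - {k}. (if k < l then 1 else -1) * (a k - a l))"
proof -
  let ?f = "\<lambda>(i, j). a i - a j" and ?g = "\<lambda>l. if k < l then (k, l) else (l, k)"
  let ?R = "\<lambda>K. {(i, j). i \<in> K \<and> j \<in> K \<and> i < j}"
  have fin: "finite (?R K)" if "finite K" for K :: "nat set"
    by (rule finite_subset[of _ "K \<times> K"]) (use that in auto)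
  have "?R K = ?R (K - {k}) \<union> ?g ` (K - {k})" using k by (auto simp: image_iff)
  hence "vdm K a = prod ?f (?R (K - {k}) \<union> ?g ` (K - {k}))" by (simp add: vdm_def)
  also have "\<dots> = prod ?f (?R (K - {k})) * prod ?f (?g ` (K - {k}))"
    using K fin[of "K - {k}"] by (intro prod.union_disjoint) auto
  also have "prod ?f (?g ` (K - {k})) = prod (?f \<circ> ?g) (K - {k})"
    by (rule prod.reindex) (auto simp: inj_on_def split: if_splits)
  also have "\<dots> = (\<Prod>l\<in>K - {k}. (if k < l then 1 else -1) * (a k - a l))"
    by (intro prod.cong) auto
  finally show ?thesis by (simp add: vdm_def)
qed

lemma vdm_cong: "(\<And>k. k \<in> K \<Longrightarrow> a k = b k) \<Longrightarrow> vdm K a = vdm K b"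
  unfolding vdm_def by (intro prod.cong) auto

text \<open>Moving one node to \<open>w\<close> multiplies the determinant by precisely the Lagrange
  weight of that node.\<close>

lemma vdm_upd:
  fixes a :: "nat \<Rightarrow> 'a::field"
  assumes K: "finite K" and k: "k \<in> K" and inj: "inj_on a K"
  shows "vdm K (a(k := w)) = vdm K a * (\<Prod>l\<in>K - {k}. (w - a l) / (a k - a l))"
proof -
  let ?e = "\<lambda>l. if k < l then 1 else -1 :: 'a"
  have "vdm (K - {k}) (a(k := w)) = vdm (K - {k}) a" by (rule vdm_cong) auto
  moreover have "(\<Prod>l\<in>K - {k}. ?e l * ((a(k := w)) k - (a(k := w)) l)) =
      (\<Prod>l\<in>K - {k}. ?e l * (a k - a l)) * (\<Prod>l\<in>K - {k}. (w - a l) / (a k - a l))"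
    unfolding prod.distrib[symmetric] using inj k
    by (intro prod.cong) (auto simp: inj_on_def)
  ultimately show ?thesis
    unfolding vdm_remove[OF K k] by (simp only: mult.assoc)
qed

lemma vdm_nonzero:
  fixes a :: "nat \<Rightarrow> 'a::field"
  assumes "finite K" "inj_on a K"
  shows "vdm K a \<noteq> 0"
proof -
  have "finite {(i, j). i \<in> K \<and> j \<in> K \<and> i < j}"
    by (rule finite_subset[of _ "K \<times> K"]) (use assms in auto)
  thus ?thesis using assms(2) by (auto simp: vdm_def inj_on_def)
qed

section \<open>More on polynomial functions\<close>

definition vd :: "'v \<Rightarrow> nat \<Rightarrow> (('v \<Rightarrow> 'a::{idom,infinite}) \<Rightarrow> 'a) \<Rightarrow> bool"
  where "vd k M f \<longleftrightarrow> (\<forall>\<zeta>. degree (uni k f \<zeta>) \<le> M)"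

lemma bdeg_iff_vd: "bdeg I M f \<longleftrightarrow> (\<forall>k\<in>I. vd k M f)"
proof -
  have "(\<forall>m>M. cf k m f = (\<lambda>_. 0)) \<longleftrightarrow> vd k M f" for k
  proof
    assume *: "\<forall>m>M. cf k m f = (\<lambda>_. 0)"
    show "vd k M f" unfolding vd_def
    proof (intro allI degree_le impI)
      fix \<zeta> m assume "M < m"
      with * show "coeff (uni k f \<zeta>) m = 0" by (auto simp: cf_def fun_eq_iff)
    qed
  next
    assume "vd k M f"
    thus "\<forall>m>M. cf k m f = (\<lambda>_. 0)"
      by (auto simp: vd_def cf_def fun_eq_iff intro: coeff_eq_0 le_less_trans)
  qed
  thus ?thesis by (simp add: bdeg_def)
qed

lemma vd_mono: "vd k M f \<Longrightarrow> M \<le> N \<Longrightarrow> vd k N f"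
  by (auto simp: vd_def intro: order.trans)

lemma vd_mult: "PF I f \<Longrightarrow> PF I g \<Longrightarrow> vd k M f \<Longrightarrow> vd k N g \<Longrightarrow> vd k (M + N) (\<lambda>\<zeta>. f \<zeta> * g \<zeta>)"
  by (auto simp: vd_def uni_mult[of I] intro!: order.trans[OF degree_mult_le] add_mono)

lemma vd_add: "PF I f \<Longrightarrow> PF I g \<Longrightarrow> vd k M f \<Longrightarrow> vd k M g \<Longrightarrow> vd k M (\<lambda>\<zeta>. f \<zeta> + g \<zeta>)"
  by (auto simp: vd_def uni_add[of I] intro!: degree_add_le)

lemma vd_sum: "(\<And>a. a \<in> A \<Longrightarrow> PF I (f a)) \<Longrightarrow> (\<And>a. a \<in> A \<Longrightarrow> vd k M (f a)) \<Longrightarrow>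
    vd k M (\<lambda>\<zeta>. \<Sum>a\<in>A. f a \<zeta>)"
  by (induction A rule: infinite_finite_induct)
    (auto intro!: vd_add[of I] PF_sum, auto simp: vd_def)

lemma vd_notin: "PF I f \<Longrightarrow> k \<notin> I \<Longrightarrow> vd k 0 f"
  by (simp add: vd_def uni_notin[of I])

lemma vd_var: "vd k (if j = k then 1 else 0) (\<lambda>\<zeta>. \<zeta> j :: 'a::{idom,infinite})"
  by (auto simp: vd_def uni_var)

lemma der_notin: "PF I f \<Longrightarrow> i \<notin> I \<Longrightarrow> der i f = (\<lambda>_. 0)"
  by (simp add: der_def uni_notin[of I] fun_eq_iff)

text \<open>Chain rule for a renaming that may identify variables: the summands are the variables
  merged into \<open>i\<close>.\<close>

lemma der_comp:
  fixes f :: "('v \<Rightarrow> 'a::{idom,infinite}) \<Rightarrow> 'a" and \<sigma> :: "'v \<Rightarrow> 'w"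
  assumes I: "finite I" and f: "PF I f"
  shows "der i (\<lambda>\<zeta>. f (\<lambda>v. \<zeta> (\<sigma> v))) \<zeta> = (\<Sum>j\<in>{j \<in> I. \<sigma> j = i}. der j f (\<lambda>v. \<zeta> (\<sigma> v)))"
  using f
proof (induction rule: PF_induct)
  case (var k)
  have "(\<Sum>j\<in>{j \<in> I. \<sigma> j = i}. if j = k then 1 else 0 :: 'a) = (if \<sigma> k = i then 1 else 0)"
    using I var by (subst sum.delta) auto
  thus ?case by (auto simp: der_var)
next
  case (add f g)
  have pf: "PF (\<sigma> ` I) (\<lambda>\<zeta>. f (\<lambda>v. \<zeta> (\<sigma> v)))" "PF (\<sigma> ` I) (\<lambda>\<zeta>. g (\<lambda>v. \<zeta> (\<sigma> v)))"
    using add(1,2) by (auto intro: PF_comp)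
  show ?case unfolding der_add[OF pf] der_add[OF add(1,2)] sum.distrib add(3,4) ..
next
  case (mult f g)
  have pf: "PF (\<sigma> ` I) (\<lambda>\<zeta>. f (\<lambda>v. \<zeta> (\<sigma> v)))" "PF (\<sigma> ` I) (\<lambda>\<zeta>. g (\<lambda>v. \<zeta> (\<sigma> v)))"
    using mult(1,2) by (auto intro: PF_comp)
  show ?case
    unfolding der_mult[OF pf] der_mult[OF mult(1,2)] sum.distrib mult(3,4)
      sum_distrib_left sum_distrib_right ..
qed simp

lemma PF_merge: "PF I f \<Longrightarrow> j \<in> I \<Longrightarrow> PF I (\<lambda>\<zeta>. f (\<zeta>(i := \<zeta> j)))"
proof -
  assume "PF I f" "j \<in> I"
  hence "PF I (\<lambda>\<zeta>. f (\<lambda>v. \<zeta> (if v = i then j else v)))"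
    by (intro PF_comp[of I f "\<lambda>v. if v = i then j else v" I]) auto
  moreover have "(\<lambda>\<zeta>. f (\<lambda>v. \<zeta> (if v = i then j else v))) = (\<lambda>\<zeta>. f (\<zeta>(i := \<zeta> j)))"
    by (intro ext arg_cong[of _ _ f]) auto
  ultimately show ?thesis by (simp only:)
qed

lemma vd_merge:
  fixes f :: "('v \<Rightarrow> 'a::{field,infinite}) \<Rightarrow> 'a"
  assumes f: "PF I f" and ij: "i \<in> I" "j \<in> I" "i \<noteq> j" and vd: "vd j M f" "vd i N f"
  shows "vd j (M + N) (\<lambda>\<zeta>. f (\<zeta>(i := \<zeta> j)))"
proof -
  have pf: "PF I (cf i m f)" for m using PF_mono[OF PF_cf[OF f]] by auto
  have "f (\<zeta>(i := \<zeta> j)) = (\<Sum>m\<le>N. cf i m f \<zeta> * \<zeta> j ^ m)" for \<zeta>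
  proof -
    have "f (\<zeta>(i := \<zeta> j)) = poly (uni i f \<zeta>) (\<zeta> j)" by (simp add: poly_uni[OF f])
    also have "\<dots> = (\<Sum>m\<le>N. coeff (uni i f \<zeta>) m * \<zeta> j ^ m)"
      using vd(2) unfolding poly_altdef
      by (intro sum.mono_neutral_left) (auto simp: vd_def intro: coeff_eq_0 order.trans)
    finally show ?thesis by (simp add: cf_def)
  qed
  moreover have "vd j (M + N) (\<lambda>\<zeta>. \<Sum>m\<le>N. cf i m f \<zeta> * \<zeta> j ^ m)"
  proof (rule vd_sum[of _ I])
    fix m assume m: "m \<in> {..N}"
    show "PF I (\<lambda>\<zeta>. cf i m f \<zeta> * \<zeta> j ^ m)" using pf ij by (intro PF_mult PF_power PF_var)
    have "cf j r (cf i m f) = (\<lambda>_. 0)" if "r > M" for r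
    proof -
      have "cf j r f = (\<lambda>_. 0)" using vd(1) that
        by (auto simp: vd_def cf_def fun_eq_iff intro: coeff_eq_0 le_less_trans)
      thus ?thesis using cf_commute[OF f, of j i r m] ij by (simp add: cf_const)
    qed
    hence "vd j M (cf i m f)"
      by (auto simp: vd_def cf_def fun_eq_iff intro!: degree_le)
    moreover have "vd j m (\<lambda>\<zeta>. \<zeta> j ^ m :: 'a)"
    proof (induction m)
      case (Suc m)
      have "vd j (Suc 0 + m) (\<lambda>\<zeta>. \<zeta> j * \<zeta> j ^ m :: 'a)"
        using vd_var[of j j] Suc by (intro vd_mult[of "{j}"] PF_var PF_power) auto
      thus ?case by simp
    qed (simp add: vd_def)
    ultimately have "vd j (M + m) (\<lambda>\<zeta>. cf i m f \<zeta> * \<zeta> j ^ m)"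
      using pf ij by (intro vd_mult[of I] PF_power PF_var)
    thus "vd j (M + N) (\<lambda>\<zeta>. cf i m f \<zeta> * \<zeta> j ^ m)" using m by (auto elim: vd_mono)
  qed
  ultimately show ?thesis by (simp only:)
qed

lemma vd_merge_other:
  assumes "PF I f" "k \<noteq> i" "k \<noteq> j" "vd k M f"
  shows "vd k M (\<lambda>\<zeta>. f (\<zeta>(i := \<zeta> j)))"
proof -
  have "uni k (\<lambda>\<zeta>. f (\<zeta>(i := \<zeta> j))) \<zeta> = uni k f (\<zeta>(i := \<zeta> j))" for \<zeta>
  proof (rule uni_eqI)
    fix t show "poly (uni k f (\<zeta>(i := \<zeta> j))) t = f ((\<zeta>(k := t))(i := (\<zeta>(k := t)) j))"
      using assms by (simp add: poly_uni[OF assms(1)] fun_upd_twist)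
  qed
  thus ?thesis using assms(4) by (simp add: vd_def)
qed

text \<open>The induction runs over the divisibility of
  \<open>f \<zeta> - f (\<zeta>(i := \<zeta> j))\<close>, since vanishing on the diagonal is not
  inherited by the parts of \<open>f\<close>.\<close>

lemma PF_factor_diff:
  fixes f :: "('v \<Rightarrow> 'a::{field,infinite}) \<Rightarrow> 'a"
  assumes ij: "i \<in> I" "j \<in> I" and f: "PF I f" and z: "\<And>\<zeta>. \<zeta> i = \<zeta> j \<Longrightarrow> f \<zeta> = 0"
  shows "\<exists>g. PF I g \<and> (\<forall>\<zeta>. f \<zeta> = (\<zeta> i - \<zeta> j) * g \<zeta>)"
proof -
  have "\<exists>g. PF I g \<and> (\<forall>\<zeta>. f \<zeta> - f (\<zeta>(i := \<zeta> j)) = (\<zeta> i - \<zeta> j) * g \<zeta>)"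
    using f
  proof (induction rule: PF_induct)
    case (const c)
    show ?case by (rule exI[of _ "\<lambda>_. 0"]) simp
  next
    case (var k)
    show ?case by (rule exI[of _ "\<lambda>_. if k = i then 1 else 0"]) simp
  next
    case (add f g)
    then obtain f' g' where "PF I f'" "PF I g'"
      "\<forall>\<zeta>. f \<zeta> - f (\<zeta>(i := \<zeta> j)) = (\<zeta> i - \<zeta> j) * f' \<zeta>"
      "\<forall>\<zeta>. g \<zeta> - g (\<zeta>(i := \<zeta> j)) = (\<zeta> i - \<zeta> j) * g' \<zeta>" by blast
    hence "PF I (\<lambda>\<zeta>. f' \<zeta> + g' \<zeta>) \<and> (\<forall>\<zeta>. (f \<zeta> + g \<zeta>) - (f (\<zeta>(i := \<zeta> j)) + g (\<zeta>(i := \<zeta> j))) =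
        (\<zeta> i - \<zeta> j) * (f' \<zeta> + g' \<zeta>))" by (auto simp: distrib_left add_diff_add)
    thus ?case by blast
  next
    case (mult f g)
    then obtain f' g' where *: "PF I f'" "PF I g'"
      "\<And>\<zeta>. f \<zeta> - f (\<zeta>(i := \<zeta> j)) = (\<zeta> i - \<zeta> j) * f' \<zeta>"
      "\<And>\<zeta>. g \<zeta> - g (\<zeta>(i := \<zeta> j)) = (\<zeta> i - \<zeta> j) * g' \<zeta>" by blast
    have "PF I (\<lambda>\<zeta>. f' \<zeta> * g \<zeta> + f (\<zeta>(i := \<zeta> j)) * g' \<zeta>)"
      using * mult ij by (intro PF_add PF_mult PF_merge)
    moreover have "f \<zeta> * g \<zeta> - f (\<zeta>(i := \<zeta> j)) * g (\<zeta>(i := \<zeta> j)) =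
        (\<zeta> i - \<zeta> j) * (f' \<zeta> * g \<zeta> + f (\<zeta>(i := \<zeta> j)) * g' \<zeta>)" for \<zeta>
    proof -
      have "f \<zeta> * g \<zeta> - f (\<zeta>(i := \<zeta> j)) * g (\<zeta>(i := \<zeta> j)) =
        (f \<zeta> - f (\<zeta>(i := \<zeta> j))) * g \<zeta> + f (\<zeta>(i := \<zeta> j)) * (g \<zeta> - g (\<zeta>(i := \<zeta> j)))"
        by (simp add: algebra_simps)
      thus ?thesis unfolding * by (simp add: algebra_simps)
    qed
    ultimately show ?case by blast
  qed
  moreover have "f (\<zeta>(i := \<zeta> j)) = 0" for \<zeta> by (rule z) simp
  ultimately show ?thesis by simp
qed

section \<open>Functions vanishing doubly on the diagonal\<close>

lemma inj_on_Inl: "inj_on \<zeta> T \<Longrightarrow> (\<And>k. k \<in> K \<Longrightarrow> Inl k \<in> T) \<Longrightarrow> inj_on (\<lambda>k. \<zeta> (Inl k)) K"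
  and inj_on_Inr: "inj_on \<zeta> T \<Longrightarrow> (\<And>k. k \<in> K' \<Longrightarrow> Inr k \<in> T) \<Longrightarrow> inj_on (\<lambda>k. \<zeta> (Inr k)) K'"
  by (auto intro!: inj_onI dest: inj_onD)

text \<open>\<open>Inl k\<close> stands for \<open>x_k\<close>, a point on the curve of degree
  \<open>u\<close>, and \<open>Inr k\<close> for \<open>y_k\<close>, a point on the curve of degree
  \<open>v\<close>; hence the crossed bounds, with \<open>v + 1\<close> variables of degree
  \<open>u\<close> and \<open>u + 1\<close> of degree \<open>v\<close>.\<close>

locale double_vanishing =
  fixes u v :: nat and H G :: "(nat + nat \<Rightarrow> 'a::{field,infinite}) \<Rightarrow> 'a" and A
  defines "A \<equiv> Inl ` {..v} \<union> Inr ` {..u}"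
  assumes uv: "u \<ge> 1" "v \<ge> 1"
    and nz: "\<And>n. 0 < n \<Longrightarrow> n \<le> u + v \<Longrightarrow> of_nat n \<noteq> (0 :: 'a)"
    and PFH: "PF A H" and PFG: "PF A G"
    and symHx: "\<And>i j. i \<in> {1..v} \<Longrightarrow> j \<in> {1..v} \<Longrightarrow> sw (Inl i) (Inl j) H = H"
    and symHy: "\<And>i j. i \<in> {..u} \<Longrightarrow> j \<in> {..u} \<Longrightarrow> sw (Inr i) (Inr j) H = H"
    and symGx: "\<And>i j. i \<in> {..v} \<Longrightarrow> j \<in> {..v} \<Longrightarrow> sw (Inl i) (Inl j) G = G"
    and symGy: "\<And>i j. i \<in> {1..u} \<Longrightarrow> j \<in> {1..u} \<Longrightarrow> sw (Inr i) (Inr j) G = G"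
    and vdx: "\<And>k. k \<le> v \<Longrightarrow> vd (Inl k) u (\<lambda>\<zeta>. H \<zeta> + G \<zeta>)"
    and vdy: "\<And>k. k \<le> u \<Longrightarrow> vd (Inr k) v (\<lambda>\<zeta>. H \<zeta> + G \<zeta>)"
    and van0: "\<And>\<zeta>. \<zeta> (Inl 0) = \<zeta> (Inr 0) \<Longrightarrow> H \<zeta> + G \<zeta> = 0"
    and van1: "\<And>\<zeta>. \<zeta> (Inl 0) = \<zeta> (Inr 0) \<Longrightarrow> der (Inl 0) (\<lambda>\<zeta>. H \<zeta> + G \<zeta>) \<zeta> = 0"
begin

section \<open>The double quotient \<open>q\<close> and the four term relation\<close>

definition h where "h \<zeta> = H \<zeta> + G \<zeta>"

lemma finA: "finite A" by (simp add: A_def)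

lemma memA [simp]: "Inl k \<in> A \<longleftrightarrow> k \<le> v" "Inr k \<in> A \<longleftrightarrow> k \<le> u"
  by (auto simp: A_def)

lemma PFh: "PF A h"
  unfolding h_def[abs_def] using PFH PFG by (rule PF_add)

text \<open>Two divisions by \<open>x_0 - y_0\<close>. On the diagonal the derivative in
  \<open>x_0\<close> of the product is the first quotient itself, so \<open>van1\<close> permits the
  second division.\<close>

lemma q_exists: "\<exists>q. PF A q \<and> (\<forall>\<zeta>. h \<zeta> = (\<zeta> (Inl 0) - \<zeta> (Inr 0)) ^ 2 * q \<zeta>)"
proof -
  have mem: "Inl 0 \<in> A" "Inr 0 \<in> A" by simp_all
  obtain g where g: "PF A g" "\<And>\<zeta>. h \<zeta> = (\<zeta> (Inl 0) - \<zeta> (Inr 0)) * g \<zeta>"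
    using PF_factor_diff[OF mem PFh] van0 by (auto simp: h_def)
  have "der (Inl 0) h \<zeta> = (\<zeta> (Inl 0) - \<zeta> (Inr 0)) * der (Inl 0) g \<zeta> + g \<zeta>" for \<zeta>
  proof -
    have "h = (\<lambda>\<zeta>. (\<zeta> (Inl 0) - \<zeta> (Inr 0)) * g \<zeta>)" using g(2) by auto
    thus ?thesis using g(1) mem
      by (simp add: der_mult[of A] der_diff[of A] der_var PF_diff PF_var)
  qed
  hence "g \<zeta> = 0" if "\<zeta> (Inl 0) = \<zeta> (Inr 0)" for \<zeta>
    using van1[OF that] that by (simp add: h_def[abs_def])
  then obtain q where "PF A q" "\<And>\<zeta>. g \<zeta> = (\<zeta> (Inl 0) - \<zeta> (Inr 0)) * q \<zeta>"
    using PF_factor_diff[OF mem g(1)] by auto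
  thus ?thesis using g by (auto simp: power2_eq_square mult.assoc)
qed

definition q where "q = (SOME q. PF A q \<and> (\<forall>\<zeta>. h \<zeta> = (\<zeta> (Inl 0) - \<zeta> (Inr 0)) ^ 2 * q \<zeta>))"

lemma PFq: "PF A q" and hq: "h \<zeta> = (\<zeta> (Inl 0) - \<zeta> (Inr 0)) ^ 2 * q \<zeta>"
proof -
  have "PF A q \<and> (\<forall>\<zeta>. h \<zeta> = (\<zeta> (Inl 0) - \<zeta> (Inr 0)) ^ 2 * q \<zeta>)"
    unfolding q_def by (rule someI_ex[OF q_exists])
  thus "PF A q" "h \<zeta> = (\<zeta> (Inl 0) - \<zeta> (Inr 0)) ^ 2 * q \<zeta>" by (blast, blast)
qed

lemma q_sw:
  assumes "a \<in> A" "b \<in> A" "a \<notin> {Inl 0, Inr 0}" "b \<notin> {Inl 0, Inr 0}"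
    and "sw a b H = H" "sw a b G = G"
  shows "q (\<zeta> \<circ> transpose a b) = q \<zeta>"
proof -
  have "sw a b q = q"
  proof (rule PF_eqI_diff[of "Inl 0" "Inr 0" A])
    fix \<zeta> :: "nat + nat \<Rightarrow> 'a" assume ne: "\<zeta> (Inl 0) \<noteq> \<zeta> (Inr 0)"
    have "h (\<zeta> \<circ> transpose a b) = h \<zeta>"
      using fun_cong[OF assms(5), of \<zeta>] fun_cong[OF assms(6), of \<zeta>] by (simp add: h_def sw_def)
    thus "sw a b q \<zeta> = q \<zeta>" using ne assms(3,4) by (auto simp: hq sw_def transpose_def)
  qed (use PFq assms in \<open>auto intro: PF_sw\<close>)
  thus ?thesis by (simp add: sw_def fun_eq_iff)
qed

lemma q_swx: "i \<in> {1..v} \<Longrightarrow> j \<in> {1..v} \<Longrightarrow> q (\<zeta> \<circ> transpose (Inl i) (Inl j)) = q \<zeta>"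
  using symHx symGx by (intro q_sw) auto

lemma q_swy: "i \<in> {1..u} \<Longrightarrow> j \<in> {1..u} \<Longrightarrow> q (\<zeta> \<circ> transpose (Inr i) (Inr j)) = q \<zeta>"
  using symHy symGy by (intro q_sw) auto

abbreviation sx :: "nat + nat \<Rightarrow> nat + nat" where "sx \<equiv> transpose (Inl 0) (Inl 1)"
abbreviation sy :: "nat + nat \<Rightarrow> nat + nat" where "sy \<equiv> transpose (Inr 0) (Inr 1)"

text \<open>The mixed difference under \<open>sx\<close> and \<open>sy\<close> kills
  \<open>G\<close>, which is symmetric in \<open>x_0, x_1\<close>, and \<open>H\<close>, which is
  symmetric in \<open>y_0, y_1\<close>.\<close>

lemma four_term: "h \<zeta> + h (\<zeta> \<circ> sx \<circ> sy) = h (\<zeta> \<circ> sx) + h (\<zeta> \<circ> sy)"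
proof -
  have G: "G (\<xi> \<circ> sx) = G \<xi>" for \<xi> using symGx[of 0 1] uv by (simp add: sw_def fun_eq_iff)
  have H: "H (\<xi> \<circ> sy) = H \<xi>" for \<xi> using symHy[of 0 1] uv by (simp add: sw_def fun_eq_iff)
  have "\<zeta> \<circ> sx \<circ> sy = \<zeta> \<circ> sy \<circ> sx" by (auto simp: fun_eq_iff transpose_def)
  hence "G (\<zeta> \<circ> sx \<circ> sy) = G (\<zeta> \<circ> sy)" by (simp only: G)
  thus ?thesis by (simp only: h_def G H add_ac)
qed

definition pt :: "(nat + nat \<Rightarrow> 'a) \<Rightarrow> 'a \<Rightarrow> 'a \<Rightarrow> 'a \<Rightarrow> 'a \<Rightarrow> nat + nat \<Rightarrow> 'a"
  where "pt \<zeta> a b c d = \<zeta>(Inl 0 := a, Inl 1 := b, Inr 0 := c, Inr 1 := d)"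

text \<open>\<open>four_term\<close> at a point with \<open>x_0 = y_0 = z\<close>, where one of the
  four values of \<open>h\<close> vanishes.\<close>

lemma four_term_q:
  "(s - t) ^ 2 * q (pt \<zeta> s z t z) = (s - z) ^ 2 * q (pt \<zeta> s z z t) + (z - t) ^ 2 * q (pt \<zeta> z s t z)"
proof -
  have "pt \<zeta> z s z t \<circ> sx = pt \<zeta> s z z t" "pt \<zeta> z s z t \<circ> sy = pt \<zeta> z s t z"
    "pt \<zeta> s z z t \<circ> sy = pt \<zeta> s z t z"
    by (auto simp: pt_def fun_eq_iff transpose_def)
  thus ?thesis using four_term[of "pt \<zeta> z s z t"] by (simp add: hq) (simp add: pt_def)
qed

text \<open>On this locus \<open>four_term_q\<close> closes up: for \<open>s = t\<close> it relates
  \<open>\<kappa>\<close> only to its own swap.\<close>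

definition \<kappa> :: "(nat + nat \<Rightarrow> 'a) \<Rightarrow> 'a"
  where "\<kappa> \<zeta> = q (\<zeta>(Inr 0 := \<zeta> (Inl 1), Inr 1 := \<zeta> (Inl 0)))"

text \<open>\<open>y_0\<close> and \<open>y_1\<close> have been substituted away, which leaves
  \<open>u + v\<close> variables.\<close>

definition I where "I = Inl ` {..v} \<union> Inr ` {2..u}"

definition \<sigma> :: "nat + nat \<Rightarrow> nat + nat"
  where "\<sigma> = (\<lambda>v. v)(Inr 0 := Inl 1, Inr 1 := Inl 0)"

lemma \<kappa>_\<sigma>: "\<kappa> \<zeta> = q (\<lambda>v. \<zeta> (\<sigma> v))"
  unfolding \<kappa>_def by (rule arg_cong[of _ _ q]) (auto simp: \<sigma>_def)

lemma finI: "finite I" by (simp add: I_def)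

lemma memI [simp]: "Inl k \<in> I \<longleftrightarrow> k \<le> v" "Inr k \<in> I \<longleftrightarrow> 2 \<le> k \<and> k \<le> u"
  by (auto simp: I_def)

lemma cardI: "card I = u + v"
proof -
  have "card I = card (Inl ` {..v} :: (nat + nat) set) + card (Inr ` {2..u} :: (nat + nat) set)"
    unfolding I_def by (rule card_Un_disjoint) auto
  also have "\<dots> = u + v" using uv by (simp add: card_image)
  finally show ?thesis .
qed

lemma PF\<kappa>: "PF I \<kappa>"
proof -
  have "\<sigma> ` A \<subseteq> I" using uv by (auto simp: A_def \<sigma>_def I_def image_iff)
  hence "PF I (\<lambda>\<zeta>. q (\<lambda>v. \<zeta> (\<sigma> v)))" by (intro PF_comp[OF PFq, where \<sigma> = \<sigma>])
  thus ?thesis unfolding \<kappa>_\<sigma>[abs_def] .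
qed

lemma \<kappa>_pt: "\<kappa> \<zeta> = q (pt \<zeta> (\<zeta> (Inl 0)) (\<zeta> (Inl 1)) (\<zeta> (Inl 1)) (\<zeta> (Inl 0)))"
  by (simp add: \<kappa>_def pt_def)

lemma \<kappa>_swap_pt: "\<kappa> (\<zeta> \<circ> sx) = q (pt \<zeta> (\<zeta> (Inl 1)) (\<zeta> (Inl 0)) (\<zeta> (Inl 0)) (\<zeta> (Inl 1)))"
  unfolding \<kappa>_def by (rule arg_cong[of _ _ q]) (auto simp: pt_def fun_eq_iff transpose_def)

text \<open>For \<open>s = t\<close> the left side of \<open>four_term_q\<close> is zero and the two
  squares on the right agree.\<close>

lemma \<kappa>_antisym: "sw (Inl 0) (Inl 1) \<kappa> = (\<lambda>\<zeta>. - \<kappa> \<zeta>)"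
proof (rule PF_eqI_diff[of "Inl 0" "Inl 1" I])
  fix \<zeta> :: "nat + nat \<Rightarrow> 'a" assume ne: "\<zeta> (Inl 0) \<noteq> \<zeta> (Inl 1)"
  let ?z = "\<zeta> (Inl 0)" and ?w = "\<zeta> (Inl 1)"
  have "0 = (?w - ?z) ^ 2 * \<kappa> (\<zeta> \<circ> sx) + (?z - ?w) ^ 2 * \<kappa> \<zeta>"
    using four_term_q[of ?w ?w \<zeta> ?z] by (simp only: \<kappa>_pt[of \<zeta>] \<kappa>_swap_pt) simp
  also have "\<dots> = (?z - ?w) ^ 2 * (\<kappa> (\<zeta> \<circ> sx) + \<kappa> \<zeta>)"
    by (simp add: power2_eq_square algebra_simps)
  finally have "\<kappa> (\<zeta> \<circ> sx) + \<kappa> \<zeta> = 0" using ne by simp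
  thus "sw (Inl 0) (Inl 1) \<kappa> \<zeta> = - \<kappa> \<zeta>" by (simp add: sw_def eq_neg_iff_add_eq_0)
qed (use PF\<kappa> uv in \<open>auto intro!: PF_sw PF_minus\<close>)

lemma \<kappa>_eq_q:
  assumes "\<zeta> (Inr 0) = \<zeta> (Inl 1)" "\<zeta> (Inr 1) = \<zeta> (Inl 0)"
  shows "\<kappa> \<zeta> = q \<zeta>"
  unfolding \<kappa>_def using assms by (metis fun_upd_triv)

lemma vd_q: "k \<le> v \<Longrightarrow> vd (Inl k) u q" "k \<le> u \<Longrightarrow> vd (Inr k) v q"
proof -
  have *: "vd x M q" if x: "x \<in> A" and vd: "vd x M h" for x M
  proof -
    have "\<forall>m>M. cf x m q = (\<lambda>_. 0)"
    proof (intro allI impI)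
      fix m assume m: "m > M"
      show "cf x m q = (\<lambda>_. 0)"
      proof (rule PF_eqI_diff[of "Inl 0" "Inr 0" A])
        show "PF A (cf x m q)" using PF_mono[OF PF_cf[OF PFq]] by auto
        fix \<zeta> :: "nat + nat \<Rightarrow> 'a" assume ne: "\<zeta> (Inl 0) \<noteq> \<zeta> (Inr 0)"
        let ?L = "uni x (\<lambda>\<zeta>. \<zeta> (Inl 0) - \<zeta> (Inr 0)) \<zeta>"
        have "h = (\<lambda>\<zeta>. (\<zeta> (Inl 0) - \<zeta> (Inr 0)) * ((\<zeta> (Inl 0) - \<zeta> (Inr 0)) * q \<zeta>))"
          using hq by (auto simp: power2_eq_square mult.assoc)
        hence eq: "uni x h \<zeta> = ?L * (?L * uni x q \<zeta>)"
          using PFq by (simp add: uni_mult[of A] PF_mult PF_diff PF_var)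
        have "poly ?L (\<zeta> x) \<noteq> 0" using ne by (simp add: poly_uni_self[of A] PF_diff PF_var)
        hence L: "?L \<noteq> 0" by auto
        have "degree (uni x q \<zeta>) \<le> degree (uni x h \<zeta>)"
          using L by (cases "uni x q \<zeta> = 0") (auto simp: eq degree_mult_eq)
        also have "\<dots> \<le> M" using vd by (simp add: vd_def)
        finally show "cf x m q \<zeta> = 0" using m by (simp add: cf_def coeff_eq_0)
      qed auto
    qed
    thus ?thesis using bdeg_iff_vd[of "{x}" M q] by (simp add: bdeg_def)
  qed
  show "k \<le> v \<Longrightarrow> vd (Inl k) u q" using *[of "Inl k" u] vdx[of k] by (simp add: h_def[abs_def])
  show "k \<le> u \<Longrightarrow> vd (Inr k) v q" using *[of "Inr k" v] vdy[of k] by (simp add: h_def[abs_def])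
qed

text \<open>The double factor removes two degrees. The weaker bounds remain true for
  \<open>u = 1\<close> or \<open>v = 1\<close>; they match the number of interpolation nodes with
  indices from 2 on, and stay below the number of roots with indices from 1 on.\<close>

lemma degree_q_x: "degree (uni (Inl 0) q \<zeta>) \<le> u - 1"
  and degree_q_y: "degree (uni (Inr 0) q \<zeta>) \<le> v - 1"
proof -
  have eq: "h = (\<lambda>\<zeta>. (\<zeta> (Inl 0) - \<zeta> (Inr 0)) * ((\<zeta> (Inl 0) - \<zeta> (Inr 0)) * q \<zeta>))"
    using hq by (auto simp: power2_eq_square mult.assoc)
  have L: "uni x h \<zeta> = uni x (\<lambda>\<zeta>. \<zeta> (Inl 0) - \<zeta> (Inr 0)) \<zeta> * (uni x (\<lambda>\<zeta>. \<zeta> (Inl 0) - \<zeta> (Inr 0)) \<zeta> * uni x q \<zeta>)" for x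
    unfolding eq using PFq by (simp add: uni_mult[of A] PF_mult PF_diff PF_var)
  have Lx: "uni (Inl 0) (\<lambda>\<zeta>. \<zeta> (Inl 0) - \<zeta> (Inr 0)) \<zeta> = [:- \<zeta> (Inr 0), 1:]"
    by (subst uni_diff[of A]) (auto simp: uni_var)
  have Ly: "uni (Inr 0) (\<lambda>\<zeta>. \<zeta> (Inl 0) - \<zeta> (Inr 0)) \<zeta> = [:\<zeta> (Inl 0), - 1:]"
    by (subst uni_diff[of A]) (auto simp: uni_var)
  have "degree (uni (Inl 0) h \<zeta>) \<le> u" "degree (uni (Inr 0) h \<zeta>) \<le> v"
    using vdx[of 0] vdy[of 0] by (simp_all add: vd_def h_def[abs_def])
  thus "degree (uni (Inl 0) q \<zeta>) \<le> u - 1" "degree (uni (Inr 0) q \<zeta>) \<le> v - 1"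
    unfolding L Lx Ly
    by (cases "uni (Inl 0) q \<zeta> = 0"; cases "uni (Inr 0) q \<zeta> = 0"; simp add: degree_mult_eq del: mult_pCons_left)+
qed

text \<open>The total derivative in \<open>w\<close> on the locus \<open>x\<^sub>1 = y\<^sub>0 = w\<close>, \<open>x\<^sub>0 = y\<^sub>1 = z\<close>: the derivative in
  \<open>x\<^sub>1\<close> is traded for one in the distinguished variable by the four term relation.\<close>

lemma der_\<kappa>:
  fixes \<zeta> :: "nat + nat \<Rightarrow> 'a"
  defines "z \<equiv> \<zeta> (Inl 0)" and "w \<equiv> \<zeta> (Inl 1)"
  assumes ne: "z \<noteq> w"
  shows "der (Inl 1) \<kappa> \<zeta> = poly (pderiv (uni (Inr 0) q (pt \<zeta> z w w z))) w
    - poly (pderiv (uni (Inl 0) q (pt \<zeta> w z z w))) w + 2 * \<kappa> \<zeta> / (w - z)"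
proof -
  let ?\<xi> = "pt \<zeta> z w w z"
  define P1 where "P1 = uni (Inl 1) q ?\<xi>"
  define P2 where "P2 = uni (Inl 0) q (pt \<zeta> w z z w)"
  define P3 where "P3 = uni (Inl 0) q (pt \<zeta> w z w z)"
  have P1: "poly P1 s = q (pt \<zeta> z s w z)" for s
    unfolding P1_def poly_uni[OF PFq] by (rule arg_cong[of _ _ q]) (auto simp: pt_def)
  have P2: "poly P2 s = q (pt \<zeta> s z z w)" for s
    unfolding P2_def poly_uni[OF PFq] by (rule arg_cong[of _ _ q]) (auto simp: pt_def)
  have P3: "poly P3 s = q (pt \<zeta> s z w z)" for s
    unfolding P3_def poly_uni[OF PFq] by (rule arg_cong[of _ _ q]) (auto simp: pt_def)
  \<comment> \<open>This is \<open>four_term_q\<close> with \<open>t = w\<close>, as an identity of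
    polynomials in \<open>s\<close>. Its left side vanishes doubly at \<open>s = w\<close>, so
    differentiating there eliminates \<open>P3\<close>.\<close>
  have "[:- w, 1:] * [:- w, 1:] * P3 = [:- z, 1:] * [:- z, 1:] * P2 + [:(z - w) ^ 2:] * P1"
  proof (rule poly_eqI_infinite[of "{}"])
    fix s
    show "poly ([:- w, 1:] * [:- w, 1:] * P3) s = poly ([:- z, 1:] * [:- z, 1:] * P2 + [:(z - w) ^ 2:] * P1) s"
      using four_term_q[of s w \<zeta> z] by (simp only: poly_add poly_mult poly_pCons poly_0 P1 P2 P3) (simp add: power2_eq_square)
  qed simp
  hence "poly (pderiv ([:- w, 1:] * [:- w, 1:] * P3)) w =
      poly (pderiv ([:- z, 1:] * [:- z, 1:] * P2 + [:(z - w) ^ 2:] * P1)) w" by (rule arg_cong)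
  moreover have "poly (pderiv ([:- a, 1:] * [:- a, 1:] * P)) w = 2 * (w - a) * poly P w + (w - a) ^ 2 * poly (pderiv P) w"
    for a and P :: "'a poly"
    unfolding pderiv_mult poly_add poly_mult by (simp add: pderiv_pCons power2_eq_square algebra_simps)
  moreover have "poly (pderiv ([:a:] * P)) w = a * poly (pderiv P) w" for a and P :: "'a poly"
    unfolding pderiv_mult poly_add poly_mult by (simp add: pderiv_pCons)
  ultimately have e: "0 = 2 * (w - z) * poly P2 w + (w - z) ^ 2 * poly (pderiv P2) w + (z - w) ^ 2 * poly (pderiv P1) w"
    by (simp only: pderiv_add poly_add) simp
  have P2w: "poly P2 w = - \<kappa> \<zeta>"
    using fun_cong[OF \<kappa>_antisym, of \<zeta>] by (simp only: P2 sw_def \<kappa>_swap_pt z_def w_def)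
  have "(w - z) * (2 * poly P2 w + (w - z) * (poly (pderiv P2) w + poly (pderiv P1) w)) =
      2 * (w - z) * poly P2 w + (w - z) ^ 2 * poly (pderiv P2) w + (z - w) ^ 2 * poly (pderiv P1) w"
    by (simp add: power2_eq_square algebra_simps)
  with e have "(w - z) * (2 * poly P2 w + (w - z) * (poly (pderiv P2) w + poly (pderiv P1) w)) = 0" by simp
  hence "(w - z) * (poly (pderiv P2) w + poly (pderiv P1) w) = 2 * \<kappa> \<zeta>"
    using ne by (simp add: P2w add_eq_0_iff)
  hence P1': "poly (pderiv P1) w = - poly (pderiv P2) w + 2 * \<kappa> \<zeta> / (w - z)"
    using ne by (simp add: field_simps)
  have \<xi>: "(\<lambda>v. \<zeta> (\<sigma> v)) = ?\<xi>" by (auto simp: \<sigma>_def pt_def z_def w_def)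
  \<comment> \<open>Both \<open>x_1\<close> and \<open>y_0\<close> follow \<open>w\<close>, so the
    chain rule has two terms.\<close>
  have fib: "{j \<in> A. \<sigma> j = Inl 1} = {Inl 1, Inr 0}"
    using uv by (auto simp: \<sigma>_def split: if_splits)
  have "der (Inl 1) \<kappa> \<zeta> = (\<Sum>j\<in>{j \<in> A. \<sigma> j = Inl 1}. der j q ?\<xi>)"
    using der_comp[OF finA PFq, of "Inl 1" \<sigma> \<zeta>] by (simp only: \<kappa>_\<sigma>[abs_def] \<xi>)
  also have "\<dots> = der (Inl 1) q ?\<xi> + der (Inr 0) q ?\<xi>" unfolding fib by simp
  also have "der (Inl 1) q ?\<xi> = poly (pderiv P1) w" by (simp add: der_def P1_def pt_def)
  also have "der (Inr 0) q ?\<xi> = poly (pderiv (uni (Inr 0) q ?\<xi>)) w" by (simp add: der_def pt_def)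
  finally show ?thesis by (simp add: P1' P2_def)
qed

section \<open>The Dunkl equations for the product of \<open>\<kappa>\<close> with Vandermonde
  determinants\<close>

abbreviation Vx :: "(nat + nat \<Rightarrow> 'a) \<Rightarrow> 'a" where "Vx \<zeta> \<equiv> vdm {2..v} (\<lambda>k. \<zeta> (Inl k))"
abbreviation Vy :: "(nat + nat \<Rightarrow> 'a) \<Rightarrow> 'a" where "Vy \<zeta> \<equiv> vdm {2..u} (\<lambda>k. \<zeta> (Inr k))"

definition F where "F \<zeta> = \<kappa> \<zeta> * (Vx \<zeta> * Vy \<zeta>)"

lemma PF_vdm: "g ` K \<subseteq> J \<Longrightarrow> PF J (\<lambda>\<zeta>. vdm K (\<lambda>k. \<zeta> (g k)))"
  unfolding vdm_def case_prod_beta by (intro PF_prod PF_diff PF_var) auto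

lemma PF_Vx: "PF I Vx" and PF_Vy: "PF I Vy"
  by (rule PF_vdm; auto)+

lemma PF_V: "PF (I - {Inl 0, Inl 1}) (\<lambda>\<zeta>. Vx \<zeta> * Vy \<zeta>)"
  by (intro PF_mult PF_vdm) auto

lemma PF_F: "PF I F"
  unfolding F_def[abs_def] by (intro PF_mult PF\<kappa> PF_Vx PF_Vy)

text \<open>By \<open>der_\<kappa>\<close> only derivatives in the distinguished variables
  \<open>y_0\<close> and \<open>x_0\<close> occur. The degrees of \<open>P0\<close> and
  \<open>P2\<close> do not exceed the numbers of nodes \<open>x_2, ..., x_v\<close> and
  \<open>y_2, ..., y_u\<close>, so \<open>lagrange_derivative\<close> applies. Symmetry of
  \<open>q\<close> turns the node values into values of \<open>\<kappa>\<close> at transposed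
  points, and \<open>vdm_upd\<close> absorbs the weights.\<close>

lemma dunkl_w: "dunkl I (Inl 1) F = (\<lambda>_. 0)"
proof (rule PF_eqI_inj[OF finI])
  show "PF I (dunkl I (Inl 1) F)" using uv by (intro PF_dunkl finI PF_F) auto
  fix \<zeta> :: "nat + nat \<Rightarrow> 'a" assume inj: "inj_on \<zeta> I"
  define z w where "z = \<zeta> (Inl 0)" and "w = \<zeta> (Inl 1)"
  define x y where "x k = \<zeta> (Inl k)" and "y k = \<zeta> (Inr k)" for k
  let ?V = "Vx \<zeta> * Vy \<zeta>"
  have inj_x: "inj_on x {2..v}" and inj_y: "inj_on y {2..u}"
    unfolding x_def[abs_def] y_def[abs_def]
    by (rule inj_on_Inl[OF inj] inj_on_Inr[OF inj]; auto)+
  have zw: "z \<noteq> w" using inj_onD[OF inj, of "Inl 0" "Inl 1"] uv by (auto simp: z_def w_def)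
  have wx: "w \<noteq> x k" if "k \<in> {2..v}" for k
    using inj_onD[OF inj, of "Inl 1" "Inl k"] uv that by (auto simp: x_def w_def)
  have wy: "w \<noteq> y k" if "k \<in> {2..u}" for k
    using inj_onD[OF inj, of "Inl 1" "Inr k"] uv that by (auto simp: y_def w_def)
  have wx': "w \<notin> x ` {2..v}" and wy': "w \<notin> y ` {2..u}" using wx wy by blast+
  define Lx where "Lx k = (\<Prod>l\<in>{2..v} - {k}. (w - x l) / (x k - x l))" for k
  define Ly where "Ly k = (\<Prod>l\<in>{2..u} - {k}. (w - y l) / (y k - y l))" for k
  let ?\<kappa>x = "\<lambda>k. \<kappa> (\<zeta> \<circ> transpose (Inl 1) (Inl k))" and ?\<kappa>y = "\<lambda>k. \<kappa> (\<zeta> \<circ> transpose (Inl 1) (Inr k))"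
  define P0 where "P0 = uni (Inr 0) q (pt \<zeta> z w w z)"
  define P2 where "P2 = uni (Inl 0) q (pt \<zeta> w z z w)"
  have P0: "poly P0 t = q (pt \<zeta> z w t z)" for t
    unfolding P0_def poly_uni[OF PFq] by (rule arg_cong[of _ _ q]) (auto simp: pt_def)
  have P2: "poly P2 s = q (pt \<zeta> s z z w)" for s
    unfolding P2_def poly_uni[OF PFq] by (rule arg_cong[of _ _ q]) (auto simp: pt_def)
  have P0w: "poly P0 w = \<kappa> \<zeta>" by (simp add: P0 \<kappa>_pt z_def w_def)
  have P2w: "poly P2 w = - \<kappa> \<zeta>"
    using fun_cong[OF \<kappa>_antisym, of \<zeta>] by (simp only: P2 sw_def \<kappa>_swap_pt z_def w_def)
  \<comment> \<open>Putting \<open>x_k\<close> into \<open>y_0\<close> and exchanging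
    \<open>x_1\<close> with \<open>x_k\<close> leads back to the locus of
    \<open>\<kappa>\<close>.\<close>
  have P0x: "poly P0 (x k) = ?\<kappa>x k" if k: "k \<in> {2..v}" for k
  proof -
    have "poly P0 (x k) = q (pt \<zeta> z w (x k) z \<circ> transpose (Inl 1) (Inl k))"
      unfolding P0 using k uv by (subst q_swx) auto
    also have "\<dots> = ?\<kappa>x k"
      unfolding \<kappa>_def by (rule arg_cong[of _ _ q])
        (use k in \<open>auto simp: pt_def fun_eq_iff transpose_def x_def z_def w_def\<close>)
    finally show ?thesis .
  qed
  \<comment> \<open>Here the node lands in \<open>x_0\<close> instead of \<open>x_1\<close>;
    antisymmetry moves it back at the price of a sign.\<close>
  have P2y: "poly P2 (y k) = - ?\<kappa>y k" if k: "k \<in> {2..u}" for k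
  proof -
    have "poly P2 (y k) = q (pt \<zeta> (y k) z z w \<circ> transpose (Inr 1) (Inr k))"
      unfolding P2 using k uv by (subst q_swy) auto
    also have "\<dots> = \<kappa> (\<zeta> \<circ> transpose (Inl 1) (Inr k) \<circ> sx)"
      unfolding \<kappa>_def by (rule arg_cong[of _ _ q])
        (use k in \<open>auto simp: pt_def fun_eq_iff transpose_def y_def z_def w_def\<close>)
    also have "\<dots> = - ?\<kappa>y k"
      using fun_cong[OF \<kappa>_antisym, of "\<zeta> \<circ> transpose (Inl 1) (Inr k)"] by (simp add: sw_def)
    finally show ?thesis .
  qed
  have "poly (pderiv P0) w = (\<Sum>k\<in>{2..v}. (poly P0 w - poly P0 (x k) * Lx k) / (w - x k))"
    unfolding Lx_def using degree_q_y[of "pt \<zeta> z w w z"]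
    by (intro lagrange_derivative inj_x wx') (auto simp: P0_def)
  also have "\<dots> = (\<Sum>k\<in>{2..v}. (\<kappa> \<zeta> - ?\<kappa>x k * Lx k) / (w - x k))"
    by (intro sum.cong refl) (simp add: P0w P0x)
  finally have dP0: "poly (pderiv P0) w = (\<Sum>k\<in>{2..v}. (\<kappa> \<zeta> - ?\<kappa>x k * Lx k) / (w - x k))" .
  have "poly (pderiv P2) w = (\<Sum>k\<in>{2..u}. (poly P2 w - poly P2 (y k) * Ly k) / (w - y k))"
    unfolding Ly_def using degree_q_x[of "pt \<zeta> w z z w"]
    by (intro lagrange_derivative inj_y wy') (auto simp: P2_def)
  also have "\<dots> = (\<Sum>k\<in>{2..u}. - ((\<kappa> \<zeta> - ?\<kappa>y k * Ly k) / (w - y k)))"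
  proof (intro sum.cong refl)
    fix k assume "k \<in> {2..u}"
    hence "poly P2 w - poly P2 (y k) * Ly k = - (\<kappa> \<zeta> - ?\<kappa>y k * Ly k)" by (simp add: P2w P2y)
    thus "(poly P2 w - poly P2 (y k) * Ly k) / (w - y k) = - ((\<kappa> \<zeta> - ?\<kappa>y k * Ly k) / (w - y k))"
      by (simp only: minus_divide_left)
  qed
  finally have dP2: "poly (pderiv P2) w = - (\<Sum>k\<in>{2..u}. (\<kappa> \<zeta> - ?\<kappa>y k * Ly k) / (w - y k))"
    by (simp only: sum_negf)
  have d\<kappa>: "der (Inl 1) \<kappa> \<zeta> = 2 * \<kappa> \<zeta> / (w - z) + (\<Sum>k\<in>{2..v}. (\<kappa> \<zeta> - ?\<kappa>x k * Lx k) / (w - x k))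
      + (\<Sum>k\<in>{2..u}. (\<kappa> \<zeta> - ?\<kappa>y k * Ly k) / (w - y k))"
    using der_\<kappa>[of \<zeta>] zw dP0 dP2 by (simp add: z_def w_def P0_def P2_def)
  have dF: "der (Inl 1) F \<zeta> = der (Inl 1) \<kappa> \<zeta> * ?V"
    unfolding F_def[abs_def] using PF\<kappa> PF_mono[OF PF_V, of I] der_notin[OF PF_V, of "Inl 1"]
    by (subst der_mult[of I]) auto
  have ddF: "dd (Inl 1) p F \<zeta> = (F \<zeta> - F (\<zeta> \<circ> transpose (Inl 1) p)) / (w - \<zeta> p)"
    if p: "p \<in> I" "p \<noteq> Inl 1" for p
  proof -
    have "\<zeta> (Inl 1) \<noteq> \<zeta> p" using inj p uv by (auto simp: inj_on_def)
    thus ?thesis using dd_val[OF PF_F, of "Inl 1" p \<zeta>] p uv by (simp add: w_def comp_transpose_upd)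
  qed
  \<comment> \<open>Antisymmetry doubles this term, which thereby accounts for the explicit fraction
    in \<open>der_\<kappa>\<close>.\<close>
  have Fz: "dd (Inl 1) (Inl 0) F \<zeta> = 2 * \<kappa> \<zeta> / (w - z) * ?V"
  proof -
    have "\<kappa> (\<zeta> \<circ> transpose (Inl 1) (Inl 0)) = - \<kappa> \<zeta>"
      using fun_cong[OF \<kappa>_antisym, of \<zeta>] by (simp add: sw_def transpose_commute)
    moreover have "Vx (\<zeta> \<circ> transpose (Inl 1) (Inl 0)) = Vx \<zeta>" "Vy (\<zeta> \<circ> transpose (Inl 1) (Inl 0)) = Vy \<zeta>"
      by (rule vdm_cong; auto simp: transpose_def)+
    ultimately have "F (\<zeta> \<circ> transpose (Inl 1) (Inl 0)) = - F \<zeta>" by (simp add: F_def)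
    thus ?thesis using ddF[of "Inl 0"] by (simp add: z_def F_def)
  qed
  have Fx: "dd (Inl 1) (Inl k) F \<zeta> = (\<kappa> \<zeta> - ?\<kappa>x k * Lx k) / (w - x k) * ?V" if k: "k \<in> {2..v}" for k
  proof -
    have "Vx (\<zeta> \<circ> transpose (Inl 1) (Inl k)) = vdm {2..v} (x(k := w))"
      by (rule vdm_cong) (use k in \<open>auto simp: transpose_def x_def w_def\<close>)
    also have "\<dots> = Vx \<zeta> * Lx k"
      unfolding Lx_def using vdm_upd[OF _ k inj_x] by (simp add: x_def[abs_def])
    finally have 1: "Vx (\<zeta> \<circ> transpose (Inl 1) (Inl k)) = Vx \<zeta> * Lx k" .
    have 2: "Vy (\<zeta> \<circ> transpose (Inl 1) (Inl k)) = Vy \<zeta>" by (rule vdm_cong) (auto simp: transpose_def)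
    have "F \<zeta> - F (\<zeta> \<circ> transpose (Inl 1) (Inl k)) = (\<kappa> \<zeta> - ?\<kappa>x k * Lx k) * ?V"
      unfolding F_def 1 2 by (simp add: algebra_simps)
    thus ?thesis using ddF[of "Inl k"] k by (simp add: x_def)
  qed
  have Fy: "dd (Inl 1) (Inr k) F \<zeta> = (\<kappa> \<zeta> - ?\<kappa>y k * Ly k) / (w - y k) * ?V" if k: "k \<in> {2..u}" for k
  proof -
    have "Vy (\<zeta> \<circ> transpose (Inl 1) (Inr k)) = vdm {2..u} (y(k := w))"
      by (rule vdm_cong) (use k in \<open>auto simp: transpose_def y_def w_def\<close>)
    also have "\<dots> = Vy \<zeta> * Ly k"
      unfolding Ly_def using vdm_upd[OF _ k inj_y] by (simp add: y_def[abs_def])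
    finally have 1: "Vy (\<zeta> \<circ> transpose (Inl 1) (Inr k)) = Vy \<zeta> * Ly k" .
    have 2: "Vx (\<zeta> \<circ> transpose (Inl 1) (Inr k)) = Vx \<zeta>" by (rule vdm_cong) (auto simp: transpose_def)
    have "F \<zeta> - F (\<zeta> \<circ> transpose (Inl 1) (Inr k)) = (\<kappa> \<zeta> - ?\<kappa>y k * Ly k) * ?V"
      unfolding F_def 1 2 by (simp add: algebra_simps)
    thus ?thesis using ddF[of "Inr k"] k by (simp add: y_def)
  qed
  have "I - {Inl 1} = insert (Inl 0) (Inl ` {2..v} \<union> Inr ` {2..u})"
    by (auto simp: I_def)
  hence "(\<Sum>p\<in>I - {Inl 1}. dd (Inl 1) p F \<zeta>) = dd (Inl 1) (Inl 0) F \<zeta> +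
      ((\<Sum>p\<in>Inl ` {2..v}. dd (Inl 1) p F \<zeta>) + (\<Sum>p\<in>Inr ` {2..u}. dd (Inl 1) p F \<zeta>))"
    by (simp only:) (subst sum.insert, (auto)[2], subst sum.union_disjoint, auto)
  also have "\<dots> = der (Inl 1) \<kappa> \<zeta> * ?V"
    unfolding d\<kappa> Fz using Fx Fy by (simp add: sum.reindex distrib_right sum_distrib_right add.assoc)
  finally show "dunkl I (Inl 1) F \<zeta> = 0" using dF by (simp add: dunkl_def)
qed simp

lemma F_antisym: "sw (Inl 0) (Inl 1) F = (\<lambda>\<zeta>. - F \<zeta>)"
proof
  fix \<zeta> :: "nat + nat \<Rightarrow> 'a"
  have "\<kappa> (\<zeta> \<circ> sx) = - \<kappa> \<zeta>" using fun_cong[OF \<kappa>_antisym, of \<zeta>] by (simp add: sw_def)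
  moreover have "Vx (\<zeta> \<circ> sx) = Vx \<zeta>" "Vy (\<zeta> \<circ> sx) = Vy \<zeta>"
    by (rule vdm_cong; auto simp: transpose_def)+
  ultimately show "sw (Inl 0) (Inl 1) F \<zeta> = - F \<zeta>" by (simp add: F_def sw_def)
qed

text \<open>\<open>dunkl_w\<close> conjugated by the swap under which \<open>F\<close> is
  antisymmetric.\<close>

lemma dunkl_z: "dunkl I (Inl 0) F = (\<lambda>_. 0)"
proof -
  have mem: "Inl 0 \<in> I" "Inl 1 \<in> I" using uv by auto
  have "sw (Inl 0) (Inl 1) (dunkl I (Inl 1) F) = dunkl I (Inl 0) (\<lambda>\<zeta>. - F \<zeta>)"
    using sw_dunkl[OF finI mem mem(2) PF_F] F_antisym by simp
  hence "(\<lambda>\<zeta>. - dunkl I (Inl 0) F \<zeta>) = (\<lambda>_. 0)"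
    using dunkl_w dunkl_minus[OF finI mem(1) PF_F] by simp
  thus ?thesis by (simp add: fun_eq_iff)
qed

lemma vd_vdm:
  assumes K: "finite K" and g: "inj_on g K" "k \<in> K"
  shows "vd (g k) (card K - 1) (\<lambda>\<zeta>. vdm K (\<lambda>k. \<zeta> (g k)) :: 'a)"
proof -
  let ?e = "\<lambda>l. if k < l then 1 else -1 :: 'a"
  define T where "T = (\<lambda>\<zeta>. \<Prod>l\<in>K - {k}. ?e l * (\<zeta> (g k) - \<zeta> (g l)) :: 'a)"
  have pfT: "PF (g ` K) (\<lambda>\<zeta>. ?e l * (\<zeta> (g k) - \<zeta> (g l)))" if "l \<in> K - {k}" for l
    using that g by (intro PF_mult PF_diff PF_var PF_const) auto
  have "vd (g k) (card K - 1) T"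
    unfolding vd_def
  proof
    fix \<zeta>
    have "degree (uni (g k) T \<zeta>) \<le> sum (degree \<circ> (\<lambda>l. uni (g k) (\<lambda>\<zeta>. ?e l * (\<zeta> (g k) - \<zeta> (g l))) \<zeta>)) (K - {k})"
      unfolding T_def using degree_prod_sum_le[of "K - {k}"] K
      by (subst uni_prod[of _ "g ` K", OF pfT]) auto
    also have "\<dots> \<le> (\<Sum>l\<in>K - {k}. 1)"
      unfolding comp_def
    proof (rule sum_mono)
      fix l assume l: "l \<in> K - {k}"
      hence "g l \<noteq> g k" using g by (auto simp: inj_on_def)
      hence "uni (g k) (\<lambda>\<zeta>. ?e l * (\<zeta> (g k) - \<zeta> (g l))) \<zeta> = [:?e l:] * [:- \<zeta> (g l), 1:]"
        by (intro uni_eqI) (simp add: algebra_simps)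
      thus "degree (uni (g k) (\<lambda>\<zeta>. ?e l * (\<zeta> (g k) - \<zeta> (g l))) \<zeta>) \<le> 1"
        by (simp add: degree_pCons_eq_if)
    qed
    finally show "degree (uni (g k) T \<zeta>) \<le> card K - 1" using K g by simp
  qed
  moreover have "vd (g k) 0 (\<lambda>\<zeta>. vdm (K - {k}) (\<lambda>k. \<zeta> (g k)) :: 'a)"
    using g by (intro vd_notin[of "g ` (K - {k})"] PF_vdm) (auto simp: inj_on_def)
  ultimately have "vd (g k) (0 + (card K - 1)) (\<lambda>\<zeta>. vdm (K - {k}) (\<lambda>k. \<zeta> (g k)) * T \<zeta>)"
    unfolding T_def using g by (intro vd_mult[of "g ` K"] PF_vdm PF_prod pfT) auto
  thus ?thesis by (simp add: vdm_remove[OF K g(2)] T_def)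
qed

text \<open>In \<open>x_0\<close> the degree \<open>u\<close> of \<open>x_0\<close> and the degree
  \<open>v\<close> of the substituted \<open>y_1\<close> add up, likewise for \<open>x_1\<close> and
  \<open>y_0\<close>. In the other variables the Vandermonde factors stay within the same
  bound.\<close>

lemma bdeg_F: "bdeg I (u + v) F"
  unfolding bdeg_iff_vd
proof
  fix p assume p: "p \<in> I"
  define q1 where "q1 \<zeta> = q (\<zeta>(Inr 0 := \<zeta> (Inl 1)))" for \<zeta>
  have PFq1: "PF A q1" unfolding q1_def[abs_def] using uv by (intro PF_merge PFq) auto
  have \<kappa>1: "\<kappa> = (\<lambda>\<zeta>. q1 (\<zeta>(Inr 1 := \<zeta> (Inl 0))))"
    by (auto simp: \<kappa>_def q1_def fun_upd_twist)
  have pf: "PF I (\<lambda>\<zeta>. Vx \<zeta> * Vy \<zeta>)" "PF I Vx" "PF I Vy"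
    by (intro PF_mult PF_Vx PF_Vy)+
  have q1_other: "vd k M q1" if "vd k M q" "k \<noteq> Inr 0" "k \<noteq> Inl 1" for k M
    unfolding q1_def[abs_def] using that by (intro vd_merge_other[OF PFq]) auto
  have \<kappa>_other: "vd k M \<kappa>" if "vd k M q" "k \<notin> {Inr 0, Inl 1, Inr 1, Inl 0}" for k M
    unfolding \<kappa>1 using that by (intro vd_merge_other[OF PFq1] q1_other) auto
  have V0: "vd k 0 (\<lambda>\<zeta>. Vx \<zeta> * Vy \<zeta>)" if "k \<in> {Inl 0, Inl 1}" for k
    using that by (intro vd_notin[OF PF_V]) auto
  consider "p = Inl 0" | "p = Inl 1" | k where "p = Inl k" "k \<in> {2..v}" | k where "p = Inr k" "k \<in> {2..u}"
    using p by (auto simp: I_def) (metis One_nat_def Suc_leI le_neq_implies_less less_one not_less numeral_2_eq_2)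
  thus "vd p (u + v) F"
  proof cases
    case 1
    have "vd (Inl 0) (u + v) \<kappa>"
      unfolding \<kappa>1 using uv vd_q(1)[of 0] vd_q(2)[of 1] by (intro vd_merge[OF PFq1] q1_other) auto
    hence "vd p (u + v + 0) F"
      unfolding F_def[abs_def] 1 by (intro vd_mult[OF PF\<kappa> pf(1)] V0) auto
    thus ?thesis by simp
  next
    case 2
    have "vd (Inl 1) (u + v) q1"
      unfolding q1_def[abs_def] using uv vd_q(1)[of 1] vd_q(2)[of 0] by (intro vd_merge[OF PFq]) auto
    hence "vd (Inl 1) (u + v) \<kappa>"
      unfolding \<kappa>1 by (intro vd_merge_other[OF PFq1]) auto
    hence "vd p (u + v + 0) F"
      unfolding F_def[abs_def] 2 by (intro vd_mult[OF PF\<kappa> pf(1)] V0) auto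
    thus ?thesis by simp
  next
    case 3
    have "vd p (card {2..v} - 1) Vx" unfolding 3(1) using vd_vdm[of "{2..v}" "Inl :: nat \<Rightarrow> nat + nat" k] 3(2) by simp
    moreover have "vd p 0 Vy" unfolding 3(1) by (intro vd_notin[of "Inr ` {2..u}"] PF_vdm) auto
    ultimately have "vd p (card {2..v} - 1 + 0) (\<lambda>\<zeta>. Vx \<zeta> * Vy \<zeta>)"
      by (intro vd_mult[OF pf(2,3)])
    moreover have "vd p u \<kappa>" using 3 vd_q(1)[of k] by (intro \<kappa>_other) auto
    ultimately have "vd p (u + (card {2..v} - 1 + 0)) F"
      unfolding F_def[abs_def] by (intro vd_mult[OF PF\<kappa> pf(1)])
    thus ?thesis by (rule vd_mono) auto
  next
    case 4
    have "vd p (card {2..u} - 1) Vy" unfolding 4(1) using vd_vdm[of "{2..u}" "Inr :: nat \<Rightarrow> nat + nat" k] 4(2) by simp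
    moreover have "vd p 0 Vx" unfolding 4(1) by (intro vd_notin[of "Inl ` {2..v}"] PF_vdm) auto
    ultimately have "vd p (0 + (card {2..u} - 1)) (\<lambda>\<zeta>. Vx \<zeta> * Vy \<zeta>)"
      by (intro vd_mult[OF pf(2,3)])
    moreover have "vd p v \<kappa>" using 4 vd_q(2)[of k] by (intro \<kappa>_other) auto
    ultimately have "vd p (v + (0 + (card {2..u} - 1))) F"
      unfolding F_def[abs_def] by (intro vd_mult[OF PF\<kappa> pf(1)])
    thus ?thesis by (rule vd_mono) auto
  qed
qed

text \<open>\<open>B = u + v\<close> serves as number of variables and as degree bound. Division by
  the Vandermonde factors is possible at points with distinct coordinates.\<close>

lemma \<kappa>_zero: "\<kappa> = (\<lambda>_. 0)"
proof (rule PF_eqI_inj[OF finI PF\<kappa>])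
  obtain n where "polyfun I n F" using PF_F by (auto simp: PF_def)
  hence F0: "F = (\<lambda>_. 0)"
    using uv by (intro dunkl_antisymmetric_zero[OF finI nz _ _ _ _ _ dunkl_z dunkl_w F_antisym bdeg_F])
      (auto simp: cardI)
  fix \<zeta> :: "nat + nat \<Rightarrow> 'a" assume inj: "inj_on \<zeta> I"
  have "Vx \<zeta> \<noteq> 0" "Vy \<zeta> \<noteq> 0"
    by (intro vdm_nonzero inj_on_Inl[OF inj] inj_on_Inr[OF inj]; simp)+
  thus "\<kappa> \<zeta> = 0" using fun_cong[OF F0, of \<zeta>] by (simp add: F_def)
qed simp

text \<open>A polynomial in \<open>x_0\<close> of degree less than \<open>u\<close> with the
  \<open>u\<close> roots \<open>y_1, ..., y_u\<close>: symmetry moves any \<open>y_j\<close> to the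
  place of \<open>y_1\<close>, where the value is one of \<open>\<kappa>\<close>.\<close>

lemma q_zero_1: "(\<lambda>\<zeta>. q (\<zeta>(Inl 1 := \<zeta> (Inr 0)))) = (\<lambda>_. 0)"
proof (rule PF_eqI_inj[OF finA])
  show "PF A (\<lambda>\<zeta>. q (\<zeta>(Inl 1 := \<zeta> (Inr 0))))" by (intro PF_merge PFq) auto
  fix \<zeta> :: "nat + nat \<Rightarrow> 'a" assume inj: "inj_on \<zeta> A"
  let ?\<zeta> = "\<zeta>(Inl 1 := \<zeta> (Inr 0))"
  let ?P = "uni (Inl 0) q ?\<zeta>"
  have root: "poly ?P (\<zeta> (Inr j)) = 0" if j: "j \<in> {1..u}" for j
  proof -
    let ?\<eta> = "?\<zeta>(Inl 0 := \<zeta> (Inr j)) \<circ> transpose (Inr 1) (Inr j)"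
    have "poly ?P (\<zeta> (Inr j)) = q ?\<eta>"
      unfolding poly_uni[OF PFq] using j uv by (subst q_swy) auto
    also have "\<dots> = \<kappa> ?\<eta>"
      by (rule \<kappa>_eq_q[symmetric]) (use j in \<open>auto simp: transpose_def\<close>)
    finally show ?thesis by (simp add: \<kappa>_zero)
  qed
  have "?P = 0"
  proof (rule poly_eqI_degree[of "(\<lambda>j. \<zeta> (Inr j)) ` {1..u}"])
    have "card ((\<lambda>j. \<zeta> (Inr j)) ` {1..u}) = u"
      by (subst card_image) (auto intro: inj_on_Inl[OF inj] inj_on_Inr[OF inj])
    thus "degree ?P < card ((\<lambda>j. \<zeta> (Inr j)) ` {1..u})" "degree (0 :: 'a poly) < card ((\<lambda>j. \<zeta> (Inr j)) ` {1..u})"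
      using degree_q_x[of ?\<zeta>] uv by auto
  qed (use root in auto)
  thus "q ?\<zeta> = 0" using poly_uni_self[OF PFq, of "Inl 0" ?\<zeta>] by simp
qed simp

text \<open>The same count in \<open>y_0\<close>: degree less than \<open>v\<close>, and the
  \<open>v\<close> roots \<open>x_1, ..., x_v\<close> by symmetry and
  \<open>q_zero_1\<close>.\<close>

theorem h_zero: "H \<zeta> + G \<zeta> = 0"
proof -
  have "q = (\<lambda>_. 0)"
  proof (rule PF_eqI_inj[OF finA PFq])
    fix \<zeta> :: "nat + nat \<Rightarrow> 'a" assume inj: "inj_on \<zeta> A"
    let ?P = "uni (Inr 0) q \<zeta>"
    have root: "poly ?P (\<zeta> (Inl k)) = 0" if k: "k \<in> {1..v}" for k
    proof -
      let ?\<eta> = "\<zeta>(Inr 0 := \<zeta> (Inl k)) \<circ> transpose (Inl 1) (Inl k)"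
      have "poly ?P (\<zeta> (Inl k)) = q ?\<eta>"
        unfolding poly_uni[OF PFq] using k uv by (subst q_swx) auto
      also have "?\<eta> = ?\<eta>(Inl 1 := ?\<eta> (Inr 0))"
        by (rule fun_upd_idem[symmetric]) (use k in \<open>auto simp: transpose_def\<close>)
      also have "q \<dots> = 0" using fun_cong[OF q_zero_1, of ?\<eta>] .
      finally show ?thesis .
    qed
    have "?P = 0"
    proof (rule poly_eqI_degree[of "(\<lambda>k. \<zeta> (Inl k)) ` {1..v}"])
      have "card ((\<lambda>k. \<zeta> (Inl k)) ` {1..v}) = v"
        by (subst card_image) (auto intro: inj_on_Inl[OF inj] inj_on_Inr[OF inj])
      thus "degree ?P < card ((\<lambda>k. \<zeta> (Inl k)) ` {1..v})" "degree (0 :: 'a poly) < card ((\<lambda>k. \<zeta> (Inl k)) ` {1..v})"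
        using degree_q_y[of \<zeta>] uv by auto
    qed (use root in auto)
    thus "q \<zeta> = 0" using poly_uni_self[OF PFq, of "Inr 0" \<zeta>] by simp
  qed simp
  thus ?thesis using hq[of \<zeta>] by (simp add: h_def)
qed

end

section \<open>Linear forms on the symmetric algebra\<close>

definition linear_form :: "(('i, 'j, 'a::field) sym_alg \<Rightarrow> 'a) \<Rightarrow> bool"
  where "linear_form L \<longleftrightarrow> (\<forall>F G. L (F + G) = L F + L G) \<and> (\<forall>c F. L (sym_scale c F) = c * L F)"

lemma linear_form_add: "linear_form L \<Longrightarrow> L (F + G) = L F + L G"
  and linear_form_scale: "linear_form L \<Longrightarrow> L (sym_scale c F) = c * L F"
  by (simp_all add: linear_form_def)

lemma linear_form_0: "linear_form L \<Longrightarrow> L 0 = 0"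
  using linear_form_scale[of L 0 0] by (simp add: sym_scale_def)

lemma linear_form_sum: "linear_form L \<Longrightarrow> L (\<Sum>i\<in>T. f i) = (\<Sum>i\<in>T. L (f i))"
  by (induction T rule: infinite_finite_induct) (simp_all add: linear_form_0 linear_form_add)

lemma linear_form_mult: "linear_form L \<Longrightarrow> linear_form (\<lambda>F. L (G * F))"
  by (simp add: linear_form_def distrib_left sym_scale_simps)

lemma linear_form_diff: "linear_form L \<Longrightarrow> linear_form L' \<Longrightarrow> linear_form (\<lambda>F. L F - L' F)"
  by (simp add: linear_form_def algebra_simps)

abbreviation mono_elem :: "(('i + 'j) \<Rightarrow>\<^sub>0 nat) \<Rightarrow> ('i, 'j, 'a::field) sym_alg"
  where "mono_elem m \<equiv> Poly_Mapping.single m 1"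

lemma sym_scale_single: "sym_scale c (Poly_Mapping.single m x) = Poly_Mapping.single m (c * x)"
  by (simp add: sym_scale_def mult_single)

lemma sym_expand:
  assumes "finite T" "Poly_Mapping.keys F \<subseteq> T"
  shows "F = (\<Sum>m\<in>T. sym_scale (Poly_Mapping.lookup F m) (mono_elem m))"
proof (rule poly_mapping_eqI)
  fix k
  have "Poly_Mapping.lookup (\<Sum>m\<in>T. sym_scale (Poly_Mapping.lookup F m) (mono_elem m)) k =
      (\<Sum>m\<in>T. if m = k then Poly_Mapping.lookup F k else 0)"
    unfolding lookup_sum by (intro sum.cong) (auto simp: sym_scale_single lookup_single)
  also have "\<dots> = Poly_Mapping.lookup F k"
    using assms by (auto simp: in_keys_iff)
  finally show "Poly_Mapping.lookup F k =
    Poly_Mapping.lookup (\<Sum>m\<in>T. sym_scale (Poly_Mapping.lookup F m) (mono_elem m)) k" ..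
qed

lemma linear_form_expand:
  assumes "linear_form L" "finite T" "Poly_Mapping.keys F \<subseteq> T"
  shows "L F = (\<Sum>m\<in>T. Poly_Mapping.lookup F m * L (mono_elem m))"
  using arg_cong[OF sym_expand[OF assms(2,3)], of L]
  by (simp add: linear_form_sum[OF assms(1)] linear_form_scale[OF assms(1)])

lemma linear_form_eqI:
  assumes "linear_form L" "linear_form L'" "F \<in> sym_comp I J d e"
    and "\<And>m. mono_elem m \<in> (sym_comp I J d e :: ('i, 'j, 'a::field) sym_alg set) \<Longrightarrow>
      L (mono_elem m) = L' (mono_elem m)"
  shows "L F = L' F"
proof -
  have "L F = (\<Sum>m\<in>Poly_Mapping.keys F. Poly_Mapping.lookup F m * L (mono_elem m))"
    by (rule linear_form_expand) (use assms in auto)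
  also have "\<dots> = (\<Sum>m\<in>Poly_Mapping.keys F. Poly_Mapping.lookup F m * L' (mono_elem m))"
    using assms(3) by (intro sum.cong refl arg_cong2[of _ _ _ _ "(*)"] assms(4)) (auto simp: sym_comp_def)
  also have "\<dots> = L' F"
    by (rule linear_form_expand[symmetric]) (use assms in auto)
  finally show ?thesis .
qed

lemma linear_form_ex:
  fixes \<mu> :: "_ \<Rightarrow> 'a::field"
  shows "\<exists>L. linear_form L \<and> (\<forall>m. L (mono_elem m :: ('i, 'j, 'a) sym_alg) = \<mu> m)"
proof -
  interpret sc: vector_space "sym_scale :: 'a \<Rightarrow> ('i, 'j, 'a) sym_alg \<Rightarrow> _"
    by (rule vector_space_scales)
  define L :: "('i, 'j, 'a) sym_alg \<Rightarrow> 'a"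
    where "L F = (\<Sum>m\<in>Poly_Mapping.keys F. Poly_Mapping.lookup F m * \<mu> m)" for F
  have L: "L F = (\<Sum>m\<in>T. Poly_Mapping.lookup F m * \<mu> m)" if "finite T" "Poly_Mapping.keys F \<subseteq> T" for T F
    unfolding L_def using that by (intro sum.mono_neutral_left) (auto simp: in_keys_iff)
  have "linear_form L"
    unfolding linear_form_def
  proof (intro conjI allI)
    fix F G :: "('i, 'j, 'a) sym_alg"
    let ?T = "Poly_Mapping.keys F \<union> Poly_Mapping.keys G"
    have "L (F + G) = (\<Sum>m\<in>?T. Poly_Mapping.lookup (F + G) m * \<mu> m)"
      by (rule L) (auto dest: subsetD[OF Poly_Mapping.keys_add])
    also have "\<dots> = L F + L G"
      by (subst (1 2) L[of ?T]) (auto simp: lookup_add distrib_right sum.distrib)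
    finally show "L (F + G) = L F + L G" .
  next
    fix c and F :: "('i, 'j, 'a) sym_alg"
    have lk: "Poly_Mapping.lookup (sym_scale c F) m = c * Poly_Mapping.lookup F m" for m
    proof -
      have "sym_scale c F = sym_scale c (\<Sum>m\<in>Poly_Mapping.keys F. sym_scale (Poly_Mapping.lookup F m) (mono_elem m))"
        by (rule arg_cong[OF sym_expand]) auto
      also have "\<dots> = (\<Sum>m\<in>Poly_Mapping.keys F. Poly_Mapping.single m (c * Poly_Mapping.lookup F m))"
        by (simp only: sc.scale_sum_right sym_scale_single mult_1_right)
      finally have "sym_scale c F = \<dots>" .
      thus ?thesis
        by (simp add: lookup_sum lookup_single when_def in_keys_iff)
    qed
    have "L (sym_scale c F) = (\<Sum>m\<in>Poly_Mapping.keys F. Poly_Mapping.lookup (sym_scale c F) m * \<mu> m)"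
      by (rule L) (auto simp: in_keys_iff lk)
    thus "L (sym_scale c F) = c * L F"
      by (simp add: lk L_def sum_distrib_left mult.assoc)
  qed
  moreover have "L (mono_elem m) = \<mu> m" for m by (simp add: L_def)
  ultimately show ?thesis by blast
qed

lemma mono_elem_comp:
  "mono_elem m \<in> (sym_comp I J d e :: ('i, 'j, 'a::field) sym_alg set) \<longleftrightarrow>
    Poly_Mapping.keys m \<subseteq> I <+> J \<and> (\<Sum>i\<in>I. Poly_Mapping.lookup m (Inl i)) = d \<and>
    (\<Sum>j\<in>J. Poly_Mapping.lookup m (Inr j)) = e"
  by (simp add: sym_comp_def)

lemma sym_var_mono: "sym_var s * mono_elem m = mono_elem (Poly_Mapping.single s 1 + m)"
  by (simp add: sym_var_def mult_single)

lemma single_split: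
  assumes "Poly_Mapping.lookup m s > 0"
  obtains n where "m = Poly_Mapping.single s (1::nat) + n"
proof
  show "m = Poly_Mapping.single s 1 + (m - Poly_Mapping.single s 1)"
    using assms by (intro poly_mapping_eqI) (auto simp: lookup_add lookup_minus lookup_single when_def)
qed

lemma mono_elem_comp_cancel:
  fixes m n :: "('i + 'j) \<Rightarrow>\<^sub>0 nat"
  assumes fin: "finite I" "finite J"
  shows "i \<in> I \<Longrightarrow> m = Poly_Mapping.single (Inl i) 1 + n \<Longrightarrow>
      mono_elem m \<in> (sym_comp I J (Suc d) e :: ('i, 'j, 'a::field) sym_alg set) \<Longrightarrow>
      mono_elem n \<in> (sym_comp I J d e :: ('i, 'j, 'a) sym_alg set)"
    and "j \<in> J \<Longrightarrow> m = Poly_Mapping.single (Inr j) 1 + n \<Longrightarrow>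
      mono_elem m \<in> (sym_comp I J d (Suc e) :: ('i, 'j, 'a) sym_alg set) \<Longrightarrow>
      mono_elem n \<in> (sym_comp I J d e :: ('i, 'j, 'a) sym_alg set)"
proof -
  have keys: "Poly_Mapping.keys n \<subseteq> Poly_Mapping.keys (Poly_Mapping.single s 1 + n)" for s
    by (auto simp: in_keys_iff lookup_add)
  show "i \<in> I \<Longrightarrow> m = Poly_Mapping.single (Inl i) 1 + n \<Longrightarrow>
      mono_elem m \<in> (sym_comp I J (Suc d) e :: ('i, 'j, 'a::field) sym_alg set) \<Longrightarrow>
      mono_elem n \<in> (sym_comp I J d e :: ('i, 'j, 'a) sym_alg set)"
    using fin keys[of "Inl i"] by (simp add: mono_elem_comp lookup_add lookup_single when_def sum.distrib) blast
  show "j \<in> J \<Longrightarrow> m = Poly_Mapping.single (Inr j) 1 + n \<Longrightarrow>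
      mono_elem m \<in> (sym_comp I J d (Suc e) :: ('i, 'j, 'a) sym_alg set) \<Longrightarrow>
      mono_elem n \<in> (sym_comp I J d e :: ('i, 'j, 'a) sym_alg set)"
    using fin keys[of "Inr j"] by (simp add: mono_elem_comp lookup_add lookup_single when_def sum.distrib) blast
qed

lemma comp_split_left:
  assumes fin: "finite I" "finite J" and m: "mono_elem m \<in> (sym_comp I J (Suc d) e :: ('i, 'j, 'a::field) sym_alg set)"
  obtains i n where "i \<in> I" "m = Poly_Mapping.single (Inl i) 1 + n"
    "mono_elem n \<in> (sym_comp I J d e :: ('i, 'j, 'a) sym_alg set)"
proof -
  have "(\<Sum>i\<in>I. Poly_Mapping.lookup m (Inl i)) > 0" using m by (simp add: mono_elem_comp)
  then obtain i where i: "i \<in> I" "Poly_Mapping.lookup m (Inl i) > 0"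
    by (metis (no_types, lifting) not_gr_zero sum.neutral)
  obtain n where n: "m = Poly_Mapping.single (Inl i) 1 + n" using single_split[OF i(2)] .
  show ?thesis using that[OF i(1) n mono_elem_comp_cancel(1)[OF fin i(1) n m]] .
qed

lemma comp_split_right:
  assumes fin: "finite I" "finite J" and m: "mono_elem m \<in> (sym_comp I J d (Suc e) :: ('i, 'j, 'a::field) sym_alg set)"
  obtains j n where "j \<in> J" "m = Poly_Mapping.single (Inr j) 1 + n"
    "mono_elem n \<in> (sym_comp I J d e :: ('i, 'j, 'a) sym_alg set)"
proof -
  have "(\<Sum>j\<in>J. Poly_Mapping.lookup m (Inr j)) > 0" using m by (simp add: mono_elem_comp)
  then obtain j where j: "j \<in> J" "Poly_Mapping.lookup m (Inr j) > 0"
    by (metis (no_types, lifting) not_gr_zero sum.neutral)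
  obtain n where n: "m = Poly_Mapping.single (Inr j) 1 + n" using single_split[OF j(2)] .
  show ?thesis using that[OF j(1) n mono_elem_comp_cancel(2)[OF fin j(1) n m]] .
qed

lemma linear_form_zeroI_left:
  fixes L :: "('i, 'j, 'a::field) sym_alg \<Rightarrow> 'a"
  assumes "finite I" "finite J" "linear_form L"
    and "\<And>i F. i \<in> I \<Longrightarrow> F \<in> sym_comp I J d e \<Longrightarrow> L (sym_var (Inl i) * F) = 0"
    and F: "F \<in> sym_comp I J (Suc d) e"
  shows "L F = 0"
proof (rule linear_form_eqI[of L "\<lambda>_. 0", OF assms(3) _ F])
  fix m assume "mono_elem m \<in> (sym_comp I J (Suc d) e :: ('i, 'j, 'a) sym_alg set)"
  with assms(1,2) obtain i n where "i \<in> I" "m = Poly_Mapping.single (Inl i) 1 + n"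
    "mono_elem n \<in> (sym_comp I J d e :: ('i, 'j, 'a) sym_alg set)" by (rule comp_split_left)
  thus "L (mono_elem m) = 0" using assms(4)[of i "mono_elem n"] by (simp add: sym_var_mono)
qed (simp add: linear_form_def)

lemma linear_form_zeroI_right:
  fixes L :: "('i, 'j, 'a::field) sym_alg \<Rightarrow> 'a"
  assumes "finite I" "finite J" "linear_form L"
    and "\<And>j F. j \<in> J \<Longrightarrow> F \<in> sym_comp I J d e \<Longrightarrow> L (sym_var (Inr j) * F) = 0"
    and F: "F \<in> sym_comp I J d (Suc e)"
  shows "L F = 0"
proof (rule linear_form_eqI[of L "\<lambda>_. 0", OF assms(3) _ F])
  fix m assume "mono_elem m \<in> (sym_comp I J d (Suc e) :: ('i, 'j, 'a) sym_alg set)"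
  with assms(1,2) obtain i n where "i \<in> J" "m = Poly_Mapping.single (Inr i) 1 + n"
    "mono_elem n \<in> (sym_comp I J d e :: ('i, 'j, 'a) sym_alg set)" by (rule comp_split_right)
  thus "L (mono_elem m) = 0" using assms(4)[of i "mono_elem n"] by (simp add: sym_var_mono)
qed (simp add: linear_form_def)

text \<open>A monomial of bidegree \<open>(d + 1, e + 1)\<close> contains variables of both sides.
  Two of its quotients by left variables are therefore compared through a quotient by a right
  variable, which makes the prescribed values of \<open>L\<close> consistent.\<close>

lemma cross_relation_common_extension:
  fixes LA :: "'i \<Rightarrow> ('i, 'j, 'a::field) sym_alg \<Rightarrow> 'a" and LB :: "'j \<Rightarrow> ('i, 'j, 'a) sym_alg \<Rightarrow> 'a"
  assumes fin: "finite I" "finite J"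
    and LA: "\<And>i. i \<in> I \<Longrightarrow> linear_form (LA i)" and LB: "\<And>j. j \<in> J \<Longrightarrow> linear_form (LB j)"
    and cross: "\<And>i j F. i \<in> I \<Longrightarrow> j \<in> J \<Longrightarrow> F \<in> sym_comp I J d e \<Longrightarrow>
      LA i (sym_var (Inr j) * F) = LB j (sym_var (Inl i) * F)"
  obtains L where "linear_form L"
    "\<And>i F. i \<in> I \<Longrightarrow> F \<in> sym_comp I J d (e + 1) \<Longrightarrow> L (sym_var (Inl i) * F) = LA i F"
    "\<And>j F. j \<in> J \<Longrightarrow> F \<in> sym_comp I J (d + 1) e \<Longrightarrow> L (sym_var (Inr j) * F) = LB j F"
proof -
  let ?S = "sym_comp I J :: nat \<Rightarrow> nat \<Rightarrow> ('i, 'j, 'a) sym_alg set"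
  let ?a = "\<lambda>i. Poly_Mapping.single (Inl i) 1 :: ('i + 'j) \<Rightarrow>\<^sub>0 nat"
  let ?b = "\<lambda>j. Poly_Mapping.single (Inr j) 1 :: ('i + 'j) \<Rightarrow>\<^sub>0 nat"
  \<comment> \<open>The two quotients share a factor \<open>l\<close> of bidegree
    \<open>(d, e)\<close>, to which \<open>cross\<close> applies.\<close>
  have eq: "LA i (mono_elem n) = LB j (mono_elem n')"
    if ij: "i \<in> I" "j \<in> J" "?a i + n = ?b j + n'" and n: "mono_elem n \<in> ?S d (e + 1)" for i j n n'
  proof -
    have "Poly_Mapping.lookup (?a i + n) (Inr j) > 0" unfolding ij(3) by (simp add: lookup_add)
    hence "Poly_Mapping.lookup n (Inr j) > 0" by (simp add: lookup_add lookup_single)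
    then obtain l where l: "n = ?b j + l" by (rule single_split)
    have "?b j + (?a i + l) = ?b j + n'" using ij(3) by (simp add: l add_ac)
    hence l': "n' = ?a i + l" by simp
    have "mono_elem l \<in> ?S d e"
      by (rule mono_elem_comp_cancel(2)[OF fin ij(2) l]) (use n in simp)
    from cross[OF ij(1,2) this] show ?thesis by (simp add: l l' sym_var_mono)
  qed
  \<comment> \<open>Any left variable dividing \<open>m\<close> may be chosen; independence of the
    choice follows from \<open>eq\<close> by way of \<open>\<mu>b\<close>.\<close>
  define \<mu> where "\<mu> m = (SOME c. \<exists>i\<in>I. \<exists>n. m = ?a i + n \<and> c = LA i (mono_elem n))" for m
  have \<mu>: "\<exists>i'\<in>I. \<exists>n'. ?a i + n = ?a i' + n' \<and> \<mu> (?a i + n) = LA i' (mono_elem n')" if "i \<in> I" for i n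
    unfolding \<mu>_def by (rule someI_ex) (use that in blast)
  have \<mu>b: "\<mu> (?b j + n') = LB j (mono_elem n')"
    if j: "j \<in> J" and n': "mono_elem n' \<in> ?S (d + 1) e" for j n'
  proof -
    obtain i l where l: "i \<in> I" "n' = ?a i + l" "mono_elem l \<in> ?S d e"
      by (rule comp_split_left[OF fin n'[folded Suc_eq_plus1]])
    have "?b j + n' = ?a i + (?b j + l)" by (simp add: l add_ac)
    then obtain i' n where n: "i' \<in> I" "?b j + n' = ?a i' + n" "\<mu> (?b j + n') = LA i' (mono_elem n)"
      using \<mu>[OF l(1), of "?b j + l"] by auto
    have "mono_elem (?a i' + n) \<in> ?S (Suc d) (e + 1)"
      unfolding n(2)[symmetric] using sym_var_mult_comp(2)[OF fin n' j] by (simp add: sym_var_mono)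
    hence "mono_elem n \<in> ?S d (e + 1)" by (rule mono_elem_comp_cancel(1)[OF fin n(1) refl])
    thus ?thesis using eq[of i' j n n'] n j by simp
  qed
  have \<mu>a: "\<mu> (?a i + n) = LA i (mono_elem n)" if i: "i \<in> I" "mono_elem n \<in> ?S d (e + 1)" for i n
  proof -
    obtain j l where l: "j \<in> J" "n = ?b j + l" "mono_elem l \<in> ?S d e"
      by (rule comp_split_right[OF fin i(2)[folded Suc_eq_plus1]])
    have "mono_elem (?a i + l) \<in> ?S (d + 1) e"
      using sym_var_mult_comp(1)[OF fin l(3) i(1)] by (simp add: sym_var_mono)
    hence "\<mu> (?b j + (?a i + l)) = LB j (mono_elem (?a i + l))" by (rule \<mu>b[OF l(1)])
    moreover have "?b j + (?a i + l) = ?a i + n" by (simp add: l add_ac)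
    ultimately show ?thesis using eq[of i j n "?a i + l"] i l by (simp add: add_ac)
  qed
  obtain L :: "('i, 'j, 'a) sym_alg \<Rightarrow> 'a" where L: "linear_form L" "\<And>m. L (mono_elem m) = \<mu> m"
    using linear_form_ex[of \<mu>] by blast
  show ?thesis
  proof (rule that[OF L(1)])
    fix i F assume i: "i \<in> I" and F: "F \<in> ?S d (e + 1)"
    show "L (sym_var (Inl i) * F) = LA i F"
      by (rule linear_form_eqI[OF linear_form_mult[OF L(1)] LA[OF i] F])
        (use \<mu>a[OF i] in \<open>simp only: sym_var_mono L\<close>)
  next
    fix j F assume j: "j \<in> J" and F: "F \<in> ?S (d + 1) e"
    show "L (sym_var (Inr j) * F) = LB j F"
      by (rule linear_form_eqI[OF linear_form_mult[OF L(1)] LB[OF j] F])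
        (use \<mu>b[OF j] in \<open>simp only: sym_var_mono L\<close>)
  qed
qed

lemma linear_form_minus: "linear_form L \<Longrightarrow> L (- F) = - L F"
  using linear_form_add[of L F "- F"] by (simp add: linear_form_0 eq_neg_iff_add_eq_0 add.commute)

lemma power_sum_eq_0:
  fixes c :: "nat \<Rightarrow> 'a::{idom,infinite}"
  assumes "\<And>t. (\<Sum>i\<le>n. t ^ i * c i) = 0" "i \<le> n"
  shows "c i = 0"
proof -
  have "(\<Sum>i\<le>n. Polynomial.monom (c i) i) = 0"
    by (rule poly_eqI_infinite[of "{}"]) (use assms(1) in \<open>simp_all add: poly_sum poly_monom mult.commute\<close>)
  hence "Polynomial.coeff (\<Sum>i\<le>n. Polynomial.monom (c i) i) i = 0" by simp
  thus ?thesis using assms(2) by (simp add: coeff_sum if_distrib cong: if_cong)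
qed

lemma vd_power: "vd s i (\<lambda>\<zeta>. \<zeta> s ^ i :: 'a::{idom,infinite})"
proof -
  have "uni s (\<lambda>\<zeta>. \<zeta> s ^ i :: 'a) \<zeta> = Polynomial.monom 1 i" for \<zeta>
    by (rule uni_eqI) (simp add: poly_monom)
  thus ?thesis by (simp add: vd_def degree_monom_eq)
qed

lemma pderiv_sum: "pderiv (\<Sum>i\<in>T. f i) = (\<Sum>i\<in>T. pderiv (f i))"
  by (induction T rule: infinite_finite_induct) (simp_all add: pderiv_add)

section \<open>Products of points on the two rational normal curves\<close>

locale generating =
  fixes u v :: nat
begin

abbreviation S :: "nat \<Rightarrow> nat \<Rightarrow> (nat, nat, 'a::{field,infinite}) sym_alg set"
  where "S \<equiv> sym_comp {0..u} {0..v}"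

text \<open>The sum type now labels points, not coordinates. Only the side of a label matters, so
  points with labels of the same side are interchangeable; this is the source of all
  symmetries.\<close>

definition dg :: "nat + nat \<Rightarrow> nat" where "dg = case_sum (\<lambda>_. u) (\<lambda>_. v)"

definition var :: "nat + nat \<Rightarrow> nat \<Rightarrow> (nat, nat, 'a::{field,infinite}) sym_alg"
  where "var s i = (case s of Inl _ \<Rightarrow> sym_var (Inl i) | Inr _ \<Rightarrow> sym_var (Inr i))"

lemma dg_simps [simp]: "dg (Inl k) = u" "dg (Inr k) = v" by (simp_all add: dg_def)
lemma var_simps: "var (Inl k) i = sym_var (Inl i)" "var (Inr k) i = sym_var (Inr i)" by (simp_all add: var_def)

definition lin :: "nat + nat \<Rightarrow> 'a \<Rightarrow> (nat, nat, 'a::{field,infinite}) sym_alg"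
  where "lin s t = (\<Sum>i\<le>dg s. sym_scale (t ^ i) (var s i))"

text \<open>The factor \<open>c\<close> fills up the bidegree that the points in \<open>T\<close>
  leave over.\<close>

definition prd :: "(nat, nat, 'a::{field,infinite}) sym_alg \<Rightarrow> (nat + nat) set \<Rightarrow> (nat + nat \<Rightarrow> 'a) \<Rightarrow> (nat, nat, 'a) sym_alg"
  where "prd c T \<zeta> = (\<Prod>s\<in>T. lin s (\<zeta> s)) * c"

lemma linear_form_lin:
  assumes "linear_form L"
  shows "L (lin s t * F) = (\<Sum>i\<le>dg s. t ^ i * L (var s i * F))"
  by (simp add: lin_def sum_distrib_right sym_scale_simps linear_form_sum[OF assms] linear_form_scale[OF assms])

lemma prd_remove: "finite T \<Longrightarrow> s \<in> T \<Longrightarrow> prd c T \<zeta> = lin s (\<zeta> s) * prd c (T - {s}) \<zeta>"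
  by (simp add: prd_def prod.remove mult.assoc)

lemma prd_cong: "(\<And>s. s \<in> T \<Longrightarrow> \<zeta> s = \<xi> s) \<Longrightarrow> prd c T \<zeta> = prd c T \<xi>"
  by (simp add: prd_def)

lemma linear_form_prd_remove:
  assumes "linear_form L" "finite T" "s \<in> T"
  shows "L (prd c T \<zeta>) = (\<Sum>i\<le>dg s. \<zeta> s ^ i * L (var s i * prd c (T - {s}) \<zeta>))"
  unfolding prd_remove[OF assms(2,3)] by (rule linear_form_lin[OF assms(1)])

lemma PF_prd:
  assumes "finite T" "linear_form L" "T \<subseteq> A"
  shows "PF A (\<lambda>\<zeta>. L (prd c T \<zeta>))"
  using assms
proof (induction T arbitrary: L rule: finite_induct)
  case empty
  show ?case by (simp add: prd_def)
next
  case (insert s T)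
  have "(\<lambda>\<zeta>. L (prd c (insert s T) \<zeta>)) = (\<lambda>\<zeta>. \<Sum>i\<le>dg s. \<zeta> s ^ i * L (var s i * prd c T \<zeta>))"
    using linear_form_prd_remove[OF insert.prems(1), of "insert s T" s] insert.hyps by auto
  moreover have "PF A \<dots>"
    by (intro PF_sum PF_mult PF_power PF_var insert.IH linear_form_mult insert.prems) (use insert.prems in auto)
  ultimately show ?case by simp
qed

lemma vd_prd:
  assumes "finite T" "s \<in> T" "linear_form L"
  shows "vd s (dg s) (\<lambda>\<zeta>. L (prd c T \<zeta>))"
  unfolding linear_form_prd_remove[OF assms(3,1,2)]
proof (rule vd_sum[of _ T])
  have pf: "PF T (\<lambda>\<zeta>. L (var s i * prd c (T - {s}) \<zeta>))"
    "PF (T - {s}) (\<lambda>\<zeta>. L (var s i * prd c (T - {s}) \<zeta>))" for i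
    by (rule PF_prd[OF _ linear_form_mult[OF assms(3)]]; use assms in auto)+
  have pw: "PF T (\<lambda>\<zeta>. \<zeta> s ^ i)" for i
    by (intro PF_power PF_var assms(2))
  fix i
  show "PF T (\<lambda>\<zeta>. \<zeta> s ^ i * L (var s i * prd c (T - {s}) \<zeta>))"
    by (rule PF_mult[OF pw pf(1)])
  assume "i \<in> {..dg s}"
  have "vd s (i + 0) (\<lambda>\<zeta>. \<zeta> s ^ i * L (var s i * prd c (T - {s}) \<zeta>))"
    by (rule vd_mult[OF pw pf(1) vd_power vd_notin[OF pf(2)]]) simp
  thus "vd s (dg s) (\<lambda>\<zeta>. \<zeta> s ^ i * L (var s i * prd c (T - {s}) \<zeta>))"
    by (rule vd_mono) (use \<open>i \<in> {..dg s}\<close> in simp)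
qed

lemma prd_transpose:
  fixes c :: "(nat, nat, 'a::{field,infinite}) sym_alg"
  assumes "s \<in> T" "t \<in> T" "dg s = dg t" "var s = (var t :: nat \<Rightarrow> (nat, nat, 'a) sym_alg)"
  shows "prd c T (\<zeta> \<circ> transpose s t) = prd c T \<zeta>"
proof -
  have "lin s = (lin t :: 'a \<Rightarrow> _)" by (rule ext) (simp only: lin_def assms(3,4))
  hence "lin x (\<zeta> (transpose s t x)) = lin (transpose s t x) (\<zeta> (transpose s t x))" for x
    by (simp add: transpose_def)
  hence "(\<Prod>x\<in>T. lin x (\<zeta> (transpose s t x))) = (\<Prod>x\<in>T. lin x (\<zeta> x))"
    using assms(1,2) by (intro prod.reindex_bij_witness[of T "transpose s t" "transpose s t"])
      (auto simp: transpose_def)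
  thus ?thesis by (simp add: prd_def)
qed

lemma lin_comp:
  "F \<in> S d e \<Longrightarrow> lin (Inl k) t * F \<in> S (d + 1) e"
  "F \<in> S d e \<Longrightarrow> lin (Inr k) t * F \<in> S d (e + 1)"
proof -
  interpret A: vector_space "sym_scale :: 'a \<Rightarrow> (nat, nat, 'a) sym_alg \<Rightarrow> _" by (rule vector_space_scales)
  note sub = subspace_sym_comp[of "{0..u}" "{0..v}", where 'a = 'a]
  show "F \<in> S d e \<Longrightarrow> lin (Inl k) t * F \<in> S (d + 1) e"
    unfolding lin_def sum_distrib_right sym_scale_simps var_simps
    by (intro A.subspace_sum[OF sub] A.subspace_scale[OF sub] sym_var_mult_comp) auto
  show "F \<in> S d e \<Longrightarrow> lin (Inr k) t * F \<in> S d (e + 1)"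
    unfolding lin_def sum_distrib_right sym_scale_simps var_simps
    by (intro A.subspace_sum[OF sub] A.subspace_scale[OF sub] sym_var_mult_comp) auto
qed

abbreviation lc where "lc T \<equiv> card (T \<inter> range Inl)"
abbreviation rc where "rc T \<equiv> card (T \<inter> range Inr)"

lemma lc_rc_insert:
  "finite T \<Longrightarrow> Inl k \<notin> T \<Longrightarrow> lc (insert (Inl k) T) = lc T + 1"
  "lc (insert (Inr k) T) = lc T"
  "finite T \<Longrightarrow> Inr k \<notin> T \<Longrightarrow> rc (insert (Inr k) T) = rc T + 1"
  "rc (insert (Inl k) T) = rc T"
proof -
  have "insert (Inl k) T \<inter> range Inl = insert (Inl k) (T \<inter> range Inl)"
    "insert (Inr k) T \<inter> range Inl = T \<inter> range Inl"
    "insert (Inr k) T \<inter> range Inr = insert (Inr k) (T \<inter> range Inr)"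
    "insert (Inl k) T \<inter> range Inr = T \<inter> range Inr" by auto
  thus "finite T \<Longrightarrow> Inl k \<notin> T \<Longrightarrow> lc (insert (Inl k) T) = lc T + 1"
    "lc (insert (Inr k) T) = lc T"
    "finite T \<Longrightarrow> Inr k \<notin> T \<Longrightarrow> rc (insert (Inr k) T) = rc T + 1"
    "rc (insert (Inl k) T) = rc T" by simp_all
qed

lemma prd_comp:
  assumes "finite T" "c \<in> S d e"
  shows "prd c T \<zeta> \<in> S (d + lc T) (e + rc T)"
  using assms(1)
proof (induction T rule: finite_induct)
  case empty
  show ?case using assms(2) by (simp add: prd_def)
next
  case (insert s T)
  have "prd c (insert s T) \<zeta> = lin s (\<zeta> s) * prd c T \<zeta>"
    using insert.hyps prd_remove[of "insert s T" s] by simp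
  thus ?case
    using lin_comp[OF insert.IH] insert.hyps by (cases s) (auto simp: lc_rc_insert add.assoc)
qed

text \<open>Products of points on the two rational normal curves span the symmetric powers of the
  ambient spaces.\<close>

lemma prd_vanish:
  fixes L :: "(nat, nat, 'a::{field,infinite}) sym_alg \<Rightarrow> 'a"
  assumes "finite T" "linear_form L"
    and "\<And>c \<zeta>. c \<in> S d e \<Longrightarrow> L (prd c T \<zeta>) = 0"
    and "F \<in> S (d + lc T) (e + rc T)"
  shows "L F = 0"
  using assms
proof (induction T arbitrary: L F rule: finite_induct)
  case empty
  thus ?case by (simp add: prd_def)
next
  case (insert s T)
  have *: "L (var s i * F') = 0" if i: "i \<le> dg s" and F': "F' \<in> S (d + lc T) (e + rc T)" for i F'
  proof (rule insert.IH[OF linear_form_mult[OF insert.prems(1)] _ F'])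
    fix c :: "(nat, nat, 'a) sym_alg" and \<zeta> assume c: "c \<in> S d e"
    \<comment> \<open>The parameter of the point \<open>s\<close> is free, so the coefficients of
      its powers vanish, which replaces the point by single variables
      \<open>var s i\<close>.\<close>
    have "(\<Sum>i\<le>dg s. t ^ i * L (var s i * prd c T \<zeta>)) = 0" for t
    proof -
      have "prd c T (\<zeta>(s := t)) = prd c T \<zeta>" by (rule prd_cong) (use insert.hyps in auto)
      hence "L (prd c (insert s T) (\<zeta>(s := t))) = (\<Sum>i\<le>dg s. t ^ i * L (var s i * prd c T \<zeta>))"
        using linear_form_prd_remove[OF insert.prems(1), of "insert s T" s c "\<zeta>(s := t)"] insert.hyps by simp
      thus ?thesis using insert.prems(2)[OF c, of "\<zeta>(s := t)"] by (simp only:)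
    qed
    thus "L (var s i * prd c T \<zeta>) = 0" using i by (rule power_sum_eq_0)
  qed
  show ?case
  proof (cases s)
    case (Inl k)
    show ?thesis
      by (rule linear_form_zeroI_left[OF _ _ insert.prems(1), of "{0..u}" "{0..v}" "d + lc T" "e + rc T"])
        (use * insert.prems(3) insert.hyps in \<open>auto simp: Inl lc_rc_insert var_simps\<close>)
  next
    case (Inr k)
    show ?thesis
      by (rule linear_form_zeroI_right[OF _ _ insert.prems(1), of "{0..u}" "{0..v}" "d + lc T" "e + rc T"])
        (use * insert.prems(3) insert.hyps in \<open>auto simp: Inr lc_rc_insert var_simps\<close>)
  qed
qed

end

text \<open>The defects \<open>D i j\<close> on a product of points are the coefficients of
  \<open>H + G\<close> in \<open>x_0\<close> and \<open>y_0\<close>. The relations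
  \<open>rel0\<close> and \<open>rel1\<close> say that \<open>H + G\<close> and its derivative in
  \<open>x_0\<close> vanish for \<open>x_0 = y_0\<close>.\<close>

theorem cross_relation:
  fixes LA LB :: "nat \<Rightarrow> (nat, nat, 'a::{field,infinite}) sym_alg \<Rightarrow> 'a"
  assumes uv: "u \<ge> 1" "v \<ge> 1" and de: "d \<ge> v" "e \<ge> u"
    and nz: "\<And>n. 0 < n \<Longrightarrow> n \<le> u + v \<Longrightarrow> of_nat n \<noteq> (0 :: 'a)"
    and LA: "\<And>i. linear_form (LA i)" and LB: "\<And>j. linear_form (LB j)"
    and rel0: "\<And>t F. F \<in> sym_comp {0..u} {0..v} d e \<Longrightarrow>
      (\<Sum>i\<le>u. \<Sum>j\<le>v. t ^ i * t ^ j * (LA i (sym_var (Inr j) * F) - LB j (sym_var (Inl i) * F))) = 0"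
    and rel1: "\<And>t F. F \<in> sym_comp {0..u} {0..v} d e \<Longrightarrow>
      (\<Sum>i\<le>u. \<Sum>j\<le>v. of_nat i * t ^ (i - 1) * t ^ j * (LA i (sym_var (Inr j) * F) - LB j (sym_var (Inl i) * F))) = 0"
    and F: "F \<in> sym_comp {0..u} {0..v} d e" and ij: "i \<le> u" "j \<le> v"
  shows "LA i (sym_var (Inr j) * F) = LB j (sym_var (Inl i) * F)"
proof -
  interpret generating u v .
  define A where "A = Inl ` {..v} \<union> Inr ` {..u :: nat}"
  define T where "T = A - {Inl 0, Inr 0}"
  define D where "D i j F = LA i (sym_var (Inr j) * F) - LB j (sym_var (Inl i) * F)" for i j F
  have linD: "linear_form (D i j)" for i j
    unfolding D_def[abs_def] by (intro linear_form_diff linear_form_mult LA LB)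
  have fin: "finite A" "finite T" "finite (A - {s})" for s by (auto simp: A_def T_def)
  have "T \<inter> range Inl = Inl ` {1..v}" "T \<inter> range Inr = Inr ` {1..u}" by (auto simp: T_def A_def)
  hence card: "lc T = v" "rc T = u" by (simp_all add: card_image)
  \<comment> \<open>The \<open>v\<close> left and \<open>u\<close> right points of \<open>T\<close>
    together with \<open>c\<close> make up bidegree \<open>(d, e)\<close>; this is where
    \<open>d \<ge> v\<close> and \<open>e \<ge> u\<close> enter.\<close>
  have key: "D i j (prd c T \<zeta>) = 0"
    if c: "c \<in> S (d - v) (e - u)" and ij: "i \<le> u" "j \<le> v" for c \<zeta> i j
  proof -
    \<comment> \<open>The point removed from the product is the one whose symmetry is lost:
      \<open>x_0\<close> for \<open>H\<close>, \<open>y_0\<close> for \<open>G\<close>.\<close>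
    define H where "H \<zeta> = (\<Sum>i\<le>u. \<zeta> (Inl 0) ^ i * LA i (prd c (A - {Inl 0}) \<zeta>))" for \<zeta>
    define G where "G \<zeta> = - (\<Sum>j\<le>v. \<zeta> (Inr 0) ^ j * LB j (prd c (A - {Inr 0}) \<zeta>))" for \<zeta>
    have T_eq: "T = A - {Inl 0} - {Inr 0}" "T = A - {Inr 0} - {Inl 0}" by (auto simp: T_def)
    have HG: "H \<zeta> + G \<zeta> = (\<Sum>i\<le>u. \<Sum>j\<le>v. \<zeta> (Inl 0) ^ i * \<zeta> (Inr 0) ^ j * D i j (prd c T \<zeta>))" for \<zeta>
    proof -
      have "H \<zeta> = (\<Sum>i\<le>u. \<Sum>j\<le>v. \<zeta> (Inl 0) ^ i * \<zeta> (Inr 0) ^ j * LA i (sym_var (Inr j) * prd c T \<zeta>))"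
        unfolding H_def
      proof (intro sum.cong refl)
        fix i
        have "LA i (prd c (A - {Inl 0}) \<zeta>) = (\<Sum>j\<le>v. \<zeta> (Inr 0) ^ j * LA i (sym_var (Inr j) * prd c T \<zeta>))"
          using linear_form_prd_remove[OF LA fin(3), of "Inr 0" "Inl 0" i c \<zeta>]
          by (simp add: T_eq(1) A_def var_simps)
        thus "\<zeta> (Inl 0) ^ i * LA i (prd c (A - {Inl 0}) \<zeta>) =
            (\<Sum>j\<le>v. \<zeta> (Inl 0) ^ i * \<zeta> (Inr 0) ^ j * LA i (sym_var (Inr j) * prd c T \<zeta>))"
          by (simp add: sum_distrib_left mult.assoc)
      qed
      moreover have "G \<zeta> = - (\<Sum>j\<le>v. \<Sum>i\<le>u. \<zeta> (Inl 0) ^ i * \<zeta> (Inr 0) ^ j * LB j (sym_var (Inl i) * prd c T \<zeta>))"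
        unfolding G_def
      proof (intro sum.cong refl arg_cong[of _ _ uminus])
        fix j
        have "LB j (prd c (A - {Inr 0}) \<zeta>) = (\<Sum>i\<le>u. \<zeta> (Inl 0) ^ i * LB j (sym_var (Inl i) * prd c T \<zeta>))"
          using linear_form_prd_remove[OF LB fin(3), of "Inl 0" "Inr 0" j c \<zeta>]
          by (simp add: T_eq(2) A_def var_simps)
        thus "\<zeta> (Inr 0) ^ j * LB j (prd c (A - {Inr 0}) \<zeta>) =
            (\<Sum>i\<le>u. \<zeta> (Inl 0) ^ i * \<zeta> (Inr 0) ^ j * LB j (sym_var (Inl i) * prd c T \<zeta>))"
          by (simp add: sum_distrib_left mult_ac)
      qed
      ultimately show ?thesis
        by (subst (asm) (2) sum.swap) (simp add: D_def right_diff_distrib sum_subtractf)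
    qed
    have PT: "prd c T \<zeta> \<in> S d e" for \<zeta>
      using prd_comp[OF fin(2) c, of \<zeta>] de by (simp add: card)
    have pfterm: "PF A (\<lambda>\<zeta>. \<zeta> s ^ i * L (prd c (A - {s}) \<zeta>))"
      if "s \<in> A" "linear_form L" for s i and L :: "(nat, nat, 'a) sym_alg \<Rightarrow> 'a"
      using that by (intro PF_mult PF_power PF_var PF_prd fin) auto
    have vdterm: "vd k (dg k) (\<lambda>\<zeta>. \<zeta> s ^ i * L (prd c (A - {s}) \<zeta>))"
      if "s \<in> A" "linear_form L" "i \<le> dg s" "k \<in> A" for s i k and L :: "(nat, nat, 'a) sym_alg \<Rightarrow> 'a"
    proof -
      have pf: "PF A (\<lambda>\<zeta>. \<zeta> s ^ i)" "PF A (\<lambda>\<zeta>. L (prd c (A - {s}) \<zeta>))"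
        "PF (A - {s}) (\<lambda>\<zeta>. L (prd c (A - {s}) \<zeta>))" "PF {s} (\<lambda>\<zeta>. \<zeta> s ^ i :: 'a)"
        using that by (auto intro!: PF_power PF_var PF_prd fin)
      show ?thesis
      proof (cases "k = s")
        case True
        have "vd k (i + 0) (\<lambda>\<zeta>. \<zeta> s ^ i * L (prd c (A - {s}) \<zeta>))"
          unfolding True by (rule vd_mult[OF pf(1,2) vd_power vd_notin[OF pf(3)]]) simp
        thus ?thesis by (rule vd_mono) (use that True in simp)
      next
        case False
        have "vd k (0 + dg k) (\<lambda>\<zeta>. \<zeta> s ^ i * L (prd c (A - {s}) \<zeta>))"
          by (rule vd_mult[OF pf(1,2) vd_notin[OF pf(4)] vd_prd[OF fin(3) _ that(2)]]) (use that False in auto)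
        thus ?thesis by simp
      qed
    qed
    have A0: "Inl 0 \<in> A" "Inr 0 \<in> A" by (auto simp: A_def)
    have PFH: "PF A H" unfolding H_def[abs_def] by (intro PF_sum pfterm A0 LA)
    have PFG: "PF A G" unfolding G_def[abs_def] by (intro PF_minus PF_sum pfterm A0 LB)
    have vd: "vd k (dg k) (\<lambda>\<zeta>. H \<zeta> + G \<zeta>)" if "k \<in> A" for k
    proof (rule vd_add[OF PFH PFG])
      show "vd k (dg k) H"
        unfolding H_def[abs_def] by (rule vd_sum[of _ A], (rule pfterm vdterm; use A0 LA that in simp)+)
      have "PF A (\<lambda>\<zeta>. \<Sum>j\<le>v. \<zeta> (Inr 0) ^ j * LB j (prd c (A - {Inr 0}) \<zeta>))"
        by (intro PF_sum pfterm A0 LB)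
      moreover have "vd k (dg k) (\<lambda>\<zeta>. \<Sum>j\<le>v. \<zeta> (Inr 0) ^ j * LB j (prd c (A - {Inr 0}) \<zeta>))"
        by (rule vd_sum[of _ A], (rule pfterm vdterm; use A0 LB that in simp)+)
      ultimately show "vd k (dg k) G"
        unfolding G_def[abs_def] vd_def by (simp add: uni_minus[of A])
    qed
    have symH: "sw s t H = H" if "s \<in> A - {Inl 0}" "t \<in> A - {Inl 0}" "dg s = dg t" "var s = (var t :: nat \<Rightarrow> (nat, nat, 'a) sym_alg)" for s t
    proof
      fix \<zeta> :: "nat + nat \<Rightarrow> 'a"
      have "(\<zeta> \<circ> transpose s t) (Inl 0) = \<zeta> (Inl 0)" using that by (auto simp: transpose_def)
      thus "sw s t H \<zeta> = H \<zeta>" by (simp only: sw_def H_def prd_transpose[OF that])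
    qed
    have symG: "sw s t G = G" if "s \<in> A - {Inr 0}" "t \<in> A - {Inr 0}" "dg s = dg t" "var s = (var t :: nat \<Rightarrow> (nat, nat, 'a) sym_alg)" for s t
    proof
      fix \<zeta> :: "nat + nat \<Rightarrow> 'a"
      have "(\<zeta> \<circ> transpose s t) (Inr 0) = \<zeta> (Inr 0)" using that by (auto simp: transpose_def)
      thus "sw s t G \<zeta> = G \<zeta>" by (simp only: sw_def G_def prd_transpose[OF that])
    qed
    have "H \<zeta> + G \<zeta> = 0" for \<zeta>
    proof (rule double_vanishing.h_zero[of u v H G])
      show "double_vanishing u v H G"
      proof (rule double_vanishing.intro)
        fix \<zeta> :: "nat + nat \<Rightarrow> 'a" assume \<zeta>: "\<zeta> (Inl 0) = \<zeta> (Inr 0)"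
        show "H \<zeta> + G \<zeta> = 0"
          using rel0[OF PT, of "\<zeta> (Inr 0)" \<zeta>] by (simp add: HG \<zeta> D_def)
        \<comment> \<open>The product over \<open>T\<close> does not involve \<open>x_0\<close>, so
          only the explicit powers are differentiated, which gives the shape of
          \<open>rel1\<close>.\<close>
        have "uni (Inl 0) (\<lambda>\<zeta>. H \<zeta> + G \<zeta>) \<zeta> =
            (\<Sum>i\<le>u. Polynomial.monom (\<Sum>j\<le>v. \<zeta> (Inr 0) ^ j * D i j (prd c T \<zeta>)) i)"
        proof (rule uni_eqI)
          fix t
          have "prd c T (\<zeta>(Inl 0 := t)) = prd c T \<zeta>" by (rule prd_cong) (auto simp: T_def)
          thus "poly (\<Sum>i\<le>u. Polynomial.monom (\<Sum>j\<le>v. \<zeta> (Inr 0) ^ j * D i j (prd c T \<zeta>)) i) t =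
              H (\<zeta>(Inl 0 := t)) + G (\<zeta>(Inl 0 := t))"
            by (simp add: HG poly_sum poly_monom sum_distrib_left sum_distrib_right mult_ac)
        qed
        thus "der (Inl 0) (\<lambda>\<zeta>. H \<zeta> + G \<zeta>) \<zeta> = 0"
          using rel1[OF PT, of "\<zeta> (Inr 0)" \<zeta>]
          by (simp add: der_def pderiv_sum pderiv_monom poly_sum poly_monom \<zeta> D_def sum_distrib_left
              sum_distrib_right mult_ac)
      next
        show "PF (Inl ` {..v} \<union> Inr ` {..u}) H" "PF (Inl ` {..v} \<union> Inr ` {..u}) G"
          using PFH PFG unfolding A_def .
        show "u \<ge> 1" "v \<ge> 1" by fact+
        show "of_nat n \<noteq> (0 :: 'a)" if "0 < n" "n \<le> u + v" for n using that by (rule nz)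
        show "sw (Inl i) (Inl j) H = H" if "i \<in> {1..v}" "j \<in> {1..v}" for i j
          by (rule symH) (use that in \<open>auto simp: A_def fun_eq_iff var_simps\<close>)
        show "sw (Inr i) (Inr j) H = H" if "i \<in> {..u}" "j \<in> {..u}" for i j
          by (rule symH) (use that in \<open>auto simp: A_def fun_eq_iff var_simps\<close>)
        show "sw (Inl i) (Inl j) G = G" if "i \<in> {..v}" "j \<in> {..v}" for i j
          by (rule symG) (use that in \<open>auto simp: A_def fun_eq_iff var_simps\<close>)
        show "sw (Inr i) (Inr j) G = G" if "i \<in> {1..u}" "j \<in> {1..u}" for i j
          by (rule symG) (use that in \<open>auto simp: A_def fun_eq_iff var_simps\<close>)
        show "vd (Inl k) u (\<lambda>\<zeta>. H \<zeta> + G \<zeta>)" if "k \<le> v" for k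
          using vd[of "Inl k"] that by (simp add: A_def)
        show "vd (Inr k) v (\<lambda>\<zeta>. H \<zeta> + G \<zeta>)" if "k \<le> u" for k
          using vd[of "Inr k"] that by (simp add: A_def)
      qed
    qed
    \<comment> \<open>\<open>x_0\<close> and \<open>y_0\<close> may vary freely while the product
      over \<open>T\<close> stays fixed, so the coefficients can be read off.\<close>
    hence "(\<Sum>i\<le>u. s ^ i * (\<Sum>j\<le>v. t ^ j * D i j (prd c T \<zeta>))) = 0" for s t
    proof -
      assume z: "\<And>\<zeta>. H \<zeta> + G \<zeta> = 0"
      have "prd c T (\<zeta>(Inl 0 := s, Inr 0 := t)) = prd c T \<zeta>" by (rule prd_cong) (auto simp: T_def)
      thus ?thesis using z[of "\<zeta>(Inl 0 := s, Inr 0 := t)"]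
        by (simp add: HG sum_distrib_left mult.assoc)
    qed
    hence "(\<Sum>j\<le>v. t ^ j * D i j (prd c T \<zeta>)) = 0" for t
      by (rule power_sum_eq_0) (rule ij)
    thus ?thesis by (rule power_sum_eq_0) (rule ij)
  qed
  have "D i j F = 0"
    by (rule prd_vanish[OF fin(2) linD, of "d - v" "e - u"]) (use key ij F de in \<open>auto simp: card\<close>)
  thus ?thesis by (simp add: D_def)
qed

section \<open>Vanishing of the Weyman module\<close>

text \<open>A basis of \<open>B\<close> stays independent when \<open>x\<close> is added; the
  functional extends the values 0 on the basis and 1 at \<open>x\<close>.\<close>

lemma vanishing_functional:
  assumes "vector_space sc" and B: "module.subspace sc B" and x: "x \<notin> B"
  obtains \<Lambda> :: "'b::ab_group_add \<Rightarrow> 'a::field"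
  where "Vector_Spaces.linear sc (*) \<Lambda>" "\<And>y. y \<in> B \<Longrightarrow> \<Lambda> y = 0" "\<Lambda> x = 1"
proof -
  interpret vs: vector_space sc by fact
  interpret fs: vector_space "(*) :: 'a \<Rightarrow> 'a \<Rightarrow> 'a" by unfold_locales (simp_all add: algebra_simps)
  interpret pair: vector_space_pair sc "(*) :: 'a \<Rightarrow> 'a \<Rightarrow> 'a" ..
  obtain bs where bs: "bs \<subseteq> B" "vs.independent bs" "B \<subseteq> vs.span bs"
    using vs.maximal_independent_subset[of B] by blast
  have span: "vs.span bs = B" using bs vs.span_minimal[OF bs(1) B] by auto
  have "vs.independent (insert x bs)" using bs(2) x by (simp add: vs.independent_insert span)
  from pair.linear_independent_extend[OF this, of "\<lambda>y. if y = x then 1 else 0"]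
  obtain \<Lambda> where \<Lambda>: "Vector_Spaces.linear sc (*) \<Lambda>" "\<forall>y\<in>insert x bs. \<Lambda> y = (if y = x then 1 else 0 :: 'a)"
    by blast
  interpret l: Vector_Spaces.linear sc "(*) :: 'a \<Rightarrow> 'a \<Rightarrow> 'a" \<Lambda> by (rule \<Lambda>(1))
  have "\<Lambda> y = 0" if "y \<in> B" for y
  proof (rule l.eq_0_on_span[of bs])
    show "y \<in> vs.span bs" using that span by simp
    show "\<Lambda> b = 0" if "b \<in> bs" for b using \<Lambda>(2) that x bs(1) by auto
  qed
  moreover have "\<Lambda> x = 1" using \<Lambda>(2) by simp
  ultimately show ?thesis using that \<Lambda>(1) by blast
qed

lemma carrier_quotient_space: "carrier (quotient_space sc Z B) = coset B ` Z"
  by (simp add: quotient_space_def)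

text \<open>Elements of \<open>K\<close> can thus be given by functionals on all of
  \<open>k[x] \<otimes> k[x]\<close>, without mentioning cosets.\<close>

lemma weyman_K_functional:
  fixes \<psi> :: "'a::field poly poly \<Rightarrow> 'a"
  assumes add: "\<And>P Q. \<psi> (P + Q) = \<psi> P + \<psi> Q" and scale: "\<And>c P. \<psi> (scaleU c P) = c * \<psi> P"
    and kill: "\<And>P. P \<in> weyman_im u v \<Longrightarrow> \<psi> P = 0"
  shows "dual_coords u v \<psi> \<in> weyman_K u v"
proof -
  define M where "M = (weyman_Q u v :: ('a, 'a poly poly set) module)"
  interpret sc: vector_space "scaleU :: 'a \<Rightarrow> 'a poly poly \<Rightarrow> _" by (rule vector_space_scaleU)
  interpret iota: Vector_Spaces.linear scaleU scaleU "iota :: 'a poly poly \<Rightarrow> _" by (rule linear_iota)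
  interpret M: module "ring_of_type_algebra :: 'a ring" M unfolding M_def by (rule module_weyman_Q)
  have "sc.subspace (weyman_im u v :: 'a poly poly set)"
    unfolding weyman_im_def symU2_def image_comp[symmetric] by (intro iota.subspace_image sc.subspace_span)
  hence 0: "(0 :: 'a poly poly) \<in> weyman_im u v" by (rule sc.subspace_0)
  \<comment> \<open>The representative is arbitrary, since \<open>\<psi>\<close> is constant on
    cosets of the subspace it kills.\<close>
  define \<phi> where "\<phi> = restrict (\<lambda>C. \<psi> (SOME z. z \<in> C)) (carrier M)"
  have \<phi>: "\<phi> C = \<psi> x" if C: "C \<in> carrier M" and x: "x \<in> C" for C x
  proof -
    obtain z where z: "C = coset (weyman_im u v) z"
      using C by (auto simp: M_def weyman_Q_def carrier_quotient_space)
    have *: "\<psi> y = \<psi> z" if "y \<in> C" for y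
      using that kill by (auto simp: z coset_def add)
    have "\<phi> C = \<psi> (SOME z. z \<in> C)" using C by (simp add: \<phi>_def)
    also have "\<dots> = \<psi> x" using *[of x] *[of "SOME z. z \<in> C"] someI[of "\<lambda>z. z \<in> C", OF x] x by simp
    finally show ?thesis .
  qed
  have ne: "\<exists>x. x \<in> C" if "C \<in> carrier M" for C
    using that 0 by (auto simp: M_def weyman_Q_def carrier_quotient_space coset_def)
  have "\<phi> \<in> dual_space M"
    unfolding dual_space_def
  proof (intro CollectI conjI ballI allI)
    show "\<phi> \<in> extensional (carrier M)" by (simp add: \<phi>_def)
    fix C assume C: "C \<in> carrier M"
    then obtain x where x: "x \<in> C" using ne by blast
    {
      fix D assume D: "D \<in> carrier M"
      then obtain y where y: "y \<in> D" using ne by blast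
      have "x + y \<in> C \<oplus>\<^bsub>M\<^esub> D" using x y by (auto simp: M_def weyman_Q_def quotient_space_def)
      thus "\<phi> (C \<oplus>\<^bsub>M\<^esub> D) = \<phi> C + \<phi> D"
        using \<phi>[OF C x] \<phi>[OF D y] \<phi>[OF M.M.add.m_closed[OF C D]] by (simp add: add)
    }
    fix c :: 'a
    have "scaleU c x + 0 \<in> {scaleU c y + b |y b. y \<in> C \<and> b \<in> weyman_im u v}" using x 0 by blast
    hence "scaleU c x + 0 \<in> c \<odot>\<^bsub>M\<^esub> C"
      by (simp add: M_def weyman_Q_def quotient_space_def)
    moreover have "c \<odot>\<^bsub>M\<^esub> C \<in> carrier M"
      by (rule M.smult_closed[OF _ C]) (simp add: ring_of_type_algebra_def)
    ultimately show "\<phi> (c \<odot>\<^bsub>M\<^esub> C) = c * \<phi> C"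
      using \<phi>[OF C x] \<phi>[of "c \<odot>\<^bsub>M\<^esub> C"] by (simp add: scale)
  qed
  moreover have "dual_coords u v \<psi> = dual_coords u v (\<phi> \<circ> weyman_Psi u v)"
  proof -
    have "\<phi> (weyman_Psi u v (tensorU (Polynomial.monom 1 i) (Polynomial.monom 1 j))) =
        \<psi> (tensorU (Polynomial.monom 1 i) (Polynomial.monom 1 j))" if "i \<le> u" "j \<le> v" for i j
    proof (rule \<phi>)
      have "(Polynomial.monom 1 i :: 'a poly) \<in> symU (int u)" "(Polynomial.monom 1 j :: 'a poly) \<in> symU (int v)"
        using that by (auto simp: symU_def)
      hence "tensorU (Polynomial.monom 1 i) (Polynomial.monom 1 j :: 'a poly) \<in> symU2 (int u) (int v)"
        unfolding symU2_def by (intro sc.span_base) blast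
      thus "weyman_Psi u v (tensorU (Polynomial.monom 1 i) (Polynomial.monom 1 j)) \<in> carrier M"
        by (auto simp: M_def weyman_Q_def carrier_quotient_space weyman_Psi_def)
      show "tensorU (Polynomial.monom 1 i) (Polynomial.monom 1 j) \<in>
          weyman_Psi u v (tensorU (Polynomial.monom 1 i) (Polynomial.monom 1 j :: 'a poly))"
        using 0 by (force simp: weyman_Psi_def coset_def)
    qed
    thus ?thesis by (auto simp: dual_coords_def fun_eq_iff)
  qed
  ultimately show ?thesis unfolding weyman_K_def M_def by blast
qed

lemma tensorU_monom: "tensorU (Polynomial.monom 1 i) (g :: 'a::field poly) = Polynomial.monom g i"
  by (rule poly_eqI) (simp add: tensorU_def coeff_map_poly)

text \<open>With the outer variable \<open>x\<close> and the inner one \<open>y\<close> this is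
  multiplication by \<open>y - x\<close>. Hence \<open>iota \<circ> iota\<close> yields multiples of
  \<open>(y - x)^2\<close>, the origin of the double vanishing.\<close>

lemma iota_eq: "iota P = [:[:0, 1:], - 1:] * P"
  by (simp add: iota_def)

text \<open>Evaluation at \<open>(t, t)\<close> and the derivative in the first factor there both
  kill multiples of \<open>(y - x)^2\<close>; the coordinates are their values on the monomials
  \<open>x^i y^j\<close>.\<close>

lemma weyman_K_point:
  "(\<lambda>(i, j). if i \<le> u \<and> j \<le> v then t ^ i * t ^ j else 0) \<in> weyman_K u v" (is ?point)
  and weyman_K_tangent:
  "(\<lambda>(i, j). if i \<le> u \<and> j \<le> v then of_nat i * t ^ (i - 1) * t ^ j else 0 :: 'a::field) \<in> weyman_K u v" (is ?tangent)
proof -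
  let ?p = "\<lambda>P :: 'a poly poly. poly (poly P [:t:]) t"
  have im: "\<exists>Q. P = iota (iota Q)" if "P \<in> weyman_im u v" for P :: "'a poly poly"
    using that by (auto simp: weyman_im_def)
  have iota: "?p (iota P) = 0" for P by (simp add: iota_eq)
  have "dual_coords u v ?p \<in> weyman_K u v"
    by (rule weyman_K_functional) (use iota im in \<open>auto simp: scaleU_def\<close>)
  also have "dual_coords u v ?p = (\<lambda>(i, j). if i \<le> u \<and> j \<le> v then t ^ i * t ^ j else 0)"
    by (auto simp: dual_coords_def fun_eq_iff tensorU_monom poly_monom)
  finally show ?point .
  have "?p (pderiv (iota P)) = - ?p P" for P by (simp add: iota_eq pderiv_mult pderiv_pCons del: mult_pCons_left)
  hence iota': "?p (pderiv (iota (iota P))) = 0" for P using iota by simp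
  have "dual_coords u v (\<lambda>P. ?p (pderiv P)) \<in> weyman_K u v"
    by (rule weyman_K_functional) (use iota' im in \<open>auto simp: scaleU_def pderiv_add pderiv_smult\<close>)
  also have "dual_coords u v (\<lambda>P. ?p (pderiv P)) =
      (\<lambda>(i, j). if i \<le> u \<and> j \<le> v then of_nat i * t ^ (i - 1) * t ^ j else 0)"
    by (auto simp: dual_coords_def fun_eq_iff tensorU_monom poly_monom pderiv_monom)
  finally show ?tangent .
qed

lemma koszul_mid_functional:
  fixes \<Lambda> :: "((nat \<Rightarrow> (nat, nat, 'a::field) sym_alg) \<times> (nat \<Rightarrow> (nat, nat, 'a) sym_alg)) \<Rightarrow> 'a"
  assumes add: "\<And>p q. \<Lambda> (p + q) = \<Lambda> p + \<Lambda> q"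
    and P: "\<And>i. i \<notin> I \<Longrightarrow> P i = 0" and Q: "\<And>j. j \<notin> J \<Longrightarrow> Q j = 0" and fin: "finite I" "finite J"
  shows "\<Lambda> (P, Q) = (\<Sum>i\<in>I. \<Lambda> (0(i := P i), 0)) + (\<Sum>j\<in>J. \<Lambda> (0, 0(j := Q j)))"
proof -
  have z: "\<Lambda> 0 = 0" using add[of 0 0] by (simp only: add_0_left add_cancel_right_right)
  have "\<Lambda> (P, 0) = (\<Sum>i\<in>I. \<Lambda> (0(i := P i), 0))" using fin(1) P
  proof (induction I arbitrary: P rule: finite_induct)
    case empty
    hence "P = 0" by (auto simp: fun_eq_iff)
    thus ?case using z by (simp only: zero_prod_def sum.empty)
  next
    case (insert i I)
    have "\<Lambda> (P, 0) = \<Lambda> (0(i := P i), 0) + \<Lambda> (P(i := 0), 0)"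
      unfolding add[symmetric] by (rule arg_cong[of _ _ \<Lambda>]) (auto simp: plus_prod_def fun_eq_iff)
    moreover have "\<Lambda> (P(i := 0), 0) = (\<Sum>k\<in>I. \<Lambda> (0(k := (P(i := 0)) k), 0))"
      by (rule insert.IH) (use insert.prems in auto)
    moreover have "\<dots> = (\<Sum>k\<in>I. \<Lambda> (0(k := P k), 0))"
      using insert.hyps by (intro sum.cong) auto
    ultimately show ?case using insert.hyps by (simp only: sum.insert not_False_eq_True)
  qed
  moreover have "\<Lambda> (0, Q) = (\<Sum>j\<in>J. \<Lambda> (0, 0(j := Q j)))" using fin(2) Q
  proof (induction J arbitrary: Q rule: finite_induct)
    case empty
    hence "Q = 0" by (auto simp: fun_eq_iff)
    thus ?case using z by (simp only: zero_prod_def sum.empty)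
  next
    case (insert i J)
    have "\<Lambda> (0, Q) = \<Lambda> (0, 0(i := Q i)) + \<Lambda> (0, Q(i := 0))"
      unfolding add[symmetric] by (rule arg_cong[of _ _ \<Lambda>]) (auto simp: plus_prod_def fun_eq_iff)
    moreover have "\<Lambda> (0, Q(i := 0)) = (\<Sum>k\<in>J. \<Lambda> (0, 0(k := (Q(i := 0)) k)))"
      by (rule insert.IH) (use insert.prems in auto)
    moreover have "\<dots> = (\<Sum>k\<in>J. \<Lambda> (0, 0(k := Q k)))"
      using insert.hyps by (intro sum.cong) auto
    ultimately show ?case using insert.hyps by (simp only: sum.insert not_False_eq_True)
  qed
  moreover have "\<Lambda> (P, Q) = \<Lambda> (P, 0) + \<Lambda> (0, Q)"
    using add[of "(P, 0)" "(0, Q)"] by (simp add: plus_prod_def)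
  ultimately show ?thesis by simp
qed

lemma subspace_koszul_boundaries:
  fixes K :: "('i \<times> 'j \<Rightarrow> 'a::field) set"
  shows "module.subspace pair_scale (koszul_d2 I J ` koszul_left I J K d e)"
proof -
  interpret A: vector_space sym_scale by (rule vector_space_scales)
  interpret B: vector_space tensor_scale by (rule vector_space_scales)
  interpret C: vector_space pair_scale by (rule vector_space_scales)
  interpret lin: Vector_Spaces.linear tensor_scale pair_scale "koszul_d2 I J"
    by unfold_locales
      (auto simp: koszul_d2_def pair_scale_def tensor_scale_def sym_scale_simps distrib_left
        sum.distrib fun_eq_iff A.scale_sum_right A.scale_minus_right)
  show ?thesis unfolding koszul_left_def by (intro lin.subspace_image B.subspace_span)
qed

lemma weyman_exact:
  fixes A B :: "nat \<Rightarrow> (nat, nat, 'a::{field,infinite}) sym_alg"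
  assumes uv: "u \<ge> 1" "v \<ge> 1" and de: "d \<ge> v" "e \<ge> u"
    and nz: "\<And>n. 0 < n \<Longrightarrow> n \<le> u + v \<Longrightarrow> of_nat n \<noteq> (0 :: 'a)"
    and AB: "(A, B) \<in> koszul_mid {0..u} {0..v} d e" and d1: "koszul_d1 {0..u} {0..v} (A, B) = 0"
  shows "(A, B) \<in> koszul_d2 {0..u} {0..v} ` koszul_left {0..u} {0..v} (weyman_K u v) d e" (is "_ \<in> ?B")
proof (rule ccontr)
  assume notin: "(A, B) \<notin> ?B"
  interpret ts: vector_space "tensor_scale :: 'a \<Rightarrow> (nat \<times> nat \<Rightarrow> (nat, nat, 'a) sym_alg) \<Rightarrow> _" by (rule vector_space_scales)
  from vanishing_functional[OF vector_space_scales(3) subspace_koszul_boundaries notin]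
  obtain \<Lambda> :: "_ \<Rightarrow> 'a" where \<Lambda>: "Vector_Spaces.linear pair_scale (*) \<Lambda>" "\<And>y. y \<in> ?B \<Longrightarrow> \<Lambda> y = 0" "\<Lambda> (A, B) = 1"
    by blast
  interpret \<Lambda>: Vector_Spaces.linear pair_scale "(*) :: 'a \<Rightarrow> 'a \<Rightarrow> 'a" \<Lambda> by (rule \<Lambda>(1))
  define LA where "LA i F = \<Lambda> (0(i := F), 0)" for i F
  define LB where "LB j F = \<Lambda> (0, 0(j := F))" for j F
  have LA: "linear_form (LA i)" and LB: "linear_form (LB i)" for i
  proof -
    have "\<Lambda> (0(i := F + G), 0) = \<Lambda> (0(i := F), 0) + \<Lambda> (0(i := G), 0)"
      "\<Lambda> (0, 0(i := F + G)) = \<Lambda> (0, 0(i := F)) + \<Lambda> (0, 0(i := G))"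
      "\<Lambda> (0(i := sym_scale c F), 0) = c * \<Lambda> (0(i := F), 0)"
      "\<Lambda> (0, 0(i := sym_scale c F)) = c * \<Lambda> (0, 0(i := F))" for F G c
      unfolding \<Lambda>.add[symmetric] \<Lambda>.scale[symmetric]
      by (rule arg_cong[of _ _ \<Lambda>]; auto simp: plus_prod_def fun_eq_iff pair_scale_def tensor_scale_def sym_scale_def)+
    thus "linear_form (LA i)" "linear_form (LB i)"
      by (simp_all add: linear_form_def LA_def LB_def)
  qed
  have \<Lambda>_eq: "\<Lambda> (P, Q) = (\<Sum>i\<in>{0..u}. LA i (P i)) + (\<Sum>j\<in>{0..v}. LB j (Q j))"
    if "\<And>i. i \<notin> {0..u} \<Longrightarrow> P i = 0" "\<And>j. j \<notin> {0..v} \<Longrightarrow> Q j = 0" for P Q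
    unfolding LA_def LB_def by (rule koszul_mid_functional) (use that \<Lambda>.add in auto)
  \<comment> \<open>Vanishing of \<open>\<Lambda>\<close> on the image of a pure tensor, in
    coordinates; the minus sign is that of the second component of \<open>koszul_d2\<close>.\<close>
  have rel: "(\<Sum>i\<le>u. \<Sum>j\<le>v. f i j * (LA i (sym_var (Inr j) * F) - LB j (sym_var (Inl i) * F))) = 0"
    if w: "(\<lambda>(i, j). if i \<le> u \<and> j \<le> v then f i j else 0) \<in> weyman_K u v" and F: "F \<in> sym_comp {0..u} {0..v} d e" for f F
  proof -
    define w where "w = (\<lambda>(i, j). if i \<le> u \<and> j \<le> v then f i j else 0)"
    have "pure_tensor w F \<in> koszul_left {0..u} {0..v} (weyman_K u v) d e"
      unfolding koszul_left_def w_def using w F by (intro ts.span_base) blast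
    hence "\<Lambda> (koszul_d2 {0..u} {0..v} (pure_tensor w F)) = 0" by (intro \<Lambda>(2)) blast
    moreover have "\<Lambda> (koszul_d2 {0..u} {0..v} (pure_tensor w F)) =
        (\<Sum>i\<in>{0..u}. LA i (\<Sum>j\<in>{0..v}. sym_var (Inr j) * pure_tensor w F (i, j))) +
        (\<Sum>j\<in>{0..v}. LB j (- (\<Sum>i\<in>{0..u}. sym_var (Inl i) * pure_tensor w F (i, j))))"
      unfolding koszul_d2_def by (rule \<Lambda>_eq) (auto simp: pure_tensor_def w_def sym_scale_def sum.neutral)
    moreover have "LA i (\<Sum>j\<in>{0..v}. sym_var (Inr j) * pure_tensor w F (i, j)) =
        (\<Sum>j\<le>v. f i j * LA i (sym_var (Inr j) * F))" if "i \<in> {0..u}" for i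
      using that unfolding linear_form_sum[OF LA] atLeast0AtMost
      by (intro sum.cong) (auto simp: pure_tensor_def w_def sym_scale_simps linear_form_scale[OF LA])
    moreover have "LB j (- (\<Sum>i\<in>{0..u}. sym_var (Inl i) * pure_tensor w F (i, j))) =
        - (\<Sum>i\<le>u. f i j * LB j (sym_var (Inl i) * F))" if "j \<in> {0..v}" for j
      using that unfolding linear_form_sum[OF LB] linear_form_minus[OF LB] atLeast0AtMost
      by (intro arg_cong[of _ _ uminus] sum.cong)
        (auto simp: pure_tensor_def w_def sym_scale_simps linear_form_scale[OF LB])
    ultimately have "(\<Sum>i\<le>u. \<Sum>j\<le>v. f i j * LA i (sym_var (Inr j) * F)) +
        (\<Sum>j\<le>v. - (\<Sum>i\<le>u. f i j * LB j (sym_var (Inl i) * F))) = 0"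
      by (simp add: atLeast0AtMost)
    also have "(\<Sum>j\<le>v. - (\<Sum>i\<le>u. f i j * LB j (sym_var (Inl i) * F))) =
        - (\<Sum>i\<le>u. \<Sum>j\<le>v. f i j * LB j (sym_var (Inl i) * F))"
      unfolding sum_negf by (subst sum.swap) simp
    finally show ?thesis by (simp add: right_diff_distrib sum_subtractf)
  qed
  have cross: "LA i (sym_var (Inr j) * F) = LB j (sym_var (Inl i) * F)"
    if "i \<in> {0..u}" "j \<in> {0..v}" "F \<in> sym_comp {0..u} {0..v} d e" for i j F
    using that by (intro cross_relation[OF uv de nz LA LB rel[OF weyman_K_point] rel[OF weyman_K_tangent]]) auto
  obtain L where L: "linear_form L"
    "\<And>i F. i \<in> {0..u} \<Longrightarrow> F \<in> sym_comp {0..u} {0..v} d (e + 1) \<Longrightarrow> L (sym_var (Inl i) * F) = LA i F"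
    "\<And>j F. j \<in> {0..v} \<Longrightarrow> F \<in> sym_comp {0..u} {0..v} (d + 1) e \<Longrightarrow> L (sym_var (Inr j) * F) = LB j F"
    using cross_relation_common_extension[of "{0..u}" "{0..v}" LA LB d e] LA LB cross by blast
  have A: "A i \<in> sym_comp {0..u} {0..v} d (e + 1)" if "i \<in> {0..u}" for i
    using AB that by (simp add: koszul_mid_def coord_space_def)
  have B: "B j \<in> sym_comp {0..u} {0..v} (d + 1) e" if "j \<in> {0..v}" for j
    using AB that by (simp add: koszul_mid_def coord_space_def)
  have "1 = (\<Sum>i\<in>{0..u}. LA i (A i)) + (\<Sum>j\<in>{0..v}. LB j (B j))"
    using AB \<Lambda>(3) \<Lambda>_eq[of A B] by (simp add: koszul_mid_def coord_space_def)
  also have "\<dots> = (\<Sum>i\<in>{0..u}. L (sym_var (Inl i) * A i)) + (\<Sum>j\<in>{0..v}. L (sym_var (Inr j) * B j))"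
    using A B by (simp only: L(2,3) cong: sum.cong)
  also have "\<dots> = L (koszul_d1 {0..u} {0..v} (A, B))"
    by (simp add: koszul_d1_def linear_form_add[OF L(1)] linear_form_sum[OF L(1)])
  also have "\<dots> = 0" by (simp add: d1 linear_form_0[OF L(1)])
  finally show False by simp
qed

theorem theorem1p11:
  fixes u v d e p :: nat
  assumes "CHAR('k::alg_closed_field) = p"
    and "u \<ge> 1" and "v \<ge> 1"
    and "p = 0 \<or> p > u + v"
    and "d \<ge> v" and "e \<ge> u"
  shows "carrier (weyman_module u v d e :: ('k, _) module) =
    {\<zero>\<^bsub>weyman_module u v d e\<^esub>}"
proof -
  let ?Z = "{AB \<in> koszul_mid {0..u} {0..v} d e. koszul_d1 {0..u} {0..v} AB = (0 :: (nat, nat, 'k) sym_alg)}"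
  let ?B = "koszul_d2 {0..u} {0..v} ` koszul_left {0..u} {0..v} (weyman_K u v :: (nat \<times> nat \<Rightarrow> 'k) set) d e"
  \<comment> \<open>A positive integer up to \<open>u + v\<close> is not divisible by the
    characteristic.\<close>
  have nz: "of_nat n \<noteq> (0 :: 'k)" if "0 < n" "n \<le> u + v" for n
    using assms(1,4) that dvd_imp_le[of p n] by (auto simp: of_nat_eq_0_iff_char_dvd)
  have sub: "?Z \<subseteq> ?B"
  proof
    fix AB assume "AB \<in> ?Z"
    thus "AB \<in> ?B" using weyman_exact[OF assms(2,3,5,6) nz, of "fst AB" "snd AB"] by simp
  qed
  interpret M: module "ring_of_type_algebra :: 'k ring" "weyman_module u v d e :: ('k, _) module"
    by (rule module_weyman_module)
  have zero: "\<zero>\<^bsub>weyman_module u v d e\<^esub> = ?B"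
    by (simp add: weyman_module_def koszul_module_def quotient_space_def)
  \<comment> \<open>Cycles are boundaries, so every coset is the zero coset.\<close>
  have "C = ?B" if C: "C \<in> carrier (weyman_module u v d e :: ('k, _) module)" for C
  proof -
    obtain z where z: "z \<in> ?Z" "C = coset ?B z"
      using C by (auto simp: weyman_module_def koszul_module_def carrier_quotient_space)
    interpret ps: vector_space "pair_scale :: 'k \<Rightarrow> (nat \<Rightarrow> (nat, nat, 'k) sym_alg) \<times> (nat \<Rightarrow> (nat, nat, 'k) sym_alg) \<Rightarrow> _"
      by (rule vector_space_scales)
    have zB: "z \<in> ?B" using sub z(1) by blast
    have "b \<in> coset ?B z" if "b \<in> ?B" for b
    proof -
      have "b = z + (b - z)" "b - z \<in> ?B" using ps.subspace_diff[OF subspace_koszul_boundaries that zB] by auto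
      thus ?thesis unfolding coset_def by blast
    qed
    moreover have "b \<in> ?B" if "b \<in> coset ?B z" for b
      using that ps.subspace_add[OF subspace_koszul_boundaries zB] by (auto simp: coset_def)
    ultimately show ?thesis using z(2) by blast
  qed
  moreover have "\<zero>\<^bsub>weyman_module u v d e\<^esub> \<in> carrier (weyman_module u v d e :: ('k, _) module)"
    by (rule M.M.zero_closed)
  ultimately show ?thesis unfolding zero by blast
qed

end
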